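(* Let $(\mathbb{R}^d,\cdot,X,K)$ be a sub-Finsler nilpotent group. The isoperimetric profile $I_K:(0,\infty)\to[0,\infty)$ is a locally Lipschitz function.
   Context: Setting. A nilpotent group is a connected, simply connected Lie group $G$ whose Lie algebra $\mathfrak{g}$ is nilpotent. With $\mathfrak{g}_0=\mathfrak{g}$, $\mathfrak{g}_{i+1}=[\mathfrak{g},\mathfrak{g}_i]$ and $r$ the step ($\mathfrak{g}_r=0\ne\mathfrak{g}_{r-1}$), fix a Malcev basis $\{Y_1,\dots,Y_d\}$ of $\mathfrak{g}$, i.e. a basis such that each $\mathrm{span}\{Y_{d-n+1},\dots,Y_d\}$, $1\le n\le d$, is an ideal and each $\mathfrak{g}_i$, $0\le i\le r-1$, is one of these ideals. Identify $G$ with $(\mathbb{R}^d,\cdot)$ via $(x_1,\dots,x_d)\mapsto\exp(x_1Y_1+\dots+x_dY_d)$; the identity is $0$. The Lebesgue measure $|\cdot|$ of $\mathbb{R}^d$ is then a Haar measure of the group. $X=\{X_1,\dots,X_k\}$ is a system of linearly independent left-invariant vector fields. Put $\mathcal{H}^0=\mathrm{span}(X)$ and $\mathcal{H}^n=\mathcal{H}^{n-1}+[\mathcal{H}^{n-1},\mathcal{H}^0]$; $X$ is assumed to be Lie bracket generating, i.e. $\mathcal{H}^s(0)=\mathfrak{g}$ for some $s$. Vector fields tangent to $\mathcal{H}^0$ at every point are called horizontal. Fix a left-invariant Riemannian metric $g=\langle\cdot,\cdot\rangle$ for which $X$ is an orthonormal basis of $\mathcal{H}^0$ and $\mathcal{H}^0$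 is orthogonal to a chosen complementary subbundle $V$; $\operatorname{div}$ is the divergence with respect to $g$. $K\subset\mathcal{H}^0_0$ is a convex body (compact convex set) with $0$ in its interior (relative to $\mathcal{H}^0_0$), not necessarily symmetric. It defines the asymmetric norm $\|u\|_K=\inf\{\lambda\ge0:u\in\lambda K\}$ on $\mathcal{H}^0_0$, extended to $\mathcal{H}^0$ by left-invariance: $\|\sum_i a_iX_i(p)\|_K=\|\sum_i a_iX_i(0)\|_K$. The data $(\mathbb{R}^d,\cdot,X,K)$ is called a sub-Finsler nilpotent group. Perimeter. For a measurable set $E\subseteq\mathbb{R}^d$, $P_K(E)=\sup\{\int_E\operatorname{div}(U)\,dx\}$, the supremum being over compactly supported $C^1$ horizontal vector fields $U$ on $\mathbb{R}^d$ with $\sup_p\|U_p\|_K\le1$. $E$ is a finite perimeter set if $P_K(E)<+\infty$. Isoperimetric profile. For $v>0$, $I_K(v)=\inf\{P_K(E): E\subseteq\mathbb{R}^d \text{ is a finite perimeter set and } |E|=v\}$. *)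

theory Defs
  imports "HOL-Analysis.Analysis"
begin

section \<open>Smooth maps and vector fields on Euclidean space\<close>

primrec C_k :: "nat \<Rightarrow> ('a::euclidean_space \<Rightarrow> 'b::euclidean_space) \<Rightarrow> bool" where
  "C_k 0 f \<longleftrightarrow> continuous_on UNIV f"
| "C_k (Suc k) f \<longleftrightarrow>
     (\<exists>f'. (\<forall>x. (f has_derivative f' x) (at x)) \<and> (\<forall>v. C_k k (\<lambda>x. f' x v)))"

definition smooth :: "('a::euclidean_space \<Rightarrow> 'b::euclidean_space) \<Rightarrow> bool" where
  "smooth f \<longleftrightarrow> (\<forall>k. C_k k f)"

text \<open>A vector field is given by its components in the global coordinates, so every tangent
  space is \<open>'a\<close> itself.\<close>

type_synonym 'a vector_field = "'a \<Rightarrow> 'a"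

definition lie_bracket :: "'a::euclidean_space vector_field \<Rightarrow> 'a vector_field \<Rightarrow> 'a vector_field" where
  "lie_bracket U W p = frechet_derivative W (at p) (U p) - frechet_derivative U (at p) (W p)"

definition compactly_supported :: "('a::euclidean_space \<Rightarrow> 'b::real_vector) \<Rightarrow> bool" where
  "compactly_supported U \<longleftrightarrow> compact (closure {p. U p \<noteq> 0})"


section \<open>Lie algebra of a group law on \<open>\<real>\<^sup>d\<close>\<close>

text \<open>The differential at \<open>p\<close> of the left translation by \<open>a\<close>.\<close>

definition dL :: "('a::euclidean_space \<Rightarrow> 'a \<Rightarrow> 'a) \<Rightarrow> 'a \<Rightarrow> 'a \<Rightarrow> 'a \<Rightarrow> 'a" where
  "dL mul a p = frechet_derivative (mul a) (at p)"

definition left_invariant :: "('a::euclidean_space \<Rightarrow> 'a \<Rightarrow> 'a) \<Rightarrow> 'a vector_field \<Rightarrow> bool" where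
  "left_invariant mul U \<longleftrightarrow> (\<forall>a p. U (mul a p) = dL mul a p (U p))"

definition left_ext :: "('a::euclidean_space \<Rightarrow> 'a \<Rightarrow> 'a) \<Rightarrow> 'a \<Rightarrow> 'a vector_field" where
  "left_ext mul u p = dL mul p 0 u"

text \<open>The Lie algebra is the tangent space at the identity \<open>0\<close>, with the bracket of the
  corresponding left-invariant vector fields.\<close>

definition bracket :: "('a::euclidean_space \<Rightarrow> 'a \<Rightarrow> 'a) \<Rightarrow> 'a \<Rightarrow> 'a \<Rightarrow> 'a" where
  "bracket mul u w = lie_bracket (left_ext mul u) (left_ext mul w) 0"

definition bracket_span :: "('a::euclidean_space \<Rightarrow> 'a \<Rightarrow> 'a) \<Rightarrow> 'a set \<Rightarrow> 'a set \<Rightarrow> 'a set" where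
  "bracket_span mul A B = span {bracket mul u w |u w. u \<in> A \<and> w \<in> B}"

definition lie_ideal :: "('a::euclidean_space \<Rightarrow> 'a \<Rightarrow> 'a) \<Rightarrow> 'a set \<Rightarrow> bool" where
  "lie_ideal mul I \<longleftrightarrow> subspace I \<and> (\<forall>u. \<forall>w\<in>I. bracket mul u w \<in> I)"

primrec lower_central :: "('a::euclidean_space \<Rightarrow> 'a \<Rightarrow> 'a) \<Rightarrow> nat \<Rightarrow> 'a set" where
  "lower_central mul 0 = UNIV"
| "lower_central mul (Suc i) = bracket_span mul UNIV (lower_central mul i)"


section \<open>Nilpotent groups in exponential coordinates of a Malcev basis\<close>

text \<open>The index type \<open>'n\<close> is a finite linear order, i.e. \<open>{1,\<dots>,d}\<close>. For the group
  law transported to \<open>\<real>\<^sup>d\<close> by \<open>x \<mapsto> exp (x\<^sub>1 Y\<^sub>1 + \<dots> + x\<^sub>d Y\<^sub>d)\<close>, the basis vector \<open>Y\<^sub>i\<close>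
  becomes the \<open>i\<close>-th standard vector \<open>axis i 1\<close> of the tangent space at \<open>0\<close>, and
  \<open>malcev_ideal i\<close> is the span of \<open>Y\<^sub>j\<close>, \<open>j \<ge> i\<close>.\<close>

definition malcev_ideal :: "'n::{finite,linorder} \<Rightarrow> (real^'n::{finite,linorder}) set" where
  "malcev_ideal i = span {axis j 1 |j. i \<le> j}"

text \<open>The assumption \<open>exp_coord\<close> says that \<open>t \<mapsto> t x\<close> is a one-parameter subgroup; its
  velocity at \<open>t = 0\<close> is \<open>x\<close>. Hence the exponential map is the identity map of \<open>\<real>\<^sup>d\<close>, which
  is what characterises exponential coordinates. Connectedness and simple connectedness hold
  because the underlying manifold is \<open>\<real>\<^sup>d\<close>.\<close>

locale nilpotent_group =
  fixes mul :: "real^'n::{finite,linorder} \<Rightarrow> real^'n::{finite,linorder} \<Rightarrow> real^'n::{finite,linorder}"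
    and r :: nat
  assumes group_law: "Groups.group mul 0 uminus"
    and smooth_law: "smooth (\<lambda>(x, y). mul x y)"
    and exp_coord: "mul (s *\<^sub>R x) (t *\<^sub>R x) = (s + t) *\<^sub>R x"
    and step_pos: "r \<ge> 1"
    and step: "lower_central mul r = {0}" "lower_central mul (r - 1) \<noteq> {0}"
    and malcev_is_ideal: "lie_ideal mul (malcev_ideal i)"
    and malcev_lower_central: "m \<le> r - 1 \<Longrightarrow> \<exists>i. lower_central mul m = malcev_ideal i"


section \<open>Sub-Finsler structures\<close>

definition hor :: "('k::finite \<Rightarrow> 'a::euclidean_space vector_field) \<Rightarrow> 'a \<Rightarrow> 'a set" where
  "hor X p = span (range (\<lambda>i. X i p))"

text \<open>The spaces \<open>\<H>\<^sup>n(0)\<close>, generated within the Lie algebra from \<open>\<H>\<^sup>0(0)\<close>.\<close>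

primrec hor_iter :: "('a::euclidean_space \<Rightarrow> 'a \<Rightarrow> 'a) \<Rightarrow> ('k::finite \<Rightarrow> 'a vector_field) \<Rightarrow> nat \<Rightarrow> 'a set"
  where
  "hor_iter mul X 0 = hor X 0"
| "hor_iter mul X (Suc n) =
     {a + b |a b. a \<in> hor_iter mul X n \<and> b \<in> bracket_span mul (hor_iter mul X n) (hor X 0)}"

locale sub_finsler_nilpotent_group = nilpotent_group mul r
  for mul :: "real^'n::{finite,linorder} \<Rightarrow> real^'n::{finite,linorder} \<Rightarrow> real^'n::{finite,linorder}" and r :: nat +
  fixes X :: "'k::finite \<Rightarrow> (real^'n::{finite,linorder}) vector_field"
    and V :: "real^'n::{finite,linorder} \<Rightarrow> (real^'n::{finite,linorder}) set"
    and g :: "real^'n::{finite,linorder} \<Rightarrow> real^'n::{finite,linorder} \<Rightarrow> real^'n::{finite,linorder} \<Rightarrow> real"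
    and K :: "(real^'n::{finite,linorder}) set"
  assumes X_left_invariant: "left_invariant mul (X i)"
    and X_independent: "(\<And>p. (\<Sum>i\<in>UNIV. c i *\<^sub>R X i p) = 0) \<Longrightarrow> c i = 0"
    and bracket_generating: "\<exists>s. hor_iter mul X s = UNIV"
    and V_subspace: "subspace (V p)"
    and V_complement: "hor X p \<inter> V p = {0}" "{a + b |a b. a \<in> hor X p \<and> b \<in> V p} = UNIV"
    and g_bilinear: "bilinear (g p)"
    and g_sym: "g p u w = g p w u"
    and g_pos: "u \<noteq> 0 \<Longrightarrow> g p u u > 0"
    and g_left_invariant: "g (mul a p) (dL mul a p u) (dL mul a p w) = g p u w"
    and X_orthonormal: "g p (X i p) (X j p) = (if i = j then 1 else 0)"
    and V_orthogonal: "u \<in> hor X p \<Longrightarrow> w \<in> V p \<Longrightarrow> g p u w = 0"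
    and K_horizontal: "K \<subseteq> hor X 0"
    and K_compact: "compact K"
    and K_convex: "convex K"
    and K_zero_interior: "0 \<in> (top_of_set (hor X 0)) interior_of K"

definition gauge :: "'a::real_vector set \<Rightarrow> 'a \<Rightarrow> real" where
  "gauge K u = Inf {l. l \<ge> 0 \<and> u \<in> (\<lambda>x. l *\<^sub>R x) ` K}"

definition hor_coeff :: "('k::finite \<Rightarrow> 'a::euclidean_space vector_field) \<Rightarrow> 'a \<Rightarrow> 'a \<Rightarrow> 'k \<Rightarrow> real" where
  "hor_coeff X p u = (THE a. u = (\<Sum>i\<in>UNIV. a i *\<^sub>R X i p))"

definition norm_K :: "('k::finite \<Rightarrow> 'a::euclidean_space vector_field) \<Rightarrow> 'a set \<Rightarrow> 'a \<Rightarrow> 'a \<Rightarrow> real" where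
  "norm_K X K p u = gauge K (\<Sum>i\<in>UNIV. hor_coeff X p u i *\<^sub>R X i 0)"


section \<open>Divergence, perimeter and isoperimetric profile\<close>

text \<open>Riemannian divergence in coordinates,
  \<open>div U = (1 / sqrt (det G)) \<Sum>\<^sub>i \<partial>\<^sub>i (sqrt (det G) U\<^sub>i)\<close>, with \<open>G\<close> the Gram matrix of \<open>g\<close>.\<close>

definition gram :: "(real^'n \<Rightarrow> real^'n \<Rightarrow> real^'n \<Rightarrow> real) \<Rightarrow> real^'n \<Rightarrow> real^'n^'n::finite" where
  "gram g p = (\<chi> i j. g p (axis i 1) (axis j 1))"

definition divergence ::
    "(real^'n::finite \<Rightarrow> real^'n \<Rightarrow> real^'n \<Rightarrow> real) \<Rightarrow> (real^'n) vector_field \<Rightarrow> real^'n \<Rightarrow> real" where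
  "divergence g U p =
     (\<Sum>i\<in>UNIV. frechet_derivative (\<lambda>q. sqrt (det (gram g q)) * U q $ i) (at p) (axis i 1))
       / sqrt (det (gram g p))"

definition admissible_fields ::
    "('k::finite \<Rightarrow> (real^'n::finite) vector_field) \<Rightarrow> (real^'n) set \<Rightarrow> (real^'n) vector_field set" where
  "admissible_fields X K =
     {U. C_k 1 U \<and> compactly_supported U \<and> (\<forall>p. U p \<in> hor X p) \<and> (\<forall>p. norm_K X K p (U p) \<le> 1)}"

definition perimeter ::
    "('k::finite \<Rightarrow> (real^'n::finite) vector_field) \<Rightarrow> (real^'n \<Rightarrow> real^'n \<Rightarrow> real^'n \<Rightarrow> real)
       \<Rightarrow> (real^'n) set \<Rightarrow> (real^'n) set \<Rightarrow> ereal" where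
  "perimeter X g K E =
     (SUP U\<in>admissible_fields X K. ereal (set_lebesgue_integral lebesgue E (divergence g U)))"

definition finite_perimeter_set ::
    "('k::finite \<Rightarrow> (real^'n::finite) vector_field) \<Rightarrow> (real^'n \<Rightarrow> real^'n \<Rightarrow> real^'n \<Rightarrow> real)
       \<Rightarrow> (real^'n) set \<Rightarrow> (real^'n) set \<Rightarrow> bool" where
  "finite_perimeter_set X g K E \<longleftrightarrow> E \<in> sets lebesgue \<and> perimeter X g K E < \<infinity>"

text \<open>The infimum is taken in the extended reals, so that it is \<open>\<infinity>\<close> rather than an
  unspecified real number should there be no competitor.\<close>

definition isoperimetric_profile ::
    "('k::finite \<Rightarrow> (real^'n::finite) vector_field) \<Rightarrow> (real^'n \<Rightarrow> real^'n \<Rightarrow> real^'n \<Rightarrow> real)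
       \<Rightarrow> (real^'n) set \<Rightarrow> real \<Rightarrow> ereal" where
  "isoperimetric_profile X g K v =
     (INF E\<in>{E. finite_perimeter_set X g K E \<and> emeasure lebesgue E = ennreal v}. perimeter X g K E)"

definition locally_lipschitz_on :: "real set \<Rightarrow> (real \<Rightarrow> real) \<Rightarrow> bool" where
  "locally_lipschitz_on S f \<longleftrightarrow> (\<forall>x\<in>S. \<exists>e>0. \<exists>L. L-lipschitz_on (ball x e \<inter> S) f)"

end

theory Submission
  imports Defs
begin

text \<open>
  The isoperimetric profile \<open>I\<close> is nonnegative and midpoint concave,
  \<open>I (v - w) + I (v + w) \<le> 2 * I v\<close> for \<open>0 < w < v\<close>. These two properties force local Lipschitz
  continuity: \<open>I\<close> cannot decrease, since a decrease would persist and make it negative, and an increment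
  is at most the average of the increments to its left, whose sum is bounded by the value of \<open>I\<close>
  (\<open>locally_lipschitz_if_midpoint_concave\<close>).

  Midpoint concavity comes from intersecting a set with a translate of itself. Let \<open>E\<close> have volume \<open>v\<close>.
  A left translate \<open>F\<close> of \<open>E\<close> has the same volume and the same perimeter. The volume of \<open>E \<inter> F\<close> depends
  continuously on the translation, is \<open>v\<close> for the identity and tends to \<open>0\<close> at infinity. Hence some
  translate satisfies \<open>\<bar>E \<inter> F\<bar> = v - w\<close>, so that \<open>\<bar>E \<union> F\<bar> = v + w\<close> (\<open>exists_translate_overlap\<close>). The
  perimeter is submodular (\<open>variation_submodular\<close>), so \<open>P (E \<inter> F) + P (E \<union> F) \<le> 2 * P E\<close>, and the
  infimum over \<open>E\<close> gives the inequality for \<open>I\<close>. Cubes have finite perimeter, so \<open>I\<close> is finite.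

  Submodularity holds for the supremum of \<open>\<integral>\<^sub>E div U\<close> over all compactly supported \<open>C\<^sup>1\<close> fields with values
  in prescribed convex sets. Given test fields \<open>U\<close> for \<open>E \<inter> F\<close> and \<open>W\<close> for \<open>E \<union> F\<close>, test \<open>E\<close> with a field
  that is close to \<open>U\<close> on \<open>F\<close> and to \<open>W\<close> elsewhere, and \<open>F\<close> with one that is close to \<open>U\<close> on \<open>E\<close> and to \<open>W\<close>
  elsewhere. The transition is made with mollified indicators. Their gradients blow up, but they enter
  only through a commutator of mollification with the field \<open>Z = U - W\<close>, which converges to
  \<open>- \<integral> div Z\<close> over \<open>E \<inter> F\<close> (\<open>commutator_tendsto\<close>).

  Left invariance rests on the fact that left translations preserve Lebesgue measure. In exponential
  coordinates the differential of the exponential map, trivialised by left translations, solves a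
  linear differential equation along rays. Its coefficient \<open>ad x\<close> is strictly triangular in a Malcev
  basis, so the differentials of left translations are unipotent (\<open>lower_unipotent_dL\<close>) and have
  determinant \<open>1\<close>. For the same reason the Gram determinant of the metric is constant, and the
  Riemannian divergence is the Euclidean one (\<open>divergence_eq\<close>).
\<close>

section \<open>Midpoint concavity\<close>

text \<open>The increments of a concave sequence decrease, so each of them lies below the first one and
  below the average of its predecessors.\<close>

lemma concave_sequence_bounds:
  fixes a :: "nat \<Rightarrow> real"
  assumes conc: "\<And>n. a n + a (Suc (Suc n)) \<le> 2 * a (Suc n)"
  shows "a n \<le> a 0 + real n * (a 1 - a 0)"
    and "real n * (a (Suc n) - a n) \<le> a n - a 0"
proof -
  have decr: "a (Suc n) - a n \<le> a 1 - a 0" for n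
  proof (induction n)
    case (Suc n)
    then show ?case using conc[of n] by simp
  qed simp
  show "a n \<le> a 0 + real n * (a 1 - a 0)"
  proof (induction n)
    case (Suc n)
    then show ?case using decr[of n] by (simp add: algebra_simps)
  qed simp
  show "real n * (a (Suc n) - a n) \<le> a n - a 0"
  proof (induction n)
    case (Suc n)
    have "real (Suc n) * (a (Suc (Suc n)) - a (Suc n)) \<le> real (Suc n) * (a (Suc n) - a n)"
      using conc[of n] by (intro mult_left_mono) auto
    also have "\<dots> \<le> a (Suc n) - a 0"
      using Suc by (simp add: algebra_simps)
    finally show ?case .
  qed simp
qed

text \<open>A decrease of \<open>f\<close> would be repeated along an arithmetic progression and push \<open>f\<close> below \<open>0\<close>, so
  \<open>f\<close> is nondecreasing. If \<open>n\<close> translates of an interval fit between \<open>0\<close> and its left end, the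
  increment over the interval is at most \<open>1 / n\<close> times the value at that end. For intervals of
  length \<open>h\<close> near \<open>x0\<close> about \<open>x0 / (4 * h)\<close> translates fit, which produces the Lipschitz constant
  \<open>4 * f (2 * x0) / x0\<close>.\<close>

lemma locally_lipschitz_if_midpoint_concave:
  fixes f :: "real \<Rightarrow> real"
  assumes nonneg: "\<And>v. v > 0 \<Longrightarrow> 0 \<le> f v"
    and conc: "\<And>v w. 0 < w \<Longrightarrow> w < v \<Longrightarrow> f (v - w) + f (v + w) \<le> 2 * f v"
  shows "locally_lipschitz_on {0<..} f"
proof -
  have seq: "f (x + real n * h) + f (x + real (Suc (Suc n)) * h) \<le> 2 * f (x + real (Suc n) * h)"
    if "x > 0" "h > 0" for x h n
  proof -
    have "h < x + real (Suc n) * h"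
      using that by (simp add: algebra_simps add_pos_nonneg)
    from conc[OF that(2) this] show ?thesis
      by (simp add: algebra_simps)
  qed
  have mono: "f x \<le> f y" if "0 < x" "x < y" for x y
  proof (rule ccontr)
    assume neg: "\<not> ?thesis"
    obtain n :: nat where n: "f x < real n * (f x - f y)"
      using neg ex_less_of_nat_mult[of "f x - f y" "f x"] by auto
    have "f (x + real n * (y - x)) \<le> f x + real n * (f y - f x)"
      using concave_sequence_bounds(1)[of "\<lambda>k. f (x + real k * (y - x))" n] seq[of x "y - x"] that
      by simp
    also have "\<dots> < 0" using n by (simp add: algebra_simps)
    finally show False
      using nonneg[of "x + real n * (y - x)"] that by (simp add: add_pos_nonneg)
  qed
  show ?thesis
    unfolding locally_lipschitz_on_def
  proof (intro ballI)
    fix x0 :: real assume "x0 \<in> {0<..}"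
    then have x0: "x0 > 0" by simp
    define L where "L = 4 * f (2 * x0) / x0"
    have L: "L \<ge> 0" using nonneg[of "2 * x0"] x0 by (simp add: L_def)
    have step: "f y - f x \<le> L * (y - x)" if "x < y" "3 * x0 / 4 < x" "y < 5 * x0 / 4" for x y
    proof -
      define h where "h = y - x"
      have h: "0 < h" "h < x0 / 2" using that by (simp_all add: h_def)
      \<comment> \<open>\<open>n\<close> steps of length \<open>h\<close> to the left of \<open>x\<close> cover \<open>x0 / 4\<close> and do not reach \<open>0\<close>.\<close>
      define n where "n = nat \<lceil>x0 / (4 * h)\<rceil>"
      have "x0 / (4 * h) > 0" using h x0 by simp
      then have n1: "x0 / (4 * h) \<le> real n" and n2: "real n < x0 / (4 * h) + 1"
        unfolding n_def by linarith+
      have nh: "x0 / 4 \<le> real n * h" using n1 h by (simp add: field_simps)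
      have "real n * h < (x0 / (4 * h) + 1) * h" using n2 h by simp
      also have "\<dots> = x0 / 4 + h" using h by (simp add: field_simps)
      finally have start: "0 < x - real n * h" using that h by simp
      have "real n * (f (x - real n * h + real (Suc n) * h) - f (x - real n * h + real n * h))
          \<le> f (x - real n * h + real n * h) - f (x - real n * h + real 0 * h)"
        using concave_sequence_bounds(2)[of "\<lambda>k. f (x - real n * h + real k * h)" n]
          seq[OF start h(1)] by blast
      then have "real n * (f y - f x) \<le> f x - f (x - real n * h)"
        by (simp add: h_def algebra_simps)
      also have "\<dots> \<le> f x" using nonneg[OF start] by simp
      also have "\<dots> \<le> f (2 * x0)" using mono[of x "2 * x0"] that x0 by simp
      finally have a: "real n * (f y - f x) \<le> f (2 * x0)" .
      have pos: "0 \<le> f y - f x" using mono[of x y] that x0 by simp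
      have "x0 / 4 * (f y - f x) \<le> (real n * h) * (f y - f x)"
        using nh pos by (rule mult_right_mono)
      also have "\<dots> = h * (real n * (f y - f x))" by simp
      also have "\<dots> \<le> h * f (2 * x0)" using a h by (intro mult_left_mono) auto
      finally show ?thesis using x0 by (simp add: L_def h_def field_simps)
    qed
    have "L-lipschitz_on (ball x0 (x0 / 4) \<inter> {0<..}) f"
    proof (rule lipschitz_onI[OF _ L])
      fix x y assume "x \<in> ball x0 (x0 / 4) \<inter> {0<..}" "y \<in> ball x0 (x0 / 4) \<inter> {0<..}"
      then have b: "3 * x0 / 4 < x" "x < 5 * x0 / 4" "3 * x0 / 4 < y" "y < 5 * x0 / 4"
        by (auto simp: dist_real_def abs_if split: if_splits)
      consider "x < y" | "x = y" | "y < x" by linarith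
      then show "dist (f x) (f y) \<le> L * dist x y"
      proof cases
        case 1
        then show ?thesis using step[OF 1] mono[OF _ 1] b x0 by (simp add: dist_real_def)
      next
        case 3
        then show ?thesis using step[OF 3] mono[OF _ 3] b x0 by (simp add: dist_real_def)
      qed simp
    qed
    then show "\<exists>e>0. \<exists>L. L-lipschitz_on (ball x0 e \<inter> {0<..}) f"
      using x0 by (intro exI[of _ "x0 / 4"]) auto
  qed
qed

section \<open>Maps of class C1 and compact support\<close>

abbreviation fderiv :: "('a::euclidean_space \<Rightarrow> 'b::euclidean_space) \<Rightarrow> 'a \<Rightarrow> 'a \<Rightarrow> 'b" where
  "fderiv f x \<equiv> frechet_derivative f (at x)"

lemma C_k_Suc_iff:
  "C_k (Suc k) f \<longleftrightarrow> (\<forall>x. f differentiable (at x)) \<and> (\<forall>v. C_k k (\<lambda>x. fderiv f x v))"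
proof
  assume "C_k (Suc k) f"
  then obtain f' where f': "\<And>x. (f has_derivative f' x) (at x)" "\<And>v. C_k k (\<lambda>x. f' x v)"
    by auto
  then have "f' = fderiv f"
    using frechet_derivative_at[OF f'(1)] by (intro ext) simp
  with f' show "(\<forall>x. f differentiable (at x)) \<and> (\<forall>v. C_k k (\<lambda>x. fderiv f x v))"
    by (auto simp: differentiable_def)
next
  assume "(\<forall>x. f differentiable (at x)) \<and> (\<forall>v. C_k k (\<lambda>x. fderiv f x v))"
  then show "C_k (Suc k) f"
    by (auto simp: frechet_derivative_works intro!: exI[of _ "fderiv f"])
qed

lemma C_k_1_iff:
  "C_k 1 f \<longleftrightarrow> (\<forall>x. f differentiable (at x)) \<and> (\<forall>v. continuous_on UNIV (\<lambda>x. fderiv f x v))"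
  unfolding One_nat_def C_k_Suc_iff by simp

lemma has_derivative_compose_at:
  assumes "(f has_derivative f') (at x within S)" "(h has_derivative h') (at y)" "f x = y"
  shows "((\<lambda>x. h (f x)) has_derivative (\<lambda>v. h' (f' v))) (at x within S)"
  using has_derivative_compose[of f f' x S h h'] assms by simp

declare C_k.simps(2) [simp del]

lemma C_k_1I:
  assumes "\<And>x. (f has_derivative f' x) (at x)" "\<And>v. continuous_on UNIV (\<lambda>x. f' x v)"
  shows "C_k 1 f"
  using assms unfolding One_nat_def C_k.simps by blast

lemma C_k_1_has_derivative: "C_k 1 f \<Longrightarrow> (f has_derivative fderiv f x) (at x)"
  unfolding C_k_1_iff frechet_derivative_works by blast

lemma C_k_1_continuous_fderiv: "C_k 1 f \<Longrightarrow> continuous_on UNIV (\<lambda>x. fderiv f x v)"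
  unfolding C_k_1_iff by blast

lemma C_k_1_continuous: "C_k 1 f \<Longrightarrow> continuous_on UNIV f"
  by (meson C_k_1_has_derivative continuous_at_imp_continuous_on has_derivative_continuous)

lemma linear_fderiv: "C_k 1 f \<Longrightarrow> linear (fderiv f x)"
  using C_k_1_has_derivative has_derivative_linear by blast

lemma linear_Basis_expand:
  fixes f :: "'a::euclidean_space \<Rightarrow> 'b::real_vector"
  assumes "linear f"
  shows "f v = (\<Sum>b\<in>Basis. (v \<bullet> b) *\<^sub>R f b)"
proof -
  have "f v = f (\<Sum>b\<in>Basis. (v \<bullet> b) *\<^sub>R b)" by (simp add: euclidean_representation)
  then show ?thesis by (simp add: linear_sum[OF assms] linear_cmul[OF assms])
qed

lemma C_k_1_continuous_fderiv_comp:
  fixes f :: "'a::euclidean_space \<Rightarrow> 'b::euclidean_space" and p :: "'c::topological_space \<Rightarrow> 'a"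
  assumes "C_k 1 f" "continuous_on S p" "continuous_on S v"
  shows "continuous_on S (\<lambda>x. fderiv f (p x) (v x))"
proof -
  have "continuous_on S (\<lambda>x. fderiv f (p x) b)" for b
    using continuous_on_compose2[OF C_k_1_continuous_fderiv[OF assms(1)] assms(2)] by simp
  then have "continuous_on S (\<lambda>x. \<Sum>b\<in>Basis. (v x \<bullet> b) *\<^sub>R fderiv f (p x) b)"
    by (intro continuous_intros assms)
  then show ?thesis
    by (subst linear_Basis_expand[OF linear_fderiv[OF assms(1)]])
qed

lemma fderiv_eqI: "(f has_derivative f') (at x) \<Longrightarrow> fderiv f x v = f' v"
  using frechet_derivative_at by metis

lemma C_k_1_const: "C_k 1 (\<lambda>x. c)"
  by (rule C_k_1I[where f'="\<lambda>x v. 0"]) (auto intro!: derivative_eq_intros)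

lemma C_k_1_bounded_linear: "bounded_linear f \<Longrightarrow> C_k 1 f"
  by (rule C_k_1I[where f'="\<lambda>x. f"]) (auto intro: bounded_linear_imp_has_derivative)

lemma C_k_1_add: "C_k 1 f \<Longrightarrow> C_k 1 h \<Longrightarrow> C_k 1 (\<lambda>x. f x + h x)"
  by (rule C_k_1I[where f'="\<lambda>x v. fderiv f x v + fderiv h x v"])
     (auto intro!: has_derivative_add C_k_1_has_derivative continuous_intros C_k_1_continuous_fderiv)

lemma C_k_1_diff: "C_k 1 f \<Longrightarrow> C_k 1 h \<Longrightarrow> C_k 1 (\<lambda>x. f x - h x)"
  by (rule C_k_1I[where f'="\<lambda>x v. fderiv f x v - fderiv h x v"])
     (auto intro!: has_derivative_diff C_k_1_has_derivative continuous_intros C_k_1_continuous_fderiv)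

lemma C_k_1_scaleR:
  assumes f: "C_k 1 f" and h: "C_k 1 h"
  shows "C_k 1 (\<lambda>x. f x *\<^sub>R h x)"
proof (rule C_k_1I)
  show "((\<lambda>x. f x *\<^sub>R h x) has_derivative (\<lambda>v. f x *\<^sub>R fderiv h x v + fderiv f x v *\<^sub>R h x)) (at x)" for x
    by (intro has_derivative_scaleR C_k_1_has_derivative f h)
  show "continuous_on UNIV (\<lambda>x. f x *\<^sub>R fderiv h x v + fderiv f x v *\<^sub>R h x)" for v
    using C_k_1_continuous[OF f] C_k_1_continuous[OF h]
    by (intro continuous_intros C_k_1_continuous_fderiv f h) auto
qed

lemma C_k_1_sum: "(\<And>i. i \<in> I \<Longrightarrow> C_k 1 (f i)) \<Longrightarrow> C_k 1 (\<lambda>x. \<Sum>i\<in>I. f i x)"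
  by (rule C_k_1I[where f'="\<lambda>x v. \<Sum>i\<in>I. fderiv (f i) x v"])
     (auto intro!: has_derivative_sum C_k_1_has_derivative continuous_intros C_k_1_continuous_fderiv)

lemma C_k_1_compose:
  fixes f :: "'a::euclidean_space \<Rightarrow> 'b::euclidean_space" and h :: "'b \<Rightarrow> 'c::euclidean_space"
  assumes f: "C_k 1 f" and h: "C_k 1 h"
  shows "C_k 1 (\<lambda>x. h (f x))"
proof (rule C_k_1I)
  show "((\<lambda>x. h (f x)) has_derivative (\<lambda>v. fderiv h (f x) (fderiv f x v))) (at x)" for x
    by (rule has_derivative_compose[OF C_k_1_has_derivative[OF f] C_k_1_has_derivative[OF h]])
  show "continuous_on UNIV (\<lambda>x. fderiv h (f x) (fderiv f x v))" for v
    by (intro C_k_1_continuous_fderiv_comp h C_k_1_continuous[OF f] C_k_1_continuous_fderiv[OF f])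
qed

lemma C_k_1_inner_left: "C_k 1 f \<Longrightarrow> C_k 1 (\<lambda>x. f x \<bullet> c)"
  using C_k_1_compose[OF _ C_k_1_bounded_linear[OF bounded_linear_inner_left]] by blast

lemma compactly_supported_ball:
  fixes U :: "'a::euclidean_space \<Rightarrow> 'b::real_vector"
  assumes "compactly_supported U"
  obtains R where "R > 0" "\<And>x. norm x \<ge> R \<Longrightarrow> U x = 0"
proof -
  have "bounded (closure {p. U p \<noteq> 0})"
    using assms unfolding compactly_supported_def by (rule compact_imp_bounded)
  then obtain R where R: "\<And>x. x \<in> closure {p. U p \<noteq> 0} \<Longrightarrow> norm x \<le> R"
    unfolding bounded_iff by blast
  show ?thesis
  proof (rule that[of "max R 0 + 1"])
    fix x :: 'a assume x: "max R 0 + 1 \<le> norm x"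
    show "U x = 0"
    proof (rule ccontr)
      assume "U x \<noteq> 0"
      then have "x \<in> closure {p. U p \<noteq> 0}"
        using closure_subset[of "{p. U p \<noteq> 0}"] by blast
      from R[OF this] show False using x by linarith
    qed
  qed simp
qed

lemma compactly_supported_if_ball:
  fixes U :: "'a::euclidean_space \<Rightarrow> 'b::real_vector"
  assumes "\<And>x. norm x \<ge> R \<Longrightarrow> U x = 0"
  shows "compactly_supported U"
proof -
  have "{p. U p \<noteq> 0} \<subseteq> cball 0 R" using assms by force
  then have "bounded {p. U p \<noteq> 0}" using bounded_subset bounded_cball by blast
  then show ?thesis unfolding compactly_supported_def by (simp add: compact_closure)
qed

lemma fderiv_zero_outside:
  assumes "\<And>x. norm x \<ge> R \<Longrightarrow> U x = 0" "norm x > R"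
  shows "fderiv U x v = 0"
proof (rule fderiv_eqI)
  have "((\<lambda>x. 0) has_derivative (\<lambda>v. 0)) (at x)" by simp
  then show "(U has_derivative (\<lambda>v. 0)) (at x)"
  proof (rule has_derivative_transform_within_open)
    show "open {x. norm x > R}" by (simp add: open_Collect_less continuous_on_norm_id)
  qed (use assms in auto)
qed

lemma continuous_bounded_support:
  fixes f :: "'a::euclidean_space \<Rightarrow> 'b::real_normed_vector"
  assumes "continuous_on UNIV f" "\<And>x. norm x > R \<Longrightarrow> f x = 0"
  obtains C where "C \<ge> 0" "\<And>x. norm (f x) \<le> C"
proof -
  have "compact (f ` cball 0 R)"
    using assms(1) by (intro compact_continuous_image) (auto intro: continuous_on_subset)
  then have "bounded (f ` cball 0 R)" by (rule compact_imp_bounded)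
  then obtain C where C: "\<And>x. x \<in> cball 0 R \<Longrightarrow> norm (f x) \<le> C"
    unfolding bounded_iff by blast
  have "norm (f x) \<le> max C 0" for x
    using C[of x] assms(2)[of x] by (cases "norm x \<le> R") auto
  then show ?thesis using that[of "max C 0"] by auto
qed

lemma C_k_1_compact_support_lipschitz:
  fixes f :: "'a::euclidean_space \<Rightarrow> 'b::euclidean_space"
  assumes f: "C_k 1 f" and supp: "compactly_supported f"
  obtains C where "C \<ge> 0" "\<And>x y. norm (f x - f y) \<le> C * norm (x - y)" "\<And>x v. norm (fderiv f x v)
      \<le> C * norm v"
proof -
  obtain R where R: "\<And>x. norm x \<ge> R \<Longrightarrow> f x = 0" using compactly_supported_ball[OF supp] by metis
  have "\<exists>C\<ge>0. \<forall>x. norm (fderiv f x b) \<le> C" for b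
    using continuous_bounded_support[OF C_k_1_continuous_fderiv[OF f], of R b]
      fderiv_zero_outside[of R f, OF R] by metis
  then obtain C where C: "\<And>b. C b \<ge> 0" "\<And>b x. norm (fderiv f x b) \<le> C b" by metis
  let ?C = "\<Sum>b\<in>(Basis :: 'a set). C b"
  have bd: "norm (fderiv f x v) \<le> ?C * norm v" for x v
  proof -
    have "norm (fderiv f x v) = norm (\<Sum>b\<in>Basis. (v \<bullet> b) *\<^sub>R fderiv f x b)"
      using linear_Basis_expand[OF linear_fderiv[OF f]] by metis
    also have "\<dots> \<le> (\<Sum>b\<in>Basis. \<bar>v \<bullet> b\<bar> * norm (fderiv f x b))"
      by (rule sum_norm_le) simp
    also have "\<dots> \<le> (\<Sum>b\<in>Basis. norm v * C b)"
      by (intro sum_mono mult_mono C Basis_le_norm) auto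
    finally show ?thesis by (simp add: sum_distrib_left mult.commute)
  qed
  have "norm (f x - f y) \<le> ?C * norm (x - y)" for x y
  proof (rule differentiable_bound[of UNIV])
    show "(f has_derivative fderiv f x) (at x within UNIV)" for x
      using C_k_1_has_derivative[OF f] by simp
    show "onorm (fderiv f x) \<le> ?C" for x
      using bd by (intro onorm_bound sum_nonneg C) auto
  qed auto
  then show ?thesis using that[of ?C] bd C by (simp add: sum_nonneg)
qed

lemma integrable_bounded_ball:
  fixes f :: "'a::euclidean_space \<Rightarrow> 'b::{banach,second_countable_topology}"
  assumes "f \<in> borel_measurable borel" "\<And>x. norm (f x) \<le> C" "\<And>x. norm x > R \<Longrightarrow> f x = 0"
  shows "integrable lborel f"
proof (rule Bochner_Integration.integrable_bound)
  show "integrable lborel (\<lambda>x::'a. C * indicator (cball 0 R) x :: real)"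
    using emeasure_lborel_cball_finite[of 0 R] by (intro integrable_mult_right)
        (simp add: integrable_indicator_iff)
  show "AE x in lborel. norm (f x) \<le> norm (C * indicator (cball 0 R) x :: real)"
  proof (intro always_eventually allI)
    fix x show "norm (f x) \<le> norm (C * indicator (cball 0 R) x :: real)"
      using assms(2)[of x] assms(3)[of x] by (cases "norm x > R") auto
  qed
qed (use assms in simp)

lemma integrable_continuous_support:
  fixes f :: "'a::euclidean_space \<Rightarrow> 'b::{banach,second_countable_topology}"
  assumes "continuous_on UNIV f" "\<And>x. norm x > R \<Longrightarrow> f x = 0"
  shows "integrable lborel f"
proof -
  obtain C where "\<And>x. norm (f x) \<le> C" using continuous_bounded_support[OF assms] by blast
  from integrable_bounded_ball[OF borel_measurable_continuous_onI[OF assms(1)] this assms(2)]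
  show ?thesis by blast
qed

section \<open>Measure-preserving maps\<close>

lemma integral_measure_preserving:
  fixes f :: "'a::euclidean_space \<Rightarrow> 'b::{banach, second_countable_topology}"
  assumes "distr lborel borel T = lborel" "T \<in> borel_measurable borel" "f \<in> borel_measurable borel"
  shows "(LBINT x. f (T x)) = (LBINT x. f x)"
proof -
  have "(\<integral>x. f x \<partial>distr lborel borel T) = (LBINT x. f (T x))"
    using assms by (intro integral_distr) auto
  then show ?thesis by (simp add: assms)
qed

lemma integrable_measure_preserving:
  fixes f :: "'a::euclidean_space \<Rightarrow> 'b::{banach, second_countable_topology}"
  assumes T: "distr lborel borel T = lborel" "T \<in> borel_measurable borel" and f: "integrable lborel f"
  shows "integrable lborel (\<lambda>x. f (T x))"
  using integrable_distr[of T lborel borel f] T f by simp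

lemma emeasure_measure_preserving:
  fixes T :: "'a::euclidean_space \<Rightarrow> 'a"
  assumes "distr lborel borel T = lborel" "T \<in> borel_measurable borel" "A \<in> sets borel"
  shows "emeasure lborel (T -` A) = emeasure lborel A"
proof -
  have "emeasure (distr lborel borel T) A = emeasure lborel (T -` A)"
    using assms by (subst emeasure_distr) auto
  then show ?thesis by (simp add: assms)
qed

lemma distr_lborel_translate:
  fixes c :: "'a::euclidean_space"
  shows "distr lborel borel (\<lambda>x. x + c) = lborel"
  using lborel_distr_plus[of c] by (simp add: add.commute[of _ c])

text \<open>Enclose \<open>F\<close> in an open set \<open>U\<close> of almost the same measure. Every point of \<open>F\<close> is eventually
  mapped into \<open>U\<close>, so dominated convergence gives the claim with \<open>U\<close> as the second set; the error
  made by this replacement is at most \<open>\<bar>U - F\<bar>\<close> for all \<open>n\<close>, because \<open>T n\<close> preserves measure. The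
  lemma serves Euclidean and left translations alike.\<close>

lemma measure_inter_preimage_tendsto:
  fixes T :: "nat \<Rightarrow> 'a::euclidean_space \<Rightarrow> 'a"
  assumes pres: "\<And>n. distr lborel borel (T n) = lborel" and meas [measurable]:
      "\<And>n. T n \<in> borel_measurable borel"
    and lim: "\<And>x. (\<lambda>n. T n x) \<longlonglongrightarrow> x"
    and F [measurable]: "F \<in> sets borel" and fin: "emeasure lborel F < \<infinity>"
  shows "(\<lambda>n. measure lborel (F \<inter> T n -` F)) \<longlonglongrightarrow> measure lborel F"
proof (rule tendstoI)
  fix e :: real assume e: "e > 0"
  obtain U where U: "open U" "F \<subseteq> U" "emeasure lborel (U - F) < ennreal (e / 2)"
    using outer_regular_lborel[OF F, of "e / 2"] e by auto
  have [measurable]: "U \<in> sets borel" using U(1) by simp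
  have Tm [measurable]: "T n -` A \<in> sets borel" if "A \<in> sets borel" for A n
    using measurable_sets_borel[OF meas that] .
  have fin': "emeasure lborel (F \<inter> A) < \<infinity>" if "A \<in> sets borel" for A
    using fin by (metis F Int_lower1 emeasure_mono le_less_trans sets_lborel)
  have int: "integrable lborel (indicator F :: 'a \<Rightarrow> real)"
    using fin by (simp add: integrable_indicator_iff)
  have "(\<lambda>n. LBINT x. indicat_real F x * indicator U (T n x)) \<longlonglongrightarrow> (\<integral>x. indicator F x \<partial>(lborel :: 'a measure))"
  proof (rule integral_dominated_convergence[where w="indicator F"])
    show "AE x in lborel. (\<lambda>n. indicator F x * indicator U (T n x) :: real) \<longlonglongrightarrow> indicator F x"
    proof (intro always_eventually allI)
      fix x :: 'a
      show "(\<lambda>n. indicator F x * indicator U (T n x) :: real) \<longlonglongrightarrow> indicator F x"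
      proof (cases "x \<in> F")
        case True
        then have "\<forall>\<^sub>F n in sequentially. T n x \<in> U"
          using lim[of x] U topological_tendstoD by blast
        then have "\<forall>\<^sub>F n in sequentially. indicator F x * indicator U (T n x) = (indicator F x :: real)"
          by eventually_elim simp
        then show ?thesis by (rule tendsto_eventually)
      qed simp
    qed
  qed (use int in \<open>auto simp: indicator_def\<close>)
  moreover have "(LBINT x. indicat_real F x * indicator U (T n x)) = measure lborel (F \<inter> T n -` U)" for n
  proof -
    have "(\<lambda>x. indicator F x * indicator U (T n x) :: real) = indicator (F \<inter> T n -` U)"
      by (auto simp: indicator_def)
    then show ?thesis by simp
  qed
  ultimately have "(\<lambda>n. measure lborel (F \<inter> T n -` U)) \<longlonglongrightarrow> measure lborel F"
    by simp
  then have "\<forall>\<^sub>F n in sequentially. dist (measure lborel (F \<inter> T n -` U)) (measure lborel F) < e / 2"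
    using e tendstoD by (metis half_gt_zero)
  then show "\<forall>\<^sub>F n in sequentially. dist (measure lborel (F \<inter> T n -` F)) (measure lborel F) < e"
  proof eventually_elim
    case (elim n)
    have em: "emeasure lborel (T n -` (U - F)) < ennreal (e / 2)"
      using emeasure_measure_preserving[OF pres meas, of "U - F" n] U by simp
    have emtop: "emeasure lborel (T n -` (U - F)) < \<infinity>"
      using less_trans[OF em ennreal_less_top] by simp
    have lm: "measure lborel (T n -` (U - F)) < e / 2"
    proof -
      have "emeasure lborel (T n -` (U - F)) \<noteq> \<infinity>" using emtop by auto
      then have "ennreal (measure lborel (T n -` (U - F))) < ennreal (e / 2)"
        using em by (simp add: emeasure_eq_ennreal_measure)
      then show ?thesis by (simp add: ennreal_less_iff)
    qed
    have "measure lborel (F \<inter> T n -` U) \<le> measure lborel ((F \<inter> T n -` F) \<union> T n -` (U - F))"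
      using fin'[of "T n -` F"] emtop by (intro measure_mono_fmeasurable)
          (auto simp: fmeasurable_def intro!: order.strict_trans1[OF emeasure_subadditive])
    also have "\<dots> \<le> measure lborel (F \<inter> T n -` F) + measure lborel (T n -` (U - F))"
      by (intro measure_Un_le) auto
    finally have "measure lborel (F \<inter> T n -` U) < measure lborel (F \<inter> T n -` F) + e / 2"
      using lm by linarith
    moreover have "measure lborel (F \<inter> T n -` F) \<le> measure lborel F"
      using fin by (intro measure_mono_fmeasurable) (auto simp: fmeasurable_def)
    ultimately show ?case using elim by (simp add: dist_real_def abs_if split: if_splits)
  qed
qed

lemma integral_abs_indicator_preimage_diff:
  fixes T :: "'a::euclidean_space \<Rightarrow> 'a"
  assumes pres: "distr lborel borel T = lborel" and meas [measurable]: "T \<in> borel_measurable borel"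
    and F [measurable]: "F \<in> sets borel" and fin: "emeasure lborel F < \<infinity>"
  shows "(LBINT x. \<bar>indicat_real F (T x) - indicat_real F x\<bar>)
      = 2 * measure lborel F - 2 * measure lborel (F \<inter> T -` F)"
proof -
  have Tm [measurable]: "T -` F \<in> sets borel"
    using measurable_sets_borel[OF meas F] .
  have emT: "emeasure lborel (T -` F) = emeasure lborel F"
    by (rule emeasure_measure_preserving[OF pres meas F])
  have fin': "emeasure lborel (F \<inter> T -` F) < \<infinity>"
    using fin by (metis F Int_lower1 emeasure_mono le_less_trans sets_lborel)
  have "(LBINT x. \<bar>indicat_real F (T x) - indicat_real F x\<bar>)
      = (\<integral>x. indicat_real (T -` F) x + indicator F x - 2 * indicator
          (F \<inter> T -` F) x \<partial>(lborel :: 'a measure))"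
    by (intro Bochner_Integration.integral_cong) (auto simp: indicator_def)
  also have "\<dots> = measure lborel (T -` F) + measure lborel F - 2 * measure lborel (F \<inter> T -` F)"
    using fin fin' emT by (simp add: integrable_indicator_iff)
  finally show ?thesis by (simp add: measure_def emT)
qed

lemma indicator_preimage_tendsto_L1:
  fixes T :: "nat \<Rightarrow> 'a::euclidean_space \<Rightarrow> 'a"
  assumes pres: "\<And>n. distr lborel borel (T n) = lborel" and meas [measurable]:
      "\<And>n. T n \<in> borel_measurable borel"
    and lim: "\<And>x. (\<lambda>n. T n x) \<longlonglongrightarrow> x"
    and F [measurable]: "F \<in> sets borel" and fin: "emeasure lborel F < \<infinity>"
  shows "(\<lambda>n. LBINT x. \<bar>indicat_real F (T n x) - indicat_real F x\<bar>) \<longlonglongrightarrow> 0"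
  unfolding integral_abs_indicator_preimage_diff[OF pres meas F fin]
  using tendsto_diff[OF tendsto_const[of "2 * measure lborel F"]
      tendsto_mult[OF tendsto_const[of 2] measure_inter_preimage_tendsto[OF pres meas lim F fin]]]
  by simp

text \<open>The indicators of \<open>F\<close> converge in \<open>L\<^sup>1\<close> but in general not pointwise, while \<open>q n\<close> converges
  pointwise and boundedly; the two limits are taken one after the other.\<close>

lemma integral_shifted_indicator_tendsto:
  fixes T :: "nat \<Rightarrow> 'a::euclidean_space \<Rightarrow> 'a" and q :: "nat \<Rightarrow> 'a \<Rightarrow> real"
  assumes pres: "\<And>n. distr lborel borel (T n) = lborel" and meas [measurable]:
      "\<And>n. T n \<in> borel_measurable borel"
    and lim: "\<And>x. (\<lambda>n. T n x) \<longlonglongrightarrow> x"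
    and F [measurable]: "F \<in> sets borel" and fin: "emeasure lborel F < \<infinity>"
    and E [measurable]: "E \<in> sets borel"
    and q [measurable]: "\<And>n. q n \<in> borel_measurable borel" and bound: "\<And>n x. \<bar>q n x\<bar> \<le> C"
    and qlim: "\<And>x. (\<lambda>n. q n x) \<longlonglongrightarrow> q0 x"
  shows "(\<lambda>n. LBINT x. indicat_real E x * indicator F (T n x) * q n x)
     \<longlonglongrightarrow> (LBINT x. indicat_real E x * indicator F x * q0 x)"
proof -
  have C: "C \<ge> 0" using bound[of 0 0] by linarith
  have int: "integrable lborel (indicator F :: 'a \<Rightarrow> real)"
    using fin by (simp add: integrable_indicator_iff)
  have emT: "emeasure lborel (T n -` F) = emeasure lborel F" for n
    by (rule emeasure_measure_preserving[OF pres meas F])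
  have intT: "integrable lborel (\<lambda>x. indicator F (T n x) :: real)" for n
  proof -
    have "(\<lambda>x. indicator F (T n x) :: real) = indicator (T n -` F)" by (auto simp: indicator_def)
    then show ?thesis using fin emT[of n] measurable_sets_borel[OF meas F, of n]
      by (simp add: integrable_indicator_iff)
  qed
  have q0 [measurable]: "q0 \<in> borel_measurable borel"
    by (rule borel_measurable_LIMSEQ_real[OF qlim]) (simp_all)
  have "(\<lambda>n. LBINT x. indicat_real E x * indicator F x * q n x)
     \<longlonglongrightarrow> (LBINT x. indicat_real E x * indicator F x * q0 x)"
  proof (rule integral_dominated_convergence[where w="\<lambda>x. C * indicator F x"])
    show "AE x in lborel. (\<lambda>n. indicator E x * indicator F x * q n x)
        \<longlonglongrightarrow> indicator E x * indicator F x * q0 x"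
      by (intro always_eventually allI tendsto_intros qlim)
    show "AE x in lborel. norm (indicator E x * indicator F x * q n x) \<le> C * indicator F x" for n
      using bound[of n] C by (auto simp: indicator_def)
  qed (use int in auto)
  moreover have "(\<lambda>n. (LBINT x. indicat_real E x * indicator F (T n x) * q n x)
      - (LBINT x. indicat_real E x * indicator F x * q n x)) \<longlonglongrightarrow> 0"
  proof (rule Lim_null_comparison[OF always_eventually, OF allI])
    fix n
    have i1: "integrable lborel (\<lambda>x. indicator E x * indicator F (T n x) * q n x)"
      by (rule Bochner_Integration.integrable_bound[OF integrable_mult_right[OF intT[of n], of C]])
         (use bound[of n] C in \<open>auto simp: indicator_def\<close>)
    have i2: "integrable lborel (\<lambda>x. indicator E x * indicator F x * q n x)"
      by (rule Bochner_Integration.integrable_bound[OF integrable_mult_right[OF int, of C]])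
         (use bound[of n] C in \<open>auto simp: indicator_def\<close>)
    have i3: "integrable lborel (\<lambda>x. C * \<bar>indicat_real F (T n x) - indicat_real F x\<bar>)"
      using intT[of n] int by (intro integrable_mult_right integrable_abs
          Bochner_Integration.integrable_diff)
    have "norm ((LBINT x. indicat_real E x * indicator F (T n x) * q n x)
      - (LBINT x. indicat_real E x * indicator F x * q n x))
      = norm (LBINT x. indicat_real E x * indicator F (T n x) * q n x
          - indicator E x * indicator F x * q n x)"
      using i1 i2 by simp
    also have "\<dots> \<le> (LBINT x. C * \<bar>indicat_real F (T n x) - indicat_real F x\<bar>)"
      by (rule Bochner_Integration.integral_norm_bound_integral[OF
          Bochner_Integration.integrable_diff[OF i1 i2] i3])
         (use bound[of n] C in \<open>auto simp: indicator_def\<close>)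
    finally show "norm ((LBINT x. indicat_real E x * indicator F (T n x) * q n x)
      - (LBINT x. indicat_real E x * indicator F x * q n x))
          \<le> C * (LBINT x. \<bar>indicat_real F (T n x) - indicat_real F x\<bar>)"
      by simp
  next
    show "(\<lambda>n. C * (LBINT x. \<bar>indicat_real F (T n x) - indicat_real F x\<bar>)) \<longlonglongrightarrow> 0"
      using tendsto_mult[OF tendsto_const[of C] indicator_preimage_tendsto_L1[OF pres meas lim F
          fin]] by simp
  qed
  ultimately show ?thesis
    using tendsto_add by fastforce
qed

section \<open>The Euclidean divergence\<close>

text \<open>A translation of \<open>f\<close> in the difference quotient is moved to the indicator. For \<open>Q = UNIV\<close> the
  left-hand side vanishes, so derivatives integrate to \<open>0\<close>; for a cube only two thin slabs along
  opposite faces contribute to it. The lemma thus plays the role of the divergence theorem.\<close>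

lemma integral_fderiv_indicator_tendsto:
  fixes f :: "'a::euclidean_space \<Rightarrow> real"
  assumes f: "C_k 1 f" and supp: "compactly_supported f" and Q [measurable]: "Q \<in> sets borel"
  shows "(\<lambda>n. real (Suc n) * (LBINT x. (indicator Q (x - b /\<^sub>R real (Suc n)) - indicator Q x) * f x))
     \<longlonglongrightarrow> (LBINT x. indicator Q x * fderiv f x b)"
proof -
  obtain R where R: "R > 0" "\<And>x. norm x \<ge> R \<Longrightarrow> f x = 0" using compactly_supported_ball[OF supp] by metis
  obtain C where C: "C \<ge> 0" "\<And>x y. norm (f x - f y) \<le> C * norm (x - y)"
    using C_k_1_compact_support_lipschitz[OF f supp] by metis
  have [measurable]: "f \<in> borel_measurable borel"
    using C_k_1_continuous[OF f] by (rule borel_measurable_continuous_onI)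
  have [measurable]: "(\<lambda>x. fderiv f x b) \<in> borel_measurable borel"
    using C_k_1_continuous_fderiv[OF f] by (rule borel_measurable_continuous_onI)
  define t where "t n = b /\<^sub>R real (Suc n)" for n
  define q where "q n x = real (Suc n) * (f (x + t n) - f x)" for n x
  have fint: "integrable lborel f"
    by (rule integrable_continuous_support[OF C_k_1_continuous[OF f], of R]) (use R in auto)
  have gint: "integrable lborel (\<lambda>x. indicator Q x * g x)" if "integrable lborel g" for g :: "'a \<Rightarrow> real"
    using integrable_mult_indicator[of Q lborel g] that by simp
  have shift: "(LBINT x. indicator Q (x - t n) * f x) = (LBINT x. indicator Q x * f (x + t n))" for n
    using integral_measure_preserving[OF distr_lborel_translate[of "t n"], of "\<lambda>x. indicator Q (x
        - t n) * f x"]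
    by simp
  have sint: "integrable lborel (\<lambda>x. f (x + t n))" for n
    by (rule integrable_measure_preserving[OF distr_lborel_translate _ fint]) simp
  have sint': "integrable lborel (\<lambda>x. indicator Q (x - t n) * f x)" for n
    by (rule Bochner_Integration.integrable_bound[OF fint]) (auto simp: indicator_def)
  have "real (Suc n) * (LBINT x. (indicator Q (x - t n) - indicator Q x) * f x)
      = (LBINT x. indicator Q x * q n x)" for n
  proof -
    have "(LBINT x. (indicator Q (x - t n) - indicator Q x) * f x)
       = (LBINT x. indicator Q (x - t n) * f x) - (LBINT x. indicator Q x * f x)"
      using sint'[of n] gint[OF fint] by (subst Bochner_Integration.integral_diff[symmetric])
          (auto simp: algebra_simps)
    also have "\<dots> = (LBINT x. indicator Q x * (f (x + t n) - f x))"
      unfolding shift using gint[OF sint[of n]] gint[OF fint]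
      by (subst Bochner_Integration.integral_diff[symmetric]) (auto simp: algebra_simps)
    finally have "real (Suc n) * (LBINT x. (indicator Q (x - t n) - indicator Q x) * f x)
        = (LBINT x. real (Suc n) * (indicator Q x * (f (x + t n) - f x)))"
      by simp
    then show ?thesis
      by (simp add: q_def mult.left_commute)
  qed
  moreover have "(\<lambda>n. LBINT x. indicator Q x * q n x) \<longlonglongrightarrow> (LBINT x. indicator Q x * fderiv f x b)"
  proof (rule integral_dominated_convergence[where w="\<lambda>x. C * norm b * indicator (cball 0 (R + norm b)) x"])
    show "integrable lborel (\<lambda>x::'a. C * norm b * indicator (cball 0 (R + norm b)) x :: real)"
      using emeasure_lborel_cball_finite[of 0 "R + norm b"]
      by (intro integrable_mult_right) (simp add: integrable_indicator_iff)
    show "AE x in lborel. (\<lambda>n. indicator Q x * q n x) \<longlonglongrightarrow> indicator Q x * fderiv f x b"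
    proof (intro always_eventually allI tendsto_mult tendsto_const)
      fix x
      have line: "((\<lambda>s. x + s *\<^sub>R b) has_derivative (\<lambda>s. s *\<^sub>R b)) (at 0)"
        by (auto intro!: derivative_eq_intros)
      have "((\<lambda>s. f (x + s *\<^sub>R b)) has_derivative (\<lambda>s. fderiv f x (s *\<^sub>R b))) (at 0)"
        by (rule has_derivative_compose_at[OF line C_k_1_has_derivative[OF f]]) simp
      then have "((\<lambda>s. f (x + s *\<^sub>R b)) has_real_derivative fderiv f x b) (at 0)"
        by (simp add: linear_cmul[OF linear_fderiv[OF f]] has_field_derivative_def mult_commute_abs)
      then have D: "((\<lambda>h. (f (x + h *\<^sub>R b) - f x) / h) \<longlongrightarrow> fderiv f x b) (at 0)"
        by (simp add: has_field_derivative_iff)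
      have "(\<lambda>n. (f (x + inverse (real (Suc n)) *\<^sub>R b) - f x) / inverse (real (Suc n))) \<longlonglongrightarrow> fderiv f x b"
        by (rule filterlim_compose[OF D])
           (auto simp: filterlim_at simp del: of_nat_Suc intro: LIMSEQ_inverse_real_of_nat)
      then show "(\<lambda>n. q n x) \<longlonglongrightarrow> fderiv f x b"
        by (simp add: q_def t_def field_simps)
    qed
    show "AE x in lborel. norm (indicator Q x * q n x) \<le> C * norm b * indicator (cball 0 (R
        + norm b)) x" for n
    proof (intro always_eventually allI)
      fix x
      have tn: "norm (t n) = norm b / real (Suc n)" by (simp add: t_def divide_inverse mult.commute)
      have "norm (t n) \<le> norm b" unfolding tn by (simp add: field_simps)
      show "norm (indicator Q x * q n x) \<le> C * norm b * indicator (cball 0 (R + norm b)) x"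
      proof (cases "x \<in> cball 0 (R + norm b)")
        case True
        have "\<bar>q n x\<bar> \<le> real (Suc n) * (C * norm (t n))"
          using C(2)[of "x + t n" x] by (simp add: q_def abs_mult)
        also have "\<dots> = C * norm b" unfolding tn by simp
        finally show ?thesis using True by (auto simp: indicator_def C)
      next
        case False
        have "norm (x + t n) \<ge> norm x - norm (t n)" by (metis norm_diff_ineq)
        moreover have "norm x > R + norm b" using False by simp
        ultimately have "R \<le> norm (x + t n)" "R \<le> norm x"
          using \<open>norm (t n) \<le> norm b\<close> norm_ge_zero[of b] by linarith+
        then have "f (x + t n) = 0" "f x = 0" by (auto intro: R)
        then show ?thesis using C(1) by (simp add: q_def)
      qed
    qed
  qed (auto simp: q_def)
  ultimately show ?thesis by (simp add: t_def)
qed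

lemma integral_fderiv_eq_0:
  fixes f :: "'a::euclidean_space \<Rightarrow> real"
  assumes "C_k 1 f" "compactly_supported f"
  shows "(LBINT x. fderiv f x b) = 0"
  using integral_fderiv_indicator_tendsto[OF assms, of UNIV b] by (simp add: LIMSEQ_const_iff)

definition trace_div :: "('a::euclidean_space \<Rightarrow> 'a) \<Rightarrow> 'a \<Rightarrow> real" where
  "trace_div U x = (\<Sum>b\<in>Basis. fderiv U x b \<bullet> b)"

lemma continuous_trace_div: "C_k 1 U \<Longrightarrow> continuous_on UNIV (trace_div U)"
  unfolding trace_div_def[abs_def] by (intro continuous_intros C_k_1_continuous_fderiv)

lemma trace_div_zero_outside:
  assumes "\<And>x. norm x \<ge> R \<Longrightarrow> U x = 0" "norm x > R"
  shows "trace_div U x = 0"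
  unfolding trace_div_def using fderiv_zero_outside[of R U x] assms by simp

lemma integrable_trace_div:
  assumes "C_k 1 U" "compactly_supported U"
  shows "integrable lborel (trace_div U)"
proof -
  obtain R where R: "R > 0" "\<And>x. norm x \<ge> R \<Longrightarrow> U x = 0" using compactly_supported_ball[OF assms(2)] by metis
  show ?thesis
    by (rule integrable_continuous_support[OF continuous_trace_div[OF assms(1)]
        trace_div_zero_outside[OF R(2)]])
qed

lemma fderiv_inner:
  "C_k 1 U \<Longrightarrow> fderiv (\<lambda>x. U x \<bullet> c) x v = fderiv U x v \<bullet> c"
  by (rule fderiv_eqI) (auto intro!: derivative_eq_intros C_k_1_has_derivative)

lemma compactly_supported_inner: "compactly_supported U \<Longrightarrow> compactly_supported (\<lambda>x. U x \<bullet> c)"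
proof (elim compactly_supported_ball)
  fix R assume "\<And>x. norm x \<ge> R \<Longrightarrow> U x = 0"
  then show ?thesis by (intro compactly_supported_if_ball[of R]) simp
qed

lemma integral_trace_div_eq_0:
  assumes "C_k 1 U" "compactly_supported U"
  shows "(LBINT x. trace_div U x) = 0"
proof -
  obtain R where R: "R > 0" "\<And>x. norm x \<ge> R \<Longrightarrow> U x = 0" using compactly_supported_ball[OF assms(2)] by metis
  have "integrable lborel (\<lambda>x. fderiv U x b \<bullet> b)" for b
    by (rule integrable_continuous_support[of _ R])
       (auto intro!: continuous_intros C_k_1_continuous_fderiv assms simp: fderiv_zero_outside[of R U] R)
  then have "(LBINT x. trace_div U x) = (\<Sum>b\<in>Basis. LBINT x. fderiv U x b \<bullet> b)"
    unfolding trace_div_def by (intro Bochner_Integration.integral_sum)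
  also have "\<dots> = (\<Sum>b\<in>Basis. LBINT x. fderiv (\<lambda>x. U x \<bullet> b) x b)"
    by (simp add: fderiv_inner[OF assms(1)])
  also have "\<dots> = 0"
    by (intro sum.neutral ballI integral_fderiv_eq_0 C_k_1_inner_left compactly_supported_inner assms)
  finally show ?thesis .
qed

lemma trace_div_add:
  "C_k 1 U \<Longrightarrow> C_k 1 W \<Longrightarrow> trace_div (\<lambda>x. U x + W x) x = trace_div U x + trace_div W x"
proof -
  assume UW: "C_k 1 U" "C_k 1 W"
  have "fderiv (\<lambda>x. U x + W x) x v = fderiv U x v + fderiv W x v" for v
    by (rule fderiv_eqI) (intro has_derivative_add C_k_1_has_derivative UW)
  then show ?thesis by (simp add: trace_div_def inner_add_left sum.distrib)
qed

lemma trace_div_diff: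
  "C_k 1 U \<Longrightarrow> C_k 1 W \<Longrightarrow> trace_div (\<lambda>x. U x - W x) x = trace_div U x - trace_div W x"
proof -
  assume UW: "C_k 1 U" "C_k 1 W"
  have "fderiv (\<lambda>x. U x - W x) x v = fderiv U x v - fderiv W x v" for v
    by (rule fderiv_eqI) (intro has_derivative_diff C_k_1_has_derivative UW)
  then show ?thesis by (simp add: trace_div_def inner_diff_left sum_subtractf)
qed

lemma trace_div_scaleR:
  assumes "C_k 1 f" "C_k 1 W"
  shows "trace_div (\<lambda>x. f x *\<^sub>R W x) x = f x * trace_div W x + fderiv f x (W x)"
proof -
  have "fderiv (\<lambda>x. f x *\<^sub>R W x) x v = f x *\<^sub>R fderiv W x v + fderiv f x v *\<^sub>R W x" for v
    by (rule fderiv_eqI) (intro has_derivative_scaleR C_k_1_has_derivative assms)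
  then show ?thesis
    using linear_Basis_expand[OF linear_fderiv[OF assms(1)], of x "W x"]
    by (simp add: trace_div_def inner_add_left sum.distrib sum_distrib_left mult.commute)
qed

text \<open>Integration by parts: the divergence of \<open>f *\<^sub>R U\<close> integrates to \<open>0\<close>.\<close>

lemma integral_scaleR_trace_div:
  fixes f :: "'a::euclidean_space \<Rightarrow> real"
  assumes f: "C_k 1 f" and U: "C_k 1 U" "compactly_supported U"
  shows "(LBINT x. f x * trace_div U x) = - (LBINT x. fderiv f x (U x))"
proof -
  obtain R where R: "\<And>x. norm x \<ge> R \<Longrightarrow> U x = 0" using compactly_supported_ball[OF U(2)] by metis
  have C1: "C_k 1 (\<lambda>x. f x *\<^sub>R U x)" by (rule C_k_1_scaleR[OF f U(1)])
  have supp: "compactly_supported (\<lambda>x. f x *\<^sub>R U x)"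
    by (rule compactly_supported_if_ball[of R]) (simp add: R)
  have i1: "integrable lborel (\<lambda>x. f x * trace_div U x)"
    by (rule integrable_continuous_support[of _ R,
          OF continuous_on_mult[OF C_k_1_continuous[OF f] continuous_trace_div[OF U(1)]]])
       (simp add: trace_div_zero_outside[of R U, OF R])
  have i2: "integrable lborel (\<lambda>x. fderiv f x (U x))"
    by (rule integrable_continuous_support[of _ R,
          OF C_k_1_continuous_fderiv_comp[OF f continuous_on_id C_k_1_continuous[OF U(1)]]])
       (simp add: R linear_0[OF linear_fderiv[OF f]])
  have "(LBINT x. f x * trace_div U x + fderiv f x (U x)) = 0"
    using integral_trace_div_eq_0[OF C1 supp] by (simp only: trace_div_scaleR[OF f U(1)])
  then show ?thesis using i1 i2 by (simp add: add_eq_0_iff)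
qed

section \<open>Mollification of indicator functions\<close>

lemma has_real_derivative_max_0_power2:
  "((\<lambda>t::real. (max 0 t)\<^sup>2) has_real_derivative 2 * max 0 t) (at t)"
proof -
  consider "t > 0" | "t < 0" | "t = 0" by linarith
  then show ?thesis
  proof cases
    case 1
    have "((\<lambda>t::real. t\<^sup>2) has_real_derivative 2 * max 0 t) (at t)"
      using 1 by (auto intro!: derivative_eq_intros)
    then show ?thesis
      by (rule has_field_derivative_transform_within_open[where S="{0<..}"]) (use 1 in auto)
  next
    case 2
    have "((\<lambda>t::real. 0) has_real_derivative 2 * max 0 t) (at t)"
      using 2 by (auto intro!: derivative_eq_intros)
    then show ?thesis
      by (rule has_field_derivative_transform_within_open[where S="{..<0}"]) (use 2 in auto)
  next
    case 3
    have "((\<lambda>h::real. \<bar>h\<bar>) \<longlongrightarrow> 0) (at 0)" using tendsto_rabs_zero[OF tendsto_ident_at] .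
    then have "((\<lambda>h::real. (max 0 h)\<^sup>2 / h) \<longlongrightarrow> 0) (at 0)"
      by (rule Lim_null_comparison[rotated])
         (auto intro!: always_eventually simp: max_def power2_eq_square)
    then show ?thesis using 3 by (simp add: has_field_derivative_iff)
  qed
qed

text \<open>This kernel is only \<open>C\<^sup>1\<close>, which suffices here, and its gradient at \<open>z\<close> is an explicit multiple
  of \<open>z\<close>.\<close>

definition bump :: "'a::euclidean_space \<Rightarrow> real" where
  "bump z = (max 0 (1 - z \<bullet> z))\<^sup>2"

lemma has_derivative_bump:
  "(bump has_derivative (\<lambda>v. - 4 * max 0 (1 - z \<bullet> z) * (z \<bullet> v))) (at z)"
proof -
  have "((\<lambda>z. 1 - z \<bullet> z) has_derivative (\<lambda>v. - 2 * (z \<bullet> v))) (at z)"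
    by (auto intro!: derivative_eq_intros simp: inner_commute)
  from has_derivative_compose[OF this has_real_derivative_max_0_power2[unfolded has_field_derivative_def]]
  have "((\<lambda>z. (max 0 (1 - z \<bullet> z))\<^sup>2) has_derivative
     (\<lambda>v. 2 * max 0 (1 - z \<bullet> z) * (- 2 * (z \<bullet> v)))) (at z)" .
  moreover have "(\<lambda>v. 2 * max 0 (1 - z \<bullet> z) * (- 2 * (z \<bullet> v))) = (\<lambda>v. - 4 * max 0 (1 - z \<bullet> z) * (z \<bullet> v))"
    by (simp add: fun_eq_iff)
  ultimately show ?thesis unfolding bump_def[abs_def] by simp
qed

lemma bump_eq_0: "norm z \<ge> 1 \<Longrightarrow> bump z = 0"
proof -
  assume "norm z \<ge> 1"
  then have "1 \<le> z \<bullet> z" using power_mono[of 1 "norm z" 2] by (simp add: power2_norm_eq_inner)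
  then show ?thesis by (simp add: bump_def)
qed

lemma continuous_bump: "continuous_on S bump"
  unfolding bump_def[abs_def] by (intro continuous_intros)

lemma integrable_bump: "integrable lborel (bump :: 'a::euclidean_space \<Rightarrow> real)"
  by (rule integrable_continuous_support[OF continuous_bump, of 1]) (simp add: bump_eq_0)

definition bump_mass :: "'a::euclidean_space itself \<Rightarrow> real" where
  "bump_mass _ = (\<integral>z. bump z \<partial>(lborel :: 'a measure))"

lemma bump_mass_pos: "bump_mass TYPE('a::euclidean_space) > 0"
proof -
  have "0 < 9/16 * measure lborel (cball (0::'a) (1/2))"
    using content_cball_pos[of "1/2" "0::'a"] by simp
  also have "\<dots> = (\<integral>z. 9/16 * indicator (cball 0 (1/2)) z \<partial>(lborel :: 'a measure))" by simp
  also have "\<dots> \<le> (\<integral>z. bump z \<partial>(lborel :: 'a measure))"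
  proof (rule integral_mono)
    show "integrable lborel (\<lambda>z::'a. 9/16 * indicator (cball 0 (1/2)) z :: real)"
      using emeasure_lborel_cball_finite[of "0::'a" "1/2"]
      by (intro integrable_mult_right) (simp add: integrable_indicator_iff)
    fix z :: 'a
    show "9/16 * indicator (cball 0 (1/2)) z \<le> bump z"
    proof (cases "z \<in> cball 0 (1/2)")
      case True
      then have "norm z ^ 2 \<le> (1/2)^2" by (intro power_mono) auto
      then have "z \<bullet> z \<le> 1/4" by (simp add: power2_norm_eq_inner power_divide)
      then have "3/4 \<le> 1 - z \<bullet> z" by simp
      then have "3/4 \<le> max 0 (1 - z \<bullet> z)" by (rule max.coboundedI2)
      then have "(3/4)^2 \<le> bump z" unfolding bump_def by (rule power_mono) simp
      then show ?thesis using True by (simp add: power2_eq_square)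
    qed (simp add: bump_def)
  qed (rule integrable_bump)
  finally show ?thesis by (simp add: bump_mass_def)
qed

definition mollifier :: "'a::euclidean_space \<Rightarrow> real" where
  "mollifier z = bump z / bump_mass TYPE('a)"

text \<open>The factor in front of \<open>z\<close> in the gradient of the mollifier.\<close>

definition mollifier_slope :: "'a::euclidean_space \<Rightarrow> real" where
  "mollifier_slope z = - 4 * max 0 (1 - z \<bullet> z) / bump_mass TYPE('a)"

lemma has_derivative_mollifier:
  "(mollifier has_derivative (\<lambda>v. mollifier_slope z * (z \<bullet> v))) (at z)"
proof -
  have "((\<lambda>z. bump z * inverse (bump_mass TYPE('a))) has_derivative
     (\<lambda>v. - 4 * max 0 (1 - z \<bullet> z) * (z \<bullet> v) * inverse (bump_mass TYPE('a)))) (at z)"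
    by (rule has_derivative_mult_left[OF has_derivative_bump])
  then show ?thesis
    by (simp add: mollifier_def[abs_def] mollifier_slope_def divide_inverse mult_ac)
qed

lemma continuous_mollifier_slope: "continuous_on S mollifier_slope"
  unfolding mollifier_slope_def[abs_def] using bump_mass_pos[where 'a='a]
  by (intro continuous_intros) auto

lemma C_k_1_mollifier: "C_k 1 mollifier"
  by (rule C_k_1I[OF has_derivative_mollifier])
     (intro continuous_intros continuous_mollifier_slope)

lemma borel_measurable_mollifier [measurable]:
  "mollifier \<in> borel_measurable borel" "mollifier_slope \<in> borel_measurable borel"
  by (intro borel_measurable_continuous_onI C_k_1_continuous C_k_1_mollifier continuous_mollifier_slope)+

lemma mollifier_eq_0: "norm z \<ge> 1 \<Longrightarrow> mollifier z = 0"
  by (simp add: mollifier_def bump_eq_0)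

lemma mollifier_slope_eq_0: "norm z \<ge> 1 \<Longrightarrow> mollifier_slope z = 0"
  using power_mono[of 1 "norm z" 2] by (simp add: mollifier_slope_def power2_norm_eq_inner)

lemma mollifier_nonneg: "mollifier z \<ge> 0"
  using bump_mass_pos[where 'a='a] by (simp add: mollifier_def bump_def)

lemma mollifier_slope_minus [simp]: "mollifier_slope (- z) = mollifier_slope z"
  by (simp add: mollifier_slope_def)

lemma integrable_mollifier: "integrable lborel (mollifier :: 'a::euclidean_space \<Rightarrow> real)"
  unfolding mollifier_def[abs_def] by (intro integrable_divide integrable_bump)

lemma integral_mollifier: "(\<integral>z. mollifier z \<partial>(lborel :: 'a::euclidean_space measure)) = 1"
  using bump_mass_pos[where 'a='a] unfolding mollifier_def by (simp add: bump_mass_def)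

lemma mollifier_bounded: obtains C where "C \<ge> 0" "\<And>z::'a::euclidean_space. \<bar>mollifier z\<bar> \<le> C"
  using continuous_bounded_support[OF C_k_1_continuous[OF C_k_1_mollifier], of 1, where 'a='a]
    mollifier_eq_0 by (metis less_imp_le real_norm_def)

lemma mollifier_slope_bounded: obtains C where "C \<ge> 0" "\<And>z::'a::euclidean_space. \<bar>mollifier_slope z\<bar> \<le> C"
  using continuous_bounded_support[OF continuous_mollifier_slope, of 1, where 'a='a]
    mollifier_slope_eq_0 by (metis less_imp_le real_norm_def)

text \<open>The field \<open>mollifier z *\<^sub>R M z\<close> has compact support and divergence
  \<open>mollifier z * tr M + mollifier_slope z * (z \<bullet> M z)\<close>, which integrates to \<open>0\<close>. This replaces an
  evaluation of the second moments of the slope.\<close>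

lemma integral_mollifier_slope_trace:
  fixes M :: "'a::euclidean_space \<Rightarrow> 'a"
  assumes M: "linear M"
  shows "(LBINT z. mollifier_slope z * (z \<bullet> M z)) = - (\<Sum>b\<in>Basis. M b \<bullet> b)"
proof -
  have bl: "bounded_linear M" using M by (simp add: linear_conv_bounded_linear)
  have C1: "C_k 1 (\<lambda>z. mollifier z *\<^sub>R M z)"
    by (intro C_k_1_scaleR C_k_1_mollifier C_k_1_bounded_linear bl)
  have supp: "compactly_supported (\<lambda>z. mollifier z *\<^sub>R M z)"
    by (rule compactly_supported_if_ball[of 1]) (simp add: mollifier_eq_0)
  have "trace_div (\<lambda>z. mollifier z *\<^sub>R M z) z
      = mollifier z * (\<Sum>b\<in>Basis. M b \<bullet> b) + mollifier_slope z * (z \<bullet> M z)" for z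
  proof -
    have "trace_div M z = (\<Sum>b\<in>Basis. M b \<bullet> b)"
      using fderiv_eqI[OF bounded_linear_imp_has_derivative[OF bl]] by (simp add: trace_div_def)
    then show ?thesis
      using fderiv_eqI[OF has_derivative_mollifier]
      by (simp add: trace_div_scaleR[OF C_k_1_mollifier C_k_1_bounded_linear[OF bl]])
  qed
  then have "(LBINT z. mollifier z * (\<Sum>b\<in>Basis. M b \<bullet> b) + mollifier_slope z * (z \<bullet> M z)) = 0"
    using integral_trace_div_eq_0[OF C1 supp] by simp
  moreover have "continuous_on UNIV (\<lambda>z. mollifier_slope z * (z \<bullet> M z))"
    by (intro continuous_intros continuous_mollifier_slope linear_continuous_on bl)
  then have "integrable lborel (\<lambda>z. mollifier_slope z * (z \<bullet> M z))"
    by (rule integrable_continuous_support[of _ 1]) (simp add: mollifier_slope_eq_0)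
  ultimately show ?thesis
    by (simp add: integrable_mollifier integral_mollifier add_eq_0_iff)
qed

text \<open>The set \<open>F\<close> is merely measurable, so the kernel is differentiated: its difference quotients are
  bounded by the Lipschitz constant on the set \<open>F\<close> of finite measure, and dominated convergence
  applies along every sequence.\<close>

lemma convolution_has_derivative:
  fixes \<rho> :: "'a::euclidean_space \<Rightarrow> real"
  assumes \<rho>: "C_k 1 \<rho>" "compactly_supported \<rho>" and F [measurable]: "F \<in> sets borel"
      and fin: "emeasure lborel F < \<infinity>"
  shows "((\<lambda>x. LBINT y. indicator F y * \<rho> (x - y)) has_derivative
     (\<lambda>v. LBINT y. indicator F y * fderiv \<rho> (x - y) v)) (at x)"
    and "continuous_on UNIV (\<lambda>x. LBINT y. indicator F y * fderiv \<rho> (x - y) v)"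
proof -
  obtain R where R: "R > 0" "\<And>x. norm x \<ge> R \<Longrightarrow> \<rho> x = 0" using compactly_supported_ball[OF \<rho>(2)] by metis
  obtain K where K: "K \<ge> 0" "\<And>x. norm (\<rho> x) \<le> K"
    using continuous_bounded_support[OF C_k_1_continuous[OF \<rho>(1)], of R] R(2) by (metis less_imp_le)
  obtain C where C: "C \<ge> 0" "\<And>x y. norm (\<rho> x - \<rho> y) \<le> C * norm (x - y)" "\<And>x v. norm (fderiv \<rho> x v)
      \<le> C * norm v"
    using C_k_1_compact_support_lipschitz[OF \<rho>] by metis
  have [measurable]: "\<rho> \<in> borel_measurable borel" "(\<lambda>x. fderiv \<rho> x v) \<in> borel_measurable borel" for v
    using C_k_1_continuous[OF \<rho>(1)] C_k_1_continuous_fderiv[OF \<rho>(1)]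
    by (auto intro!: borel_measurable_continuous_onI)
  have intF: "integrable lborel (\<lambda>y. c * indicator F y :: real)" for c
    using fin by (intro integrable_mult_right) (simp add: integrable_indicator_iff)
  have i1: "integrable lborel (\<lambda>y. indicator F y * \<rho> (x - y))" for x
    by (rule Bochner_Integration.integrable_bound[OF intF[of K]])
       (use K in \<open>auto simp: indicator_def\<close>)
  have i2: "integrable lborel (\<lambda>y. indicator F y * fderiv \<rho> (x - y) v)" for x v
    by (rule Bochner_Integration.integrable_bound[OF intF[of "C * norm v"]])
       (use C in \<open>auto simp: indicator_def\<close>)
  let ?I = "\<lambda>x. LBINT y. indicator F y * \<rho> (x - y)"
  let ?D = "\<lambda>x v. LBINT y. indicator F y * fderiv \<rho> (x - y) v"
  have lin: "linear (?D x)" for x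
  proof (rule linearI)
    show "?D x (v + w) = ?D x v + ?D x w" for v w
      using i2 by (subst Bochner_Integration.integral_add[symmetric])
        (auto simp: linear_add[OF linear_fderiv[OF \<rho>(1)]] algebra_simps)
    show "?D x (c *\<^sub>R v) = c *\<^sub>R ?D x v" for c v
      by (subst integral_scaleR_right[symmetric])
         (auto simp: linear_cmul[OF linear_fderiv[OF \<rho>(1)]] algebra_simps)
  qed
  show "(?I has_derivative ?D x) (at x)"
    unfolding has_derivative_at
  proof (intro conjI)
    show "bounded_linear (?D x)" using lin by (simp add: linear_conv_bounded_linear)
    let ?e = "\<lambda>h y. (\<rho> (x - y + h) - \<rho> (x - y) - fderiv \<rho> (x - y) h) / norm h"
    have "((\<lambda>h. LBINT y. indicator F y * ?e h y) \<longlongrightarrow> 0) (at 0)"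
      unfolding tendsto_at_iff_sequentially comp_def
    proof (intro allI impI)
      fix h :: "nat \<Rightarrow> 'a" assume h0: "\<forall>i. h i \<in> UNIV - {0}" and h: "h \<longlonglongrightarrow> 0"
      have "(\<lambda>n. LBINT y. indicator F y * ?e (h n) y) \<longlonglongrightarrow> (\<integral>y. 0 \<partial>(lborel :: 'a measure))"
      proof (rule integral_dominated_convergence[where w="\<lambda>y. (2 * C) * indicator F y"])
        show "AE y in lborel. (\<lambda>n. indicator F y * ?e (h n) y) \<longlonglongrightarrow> 0"
        proof (intro always_eventually allI tendsto_mult_right_zero)
          fix y
          have "((\<lambda>k. norm (\<rho> (x - y + k) - \<rho> (x - y) - fderiv \<rho> (x - y) k) / norm k) \<longlongrightarrow> 0) (at 0)"
            using C_k_1_has_derivative[OF \<rho>(1), of "x - y"] unfolding has_derivative_at by blast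
          then have "(\<lambda>n. norm (?e (h n) y)) \<longlonglongrightarrow> 0"
            using h0 h unfolding tendsto_at_iff_sequentially comp_def by simp
          then show "(\<lambda>n. ?e (h n) y) \<longlonglongrightarrow> 0" by (rule tendsto_norm_zero_cancel)
        qed
        show "AE y in lborel. norm (indicator F y * ?e (h n) y) \<le> (2 * C) * indicator F y" for n
        proof (intro always_eventually allI)
          fix y
          have "\<bar>\<rho> (x - y + h n) - \<rho> (x - y) - fderiv \<rho> (x - y) (h n)\<bar> \<le> 2 * C * norm (h n)"
            using C(2)[of "x - y + h n" "x - y"] C(3)[of "x - y" "h n"] by (simp add: abs_le_iff)
          moreover have "norm (h n) > 0" using h0 by simp
          ultimately have "\<bar>?e (h n) y\<bar> \<le> 2 * C" by (simp add: divide_le_eq)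
          then show "norm (indicator F y * ?e (h n) y) \<le> (2 * C) * indicator F y"
            using C(1) by (auto simp: indicator_def)
        qed
      qed (use intF in auto)
      then show "(\<lambda>n. LBINT y. indicator F y * ?e (h n) y) \<longlonglongrightarrow> 0" by simp
    qed
    then have "((\<lambda>h. norm (LBINT y. indicator F y * ?e h y)) \<longlongrightarrow> 0) (at 0)"
      by (rule tendsto_norm_zero)
    moreover have "norm (LBINT y. indicator F y * ?e h y)
      = norm (?I (x + h) - ?I x - ?D x h) / norm h" for h
    proof -
      have "?I (x + h) - ?I x - ?D x h
        = (LBINT y. indicator F y * \<rho> (x + h - y) - indicator F y * \<rho> (x - y)
            - indicator F y * fderiv \<rho> (x - y) h)"
        using i1 i2 by simp
      moreover have "(LBINT y. indicator F y * ?e h y)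
        = (LBINT y. (indicator F y * \<rho> (x + h - y) - indicator F y * \<rho> (x - y)
            - indicator F y * fderiv \<rho> (x - y) h) / norm h)"
        by (intro Bochner_Integration.integral_cong refl)
           (simp add: diff_add_eq right_diff_distrib diff_divide_distrib)
      ultimately have eq: "(LBINT y. indicator F y * ?e h y)
        = (?I (x + h) - ?I x - ?D x h) / norm h"
        by (simp only: integral_divide_zero)
      show ?thesis unfolding eq by (simp only: real_norm_def abs_divide abs_norm_cancel)
    qed
    ultimately show "((\<lambda>h. norm (?I (x + h) - ?I x - ?D x h) / norm h) \<longlongrightarrow> 0) (at 0)"
      by (simp only:)
  qed
  show "continuous_on UNIV (\<lambda>x. ?D x v)"
  proof (rule continuous_on_sequentiallyI)
    fix u :: "nat \<Rightarrow> 'a" and a assume u: "u \<longlonglongrightarrow> a"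
    show "(\<lambda>n. ?D (u n) v) \<longlonglongrightarrow> ?D a v"
    proof (rule integral_dominated_convergence[where w="\<lambda>y. (C * norm v) * indicator F y"])
      show "AE y in lborel. (\<lambda>n. indicator F y * fderiv \<rho> (u n - y) v) \<longlonglongrightarrow> indicator F y * fderiv \<rho> (a - y) v"
        using continuous_on_tendsto_compose[OF C_k_1_continuous_fderiv[OF \<rho>(1)] tendsto_diff[OF u
            tendsto_const]]
        by (intro always_eventually allI tendsto_mult tendsto_const) simp
      show "AE y in lborel. norm (indicator F y * fderiv \<rho> (u n - y) v)
          \<le> (C * norm v) * indicator F y" for n
        using C by (intro always_eventually allI) (auto simp: indicator_def)
    qed (use intF in auto)
  qed
qed

lemma integral_affine_substitution:
  fixes g :: "'a::euclidean_space \<Rightarrow> real"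
  assumes [measurable]: "g \<in> borel_measurable borel" and e: "e > 0"
  shows "(LBINT y. g y) = e ^ DIM('a) * (LBINT z. g (x - e *\<^sub>R z))"
proof -
  have "(LBINT y. g y) = (\<integral>y. g y \<partial>density (distr lborel borel (\<lambda>z. x
      + (- e) *\<^sub>R z)) (\<lambda>_. ennreal (\<bar>- e\<bar> ^ DIM('a))))"
    using lborel_affine[of "- e" x] e by simp
  also have "\<dots> = (\<integral>y. \<bar>- e\<bar> ^ DIM('a) *\<^sub>R g y \<partial>distr lborel borel (\<lambda>z. x + (- e) *\<^sub>R z))"
    by (intro integral_density) auto
  also have "\<dots> = (LBINT z. \<bar>- e\<bar> ^ DIM('a) *\<^sub>R g (x + (- e) *\<^sub>R z))"
    by (intro integral_distr) auto
  finally show ?thesis using e by simp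
qed

text \<open>The convolution of the indicator of \<open>F\<close> with the kernel at scale \<open>e\<close>, written with the kernel at
  unit scale: in this form \<open>e\<close> enters only through a translation of \<open>F\<close>, and the indicator of a
  translate of \<open>F\<close> converges in \<open>L\<^sup>1\<close> as \<open>e\<close> tends to \<open>0\<close>.\<close>

definition smooth_indicator :: "real \<Rightarrow> 'a::euclidean_space set \<Rightarrow> 'a \<Rightarrow> real" where
  "smooth_indicator e F x = (LBINT z. mollifier z * indicator F (x - e *\<^sub>R z))"

text \<open>The substitution \<open>y = x - e *\<^sub>R z\<close> turns the definition into a convolution with a rescaled
  kernel; its derivative is transformed back.\<close>

lemma smooth_indicator_has_derivative:
  fixes F :: "'a::euclidean_space set"
  assumes e: "e > 0" and F [measurable]: "F \<in> sets borel" and fin: "emeasure lborel F < \<infinity>"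
  shows "(smooth_indicator e F has_derivative
     (\<lambda>v. (LBINT z. mollifier_slope z * (z \<bullet> v) * indicator F (x - e *\<^sub>R z)) / e)) (at x)"
    and "C_k 1 (smooth_indicator e F)"
proof -
  define \<rho> where "\<rho> u = mollifier (u /\<^sub>R e) / e ^ DIM('a)" for u :: 'a
  have d\<rho>: "(\<rho> has_derivative (\<lambda>v. mollifier_slope (u /\<^sub>R e) * ((u /\<^sub>R e) \<bullet> v) / e / e ^ DIM('a)))
      (at u)" for u
  proof -
    have sc: "((\<lambda>u::'a. u /\<^sub>R e) has_derivative (\<lambda>v. v /\<^sub>R e)) (at u)"
      by (auto intro!: derivative_eq_intros)
    have "((\<lambda>u. mollifier (u /\<^sub>R e) * inverse (e ^ DIM('a))) has_derivative
       (\<lambda>v. mollifier_slope (u /\<^sub>R e) * ((u /\<^sub>R e) \<bullet> (v /\<^sub>R e)) * inverse (e ^ DIM('a)))) (at u)"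
      by (intro has_derivative_mult_left has_derivative_compose[OF sc has_derivative_mollifier])
    then show ?thesis
      unfolding \<rho>_def[abs_def] by (simp add: divide_inverse mult_ac)
  qed
  have C1: "C_k 1 \<rho>"
    by (rule C_k_1I[OF d\<rho>])
       (use e in \<open>intro continuous_intros continuous_on_compose2[OF continuous_mollifier_slope[of
           UNIV]]; simp\<close>)
  have supp: "compactly_supported \<rho>"
  proof (rule compactly_supported_if_ball[of e])
    fix u :: 'a assume "norm u \<ge> e"
    then have "norm (u /\<^sub>R e) \<ge> 1" using e by (simp add: field_simps)
    then show "\<rho> u = 0" by (simp add: \<rho>_def mollifier_eq_0)
  qed
  have [measurable]: "\<rho> \<in> borel_measurable borel" "(\<lambda>x. fderiv \<rho> x v) \<in> borel_measurable borel" for v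
    using C_k_1_continuous[OF C1] C_k_1_continuous_fderiv[OF C1]
    by (auto intro!: borel_measurable_continuous_onI)
  have 1: "(\<lambda>x. LBINT y. indicator F y * \<rho> (x - y)) = smooth_indicator e F"
  proof
    fix x
    have "(LBINT y. indicator F y * \<rho> (x - y))
        = e ^ DIM('a) * (LBINT z. indicator F (x - e *\<^sub>R z) * \<rho> (x - (x - e *\<^sub>R z)))"
      by (rule integral_affine_substitution[OF _ e]) measurable
    also have "\<dots> = smooth_indicator e F x"
      unfolding smooth_indicator_def \<rho>_def using e
      by (subst integral_mult_right_zero[symmetric]) (simp add: mult.commute)
    finally show "(LBINT y. indicator F y * \<rho> (x - y)) = smooth_indicator e F x" .
  qed
  have 2: "(LBINT y. indicator F y * fderiv \<rho> (x - y) v)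
     = (LBINT z. mollifier_slope z * (z \<bullet> v) * indicator F (x - e *\<^sub>R z)) / e" for x v
  proof -
    have "(LBINT y. indicator F y * fderiv \<rho> (x - y) v)
        = e ^ DIM('a) * (LBINT z. indicator F (x - e *\<^sub>R z) * fderiv \<rho> (x - (x - e *\<^sub>R z)) v)"
      by (rule integral_affine_substitution[OF _ e]) measurable
    also have "\<dots> = (LBINT z. mollifier_slope z * (z \<bullet> v) * indicator F (x - e *\<^sub>R z)) / e"
      unfolding fderiv_eqI[OF d\<rho>] using e
      by (subst integral_mult_right_zero[symmetric], subst integral_divide_zero[symmetric])
          (simp add: field_simps)
    finally show ?thesis .
  qed
  show "(smooth_indicator e F has_derivative
     (\<lambda>v. (LBINT z. mollifier_slope z * (z \<bullet> v) * indicator F (x - e *\<^sub>R z)) / e)) (at x)" for x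
    using convolution_has_derivative(1)[OF C1 supp F fin, of x] unfolding 1 2 .
  then show "C_k 1 (smooth_indicator e F)"
    using convolution_has_derivative(2)[OF C1 supp F fin] unfolding 2 by (rule C_k_1I)
qed

lemma smooth_indicator_bounds:
  fixes F :: "'a::euclidean_space set"
  assumes [measurable]: "F \<in> sets borel"
  shows "0 \<le> smooth_indicator e F x" "smooth_indicator e F x \<le> 1"
proof -
  show "0 \<le> smooth_indicator e F x"
    unfolding smooth_indicator_def by (intro Bochner_Integration.integral_nonneg)
        (auto simp: mollifier_nonneg)
  have "integrable lborel (\<lambda>z. mollifier z * indicator F (x - e *\<^sub>R z))"
  proof (rule Bochner_Integration.integrable_bound[OF integrable_mollifier])
    show "AE z in lborel. norm (mollifier z * indicator F (x - e *\<^sub>R z)) \<le> norm (mollifier z)"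
      by (auto simp: indicator_def)
  qed measurable
  then have "smooth_indicator e F x \<le> (\<integral>z. mollifier z \<partial>(lborel :: 'a measure))"
    unfolding smooth_indicator_def
    by (intro integral_mono integrable_mollifier) (auto simp: indicator_def mollifier_nonneg)
  then show "smooth_indicator e F x \<le> 1" by (simp add: integral_mollifier)
qed

section \<open>Commutator of mollification and a vector field\<close>

lemma fubini_bounded:
  fixes h :: "'a::euclidean_space \<Rightarrow> 'a \<Rightarrow> real"
  assumes [measurable]: "(\<lambda>(x, z). h x z) \<in> borel_measurable (borel \<Otimes>\<^sub>M borel)"
    and bound: "\<And>x z. \<bar>h x z\<bar> \<le> C * indicator E x * indicator B z"
    and E [measurable]: "E \<in> sets borel" "emeasure lborel E < \<infinity>"
    and B [measurable]: "B \<in> sets borel" "emeasure lborel B < \<infinity>"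
  shows "(LBINT x. (LBINT z. h x z)) = (LBINT z. (LBINT x. h x z))"
    and "integrable lborel (\<lambda>z. LBINT x. h x z)"
    and "integrable lborel (\<lambda>x. LBINT z. h x z)"
proof -
  have "emeasure (lborel \<Otimes>\<^sub>M lborel) (E \<times> B) = emeasure lborel E * emeasure lborel B"
    by (rule lborel.emeasure_pair_measure_Times) auto
  also have "\<dots> < \<infinity>" using E B by (simp add: ennreal_mult_less_top)
  finally have "integrable (lborel \<Otimes>\<^sub>M lborel) (\<lambda>p. C * indicator (E \<times> B) p :: real)"
    by (intro integrable_mult_right) (simp add: integrable_indicator_iff)
  then have int: "integrable (lborel \<Otimes>\<^sub>M lborel) (\<lambda>(x, z). h x z)"
  proof (rule Bochner_Integration.integrable_bound)
    show "AE p in lborel \<Otimes>\<^sub>M lborel. norm (case p of (x, z) \<Rightarrow> h x z)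
        \<le> norm (C * indicator (E \<times> B) p :: real)"
    proof (intro always_eventually allI)
      fix p :: "'a \<times> 'a"
      show "norm (case p of (x, z) \<Rightarrow> h x z) \<le> norm (C * indicator (E \<times> B) p :: real)"
        using bound[of "fst p" "snd p"]
        by (cases p) (auto simp: indicator_def split: if_splits)
    qed
  qed (use assms(1) in measurable)
  show "(LBINT x. (LBINT z. h x z)) = (LBINT z. (LBINT x. h x z))"
    using lborel_pair.Fubini_integral[OF int] by simp
  show "integrable lborel (\<lambda>z. LBINT x. h x z)"
    using lborel_pair.integrable_snd[OF int] .
  show "integrable lborel (\<lambda>x. LBINT z. h x z)"
    using lborel_pair.integrable_fst[OF int] .
qed

lemma distr_lborel_uminus: "distr lborel borel uminus = (lborel :: 'a::euclidean_space measure)"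
  using lborel_affine[of "-1 :: real" "0 :: 'a"] by (simp add: density_1)

definition scale_seq :: "nat \<Rightarrow> real" where "scale_seq n = inverse (real (Suc n))"

lemma scale_seq_pos: "scale_seq n > 0" by (simp add: scale_seq_def)
lemma scale_seq_tendsto: "scale_seq \<longlonglongrightarrow> 0"
  unfolding scale_seq_def[abs_def] by (rule LIMSEQ_inverse_real_of_nat)

lemma shift_tendsto:
  fixes x z :: "'a::real_normed_vector"
  shows "(\<lambda>n. x - scale_seq n *\<^sub>R z) \<longlonglongrightarrow> x"
  using tendsto_diff[OF tendsto_const[of x] tendsto_scaleR[OF scale_seq_tendsto tendsto_const[of
      z]]] by simp

lemma distr_lborel_shift: "distr lborel borel (\<lambda>x. x - c) = (lborel :: 'a::euclidean_space measure)"
  using distr_lborel_translate[of "- c"] by simp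

text \<open>By Fubini the left-hand side is an average over \<open>z\<close> of integrals in which \<open>F\<close> is translated by
  \<open>scale_seq n *\<^sub>R z\<close>. They converge for every \<open>z\<close> and are bounded.\<close>

lemma smooth_indicator_tendsto:
  fixes E F :: "'a::euclidean_space set" and q :: "'a \<Rightarrow> real"
  assumes E [measurable]: "E \<in> sets borel" "emeasure lborel E < \<infinity>"
    and F [measurable]: "F \<in> sets borel" "emeasure lborel F < \<infinity>"
    and q [measurable]: "q \<in> borel_measurable borel" and bound: "\<And>x. \<bar>q x\<bar> \<le> C"
  shows "(\<lambda>n. LBINT x. indicator E x * smooth_indicator (scale_seq n) F x * q x)
    \<longlonglongrightarrow> (LBINT x. indicator E x * indicator F x * q x)"
proof -
  have C: "C \<ge> 0" using bound[of 0] by linarith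
  have intE: "integrable lborel (\<lambda>x. C * indicator E x :: real)"
    using E by (intro integrable_mult_right) (simp add: integrable_indicator_iff)
  obtain S where S: "S \<ge> 0" "\<And>z::'a. \<bar>mollifier z\<bar> \<le> S" using mollifier_bounded by blast
  let ?A = "\<lambda>n z. LBINT x. indicator E x * indicator F (x - scale_seq n *\<^sub>R z) * q x"
  have "(LBINT x. indicator E x * smooth_indicator (scale_seq n) F x * q x)
     = (LBINT z. mollifier z * ?A n z)" (is "?L n = _") for n
  proof -
    have "?L n = (LBINT x. (LBINT z. mollifier z * (indicator E x * indicator F (x
        - scale_seq n *\<^sub>R z) * q x)))"
      unfolding smooth_indicator_def
      by (intro Bochner_Integration.integral_cong refl)
         (simp add: mult_ac flip: integral_mult_right_zero integral_mult_left_zero)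
    also have "\<dots> = (LBINT z. (LBINT x. mollifier z * (indicator E x * indicator F (x
        - scale_seq n *\<^sub>R z) * q x)))"
    proof (rule fubini_bounded(1)[OF _ _ E, where B="cball 0 1" and C="S * C"])
      show "\<bar>mollifier z * (indicator E x * indicator F (x - scale_seq n *\<^sub>R z) * q x)\<bar>
          \<le> S * C * indicator E x * indicator (cball 0 1) z" for x z
        using mult_mono[OF S(2)[of z] bound[of x] S(1)] mollifier_eq_0[of z] S(1) C
        by (auto simp: indicator_def abs_mult)
    qed (use emeasure_lborel_cball_finite[of "0::'a" 1] in simp_all)
    finally show ?thesis by simp
  qed
  moreover have "(\<lambda>n. LBINT z. mollifier z * ?A n z)
    \<longlonglongrightarrow> (\<integral>z. mollifier z * (LBINT x. indicator E x * indicator F x * q x) \<partial>(lborel :: 'a measure))"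
  proof (rule integral_dominated_convergence[where w="\<lambda>z. mollifier z * (C * measure lborel E)"])
    show "AE z in lborel. (\<lambda>n. mollifier z * ?A n z) \<longlonglongrightarrow> mollifier z *
        (LBINT x. indicator E x * indicator F x * q x)"
      by (intro always_eventually allI tendsto_mult tendsto_const
          integral_shifted_indicator_tendsto[OF distr_lborel_shift _ shift_tendsto F E(1) q bound]) auto
    show "AE z in lborel. norm (mollifier z * ?A n z) \<le> mollifier z * (C * measure lborel E)" for n
    proof (intro always_eventually allI)
      fix z :: 'a
      have "norm (?A n z) \<le> (\<integral>x. C * indicator E x \<partial>(lborel :: 'a measure))"
      proof (rule Bochner_Integration.integral_norm_bound_integral)
        show "integrable lborel (\<lambda>x. indicator E x * indicator F (x - scale_seq n *\<^sub>R z) * q x)"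
          by (rule Bochner_Integration.integrable_bound[OF intE])
             (use bound C in \<open>auto simp: indicator_def\<close>)
      qed (use intE bound C in \<open>auto simp: indicator_def\<close>)
      then have "norm (?A n z) \<le> C * measure lborel E" by simp
      then show "norm (mollifier z * ?A n z) \<le> mollifier z * (C * measure lborel E)"
        using mollifier_nonneg[of z] by (simp add: abs_mult mult_left_mono)
    qed
  qed (auto intro: integrable_mult_left integrable_mollifier)
  ultimately show ?thesis by (simp add: integral_mollifier)
qed

text \<open>Each summand on the left is a double integral over \<open>x\<close> and \<open>z\<close> of size \<open>1 / e\<close>. In the second
  one replace \<open>z\<close> by \<open>- z\<close> and \<open>x\<close> by \<open>x - e *\<^sub>R z\<close>: this exchanges the roles of \<open>E\<close> and \<open>F\<close>, and
  since the gradient of the kernel is odd, the sum contains \<open>Z\<close> only through a difference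
  quotient, which stays bounded as \<open>e\<close> tends to \<open>0\<close>.\<close>

lemma commutator_identity:
  fixes E F :: "'a::euclidean_space set" and Z :: "'a \<Rightarrow> 'a"
  assumes E [measurable]: "E \<in> sets borel" "emeasure lborel E < \<infinity>"
    and F [measurable]: "F \<in> sets borel" "emeasure lborel F < \<infinity>"
    and Z: "C_k 1 Z" "compactly_supported Z" and e: "e > 0"
  shows "(LBINT x. indicator E x * fderiv (smooth_indicator e F) x (Z x))
       + (LBINT x. indicator F x * fderiv (smooth_indicator e E) x (Z x))
    = (LBINT z. mollifier_slope z * (LBINT x. indicator E x * indicator F (x - e *\<^sub>R z) * (z \<bullet> (Z x
        - Z (x - e *\<^sub>R z)) / e)))"
proof -
  let ?Q = "\<lambda>z. LBINT x. indicator E x * indicator F (x - e *\<^sub>R z) * (z \<bullet> (Z x - Z (x - e *\<^sub>R z)) / e)"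
  obtain R where R: "R > 0" "\<And>x. norm x \<ge> R \<Longrightarrow> Z x = 0" using compactly_supported_ball[OF Z(2)] by metis
  obtain K where K: "K \<ge> 0" "\<And>x. norm (Z x) \<le> K"
    using continuous_bounded_support[OF C_k_1_continuous[OF Z(1)], of R] R(2) by (metis less_imp_le)
  obtain S where S: "S \<ge> 0" "\<And>z::'a. \<bar>mollifier_slope z\<bar> \<le> S" using mollifier_slope_bounded by blast
  have [measurable]: "Z \<in> borel_measurable borel"
    using C_k_1_continuous[OF Z(1)] by (rule borel_measurable_continuous_onI)
  define A where "A E F z = (LBINT x. indicator E x * indicator F (x - e *\<^sub>R z) * (z \<bullet> Z x))"
    for E F :: "'a set" and z
  have fub: "(LBINT x. indicator E x * fderiv (smooth_indicator e F) x (Z x))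
      = (LBINT z. mollifier_slope z * A E F z) / e"
    "integrable lborel (\<lambda>z. mollifier_slope z * A E F z)"
    if E [measurable]: "E \<in> sets borel" "emeasure lborel E < \<infinity>"
      and F [measurable]: "F \<in> sets borel" "emeasure lborel F < \<infinity>" for E F
  proof -
    let ?h = "\<lambda>x z. mollifier_slope z * (indicator E x * indicator F (x - e *\<^sub>R z) * (z \<bullet> Z x))"
    have h: "\<bar>?h x z\<bar> \<le> S * K * indicator E x * indicator (cball 0 1) z" for x z
    proof (cases "norm z \<le> 1")
      case True
      have "\<bar>z \<bullet> Z x\<bar> \<le> norm z * norm (Z x)" by (rule Cauchy_Schwarz_ineq2)
      also have "\<dots> \<le> 1 * K" using True K by (intro mult_mono) auto
      finally have "\<bar>mollifier_slope z\<bar> * \<bar>z \<bullet> Z x\<bar> \<le> S * K" using S K by (intro mult_mono) auto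
      then show ?thesis using True S(1) K(1) by (auto simp: indicator_def abs_mult)
    qed (simp add: mollifier_slope_eq_0)
    have mh: "(\<lambda>(x, z). ?h x z) \<in> borel_measurable (borel \<Otimes>\<^sub>M borel)" by measurable
    have fb: "cball (0::'a) 1 \<in> sets borel" "emeasure lborel (cball (0::'a) 1) < \<infinity>"
      using emeasure_lborel_cball_finite[of "0::'a" 1] by simp_all
    have "(LBINT x. indicator E x * fderiv (smooth_indicator e F) x (Z x))
        = (LBINT x. (LBINT z. ?h x z) / e)"
      unfolding fderiv_eqI[OF smooth_indicator_has_derivative(1)[OF e F]]
      by (intro Bochner_Integration.integral_cong refl)
         (simp add: mult_ac flip: integral_mult_right_zero)
    also have "\<dots> = (LBINT z. (LBINT x. ?h x z)) / e"
      using fubini_bounded(1)[OF mh h E fb] by simp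
    finally show "(LBINT x. indicator E x * fderiv (smooth_indicator e F) x (Z x))
        = (LBINT z. mollifier_slope z * A E F z) / e"
      by (simp add: A_def)
    show "integrable lborel (\<lambda>z. mollifier_slope z * A E F z)"
      using fubini_bounded(2)[OF mh h E fb] by (simp add: A_def)
  qed
  \<comment> \<open>The reflection and translation that exchange \<open>E\<close> and \<open>F\<close>.\<close>
  have reflect: "A F E (- z) = - (LBINT x. indicator E x * indicator F (x - e *\<^sub>R z) * (z \<bullet> Z (x
      - e *\<^sub>R z)))" for z
  proof -
    have "A F E (- z) = (LBINT x. indicator F (x - e *\<^sub>R z) * indicator E ((x - e *\<^sub>R z)
        + e *\<^sub>R z) * (- z \<bullet> Z (x - e *\<^sub>R z)))"
      unfolding A_def
      using integral_measure_preserving[OF distr_lborel_shift[of "e *\<^sub>R z"],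
          of "\<lambda>x. indicator F x * indicator E (x + e *\<^sub>R z) * (- z \<bullet> Z x)"] by simp
    then show ?thesis by (simp add: mult_ac)
  qed
  have "(LBINT z. mollifier_slope z * A F E z) = (LBINT z. mollifier_slope z * A F E (- z))"
    using integral_measure_preserving[OF distr_lborel_uminus, of "\<lambda>z. mollifier_slope z * A F E z"]
      borel_measurable_integrable[OF fub(2)[OF F E]] by simp
  moreover have int': "integrable lborel (\<lambda>z. mollifier_slope z * A F E (- z))"
    using integrable_measure_preserving[OF distr_lborel_uminus _ fub(2)[OF F E]] by simp
  ultimately have "(LBINT x. indicator E x * fderiv (smooth_indicator e F) x (Z x))
       + (LBINT x. indicator F x * fderiv (smooth_indicator e E) x (Z x))
     = (LBINT z. (mollifier_slope z * A E F z + mollifier_slope z * A F E (- z)) / e)"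
    using fub(2)[OF E F] by (simp add: fub(1)[OF E F] fub(1)[OF F E] add_divide_distrib)
  also have "\<dots> = (LBINT z. mollifier_slope z * ?Q z)"
  proof (intro Bochner_Integration.integral_cong refl)
    fix z :: 'a
    have b: "\<bar>z \<bullet> Z x\<bar> \<le> norm z * K" for x
      using Cauchy_Schwarz_ineq2[of z "Z x"] mult_left_mono[OF K(2)[of x], of "norm z"] by simp
    have intE: "integrable lborel (\<lambda>x. (norm z * K) * indicator E x :: real)"
      using E by (intro integrable_mult_right) (simp add: integrable_indicator_iff)
    have i1: "integrable lborel (\<lambda>x. indicator E x * indicator F (x - e *\<^sub>R z) * (z \<bullet> Z x))"
      by (rule Bochner_Integration.integrable_bound[OF intE]) (use b K in \<open>auto simp: indicator_def\<close>)
    have i2: "integrable lborel (\<lambda>x. indicator E x * indicator F (x - e *\<^sub>R z) * (z \<bullet> Z (x - e *\<^sub>R z)))"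
      by (rule Bochner_Integration.integrable_bound[OF intE]) (use b K in \<open>auto simp: indicator_def\<close>)
    have "?Q z
        = (LBINT x. (indicator E x * indicator F (x - e *\<^sub>R z) * (z \<bullet> Z x)
          - indicator E x * indicator F (x - e *\<^sub>R z) * (z \<bullet> Z (x - e *\<^sub>R z))) / e)"
      by (intro Bochner_Integration.integral_cong refl) (simp_all add: inner_diff_right
          right_diff_distrib diff_divide_distrib)
    also have "\<dots> = (A E F z + A F E (- z)) / e"
      using i1 i2 unfolding reflect by (simp add: A_def)
    finally have eq: "?Q z
      = (A E F z + A F E (- z)) / e" .
    show "(mollifier_slope z * A E F z + mollifier_slope z * A F E (- z)) / e
      = mollifier_slope z * ?Q z"
      unfolding eq by (simp add: distrib_left)
  qed
  finally show ?thesis .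
qed

text \<open>For fixed \<open>z\<close> the difference quotient of \<open>Z\<close> converges to its derivative in direction \<open>z\<close>, and
  the weight \<open>mollifier_slope z\<close> averages \<open>z \<bullet> fderiv Z x z\<close> to minus the trace.\<close>

lemma commutator_tendsto:
  fixes E F :: "'a::euclidean_space set" and Z :: "'a \<Rightarrow> 'a"
  assumes E [measurable]: "E \<in> sets borel" "emeasure lborel E < \<infinity>"
    and F [measurable]: "F \<in> sets borel" "emeasure lborel F < \<infinity>"
    and Z: "C_k 1 Z" "compactly_supported Z"
  shows "(\<lambda>n. (LBINT x. indicator E x * fderiv (smooth_indicator (scale_seq n) F) x (Z x))
       + (LBINT x. indicator F x * fderiv (smooth_indicator (scale_seq n) E) x (Z x)))
    \<longlonglongrightarrow> - (LBINT x. indicator (E \<inter> F) x * trace_div Z x)"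
proof -
  obtain L where L: "L \<ge> 0" "\<And>x y. norm (Z x - Z y) \<le> L * norm (x - y)" "\<And>x v. norm (fderiv Z x v)
      \<le> L * norm v"
    using C_k_1_compact_support_lipschitz[OF Z] by metis
  obtain S where S: "S \<ge> 0" "\<And>z::'a. \<bar>mollifier_slope z\<bar> \<le> S" using mollifier_slope_bounded by blast
  have [measurable]: "Z \<in> borel_measurable borel"
    using C_k_1_continuous[OF Z(1)] by (rule borel_measurable_continuous_onI)
  define q where "q n z x = z \<bullet> (Z x - Z (x - scale_seq n *\<^sub>R z)) / scale_seq n" for n z x
  have q_bound: "\<bar>q n z x\<bar> \<le> L * (norm z)\<^sup>2" for n z x
  proof -
    have "\<bar>z \<bullet> (Z x - Z (x - scale_seq n *\<^sub>R z))\<bar> \<le> norm z * (L * norm (scale_seq n *\<^sub>R z))"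
      using Cauchy_Schwarz_ineq2[of z "Z x - Z (x - scale_seq n *\<^sub>R z)"]
        mult_left_mono[OF L(2)[of x "x - scale_seq n *\<^sub>R z"], of "norm z"] by simp
    then show ?thesis
      using scale_seq_pos[of n] by (simp add: q_def divide_le_eq power2_eq_square mult_ac)
  qed
  have q_lim: "(\<lambda>n. q n z x) \<longlonglongrightarrow> z \<bullet> fderiv Z x z" for z x
  proof -
    have line: "((\<lambda>s. x + s *\<^sub>R (- z)) has_derivative (\<lambda>s. s *\<^sub>R (- z))) (at 0)"
      by (auto intro!: derivative_eq_intros)
    have "((\<lambda>s. Z (x + s *\<^sub>R (- z))) has_derivative (\<lambda>s. fderiv Z x (s *\<^sub>R (- z)))) (at 0)"
      by (rule has_derivative_compose_at[OF line C_k_1_has_derivative[OF Z(1)]]) simp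
    then have "((\<lambda>s. z \<bullet> Z (x + s *\<^sub>R (- z))) has_derivative (\<lambda>s. z \<bullet> fderiv Z x (s *\<^sub>R (- z)))) (at 0)"
      by (rule has_derivative_inner_right)
    moreover have "(\<lambda>s. z \<bullet> fderiv Z x (s *\<^sub>R (- z))) = (*) (- (z \<bullet> fderiv Z x z))"
      using linear_cmul[OF linear_fderiv[OF Z(1)], of x _ z] linear_neg[OF linear_fderiv[OF Z(1)]]
      by (simp add: fun_eq_iff mult.commute)
    ultimately have "((\<lambda>s. z \<bullet> Z (x + s *\<^sub>R (- z))) has_real_derivative - (z \<bullet> fderiv Z x z)) (at 0)"
      unfolding has_field_derivative_def by (simp only:)
    then have D: "((\<lambda>h. (z \<bullet> Z (x + h *\<^sub>R (- z)) - z \<bullet> Z x) / h) \<longlongrightarrow> - (z \<bullet> fderiv Z x z)) (at 0)"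
      by (simp add: has_field_derivative_iff)
    have "(\<lambda>n. (z \<bullet> Z (x + scale_seq n *\<^sub>R (- z)) - z \<bullet> Z x) / scale_seq n) \<longlonglongrightarrow> - (z \<bullet> fderiv Z x z)"
    proof (rule filterlim_compose[OF D])
      show "filterlim scale_seq (at 0) sequentially"
        using scale_seq_tendsto scale_seq_pos
        by (auto simp: filterlim_at intro!: always_eventually) (metis less_irrefl)
    qed
    from tendsto_minus[OF this] show ?thesis
      by (simp add: q_def inner_diff_right minus_divide_left)
  qed
  have [measurable]: "q n z \<in> borel_measurable borel" for n z
    unfolding q_def[abs_def] by measurable
  let ?I = "\<lambda>n z. LBINT x. indicator E x * indicator F (x - scale_seq n *\<^sub>R z) * q n z x"
  let ?J = "\<lambda>z. LBINT x. indicator E x * indicator F x * (z \<bullet> fderiv Z x z)"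
  have I_lim: "(\<lambda>n. ?I n z) \<longlonglongrightarrow> ?J z" for z
    by (rule integral_shifted_indicator_tendsto[OF distr_lborel_shift _ shift_tendsto F E(1) _
        q_bound q_lim]) auto
  have intE: "integrable lborel (\<lambda>x. c * indicator E x :: real)" for c
    using E by (intro integrable_mult_right) (simp add: integrable_indicator_iff)
  have I_bound: "\<bar>mollifier_slope z * ?I n z\<bar> \<le> S * L * measure lborel E * indicator (cball 0 1) z" for n z
  proof (cases "norm z \<le> 1")
    case True
    have qb: "\<bar>q n z x\<bar> \<le> L" for x
      using q_bound[of n z x] mult_left_mono[OF power_mono[OF True, of 2] L(1)] by simp
    have "norm (?I n z) \<le> (\<integral>x. L * indicator E x \<partial>(lborel :: 'a measure))"
    proof (rule Bochner_Integration.integral_norm_bound_integral)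
      show "integrable lborel (\<lambda>x. indicator E x * indicator F (x - scale_seq n *\<^sub>R z) * q n z x)"
        by (rule Bochner_Integration.integrable_bound[OF intE[of L]])
           (use qb L(1) in \<open>auto simp: indicator_def\<close>)
    qed (use intE qb L(1) in \<open>auto simp: indicator_def\<close>)
    then have "\<bar>?I n z\<bar> \<le> L * measure lborel E" by simp
    from mult_mono[OF S(2)[of z] this S(1)] show ?thesis
      using True by (simp add: abs_mult mult_ac)
  qed (simp add: mollifier_slope_eq_0)
  have [measurable]: "(\<lambda>z. mollifier_slope z * ?I n z) \<in> borel_measurable borel" for n
    unfolding q_def by measurable
  have "(\<lambda>n. LBINT z. mollifier_slope z * ?I n z) \<longlonglongrightarrow> (LBINT z. mollifier_slope z * ?J z)"
  proof (rule integral_dominated_convergence[where w="\<lambda>z. S * L * measure lborel E * indicator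
      (cball 0 1) z"])
    show "AE z in lborel. (\<lambda>n. mollifier_slope z * ?I n z) \<longlonglongrightarrow> mollifier_slope z * ?J z"
      by (intro always_eventually allI tendsto_mult tendsto_const I_lim)
    show "(\<lambda>z. mollifier_slope z * ?J z) \<in> borel_measurable lborel"
      by (rule borel_measurable_LIMSEQ_real[where u="\<lambda>n z. mollifier_slope z * ?I n z"])
         (auto intro!: tendsto_mult I_lim)
    show "integrable lborel (\<lambda>z::'a. S * L * measure lborel E * indicator (cball 0 1) z :: real)"
      using emeasure_lborel_cball_finite[of "0::'a" 1] by (intro integrable_mult_right)
          (simp add: integrable_indicator_iff)
  qed (use I_bound in auto)
  moreover have "(LBINT z. mollifier_slope z * ?J z) = - (LBINT x. indicator (E \<inter> F) x * trace_div Z x)"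
  proof -
    let ?h = "\<lambda>x z. mollifier_slope z * (indicator E x * indicator F x * (z \<bullet> fderiv Z x z))"
    have "continuous_on UNIV (\<lambda>p::'a \<times> 'a. fderiv Z (fst p) (snd p))"
      by (intro C_k_1_continuous_fderiv_comp Z continuous_intros)
    then have "(\<lambda>p::'a \<times> 'a. fderiv Z (fst p) (snd p)) \<in> borel_measurable borel"
      by (rule borel_measurable_continuous_onI)
    then have [measurable]: "(\<lambda>p::'a \<times> 'a. fderiv Z (fst p) (snd p)) \<in> borel_measurable (borel \<Otimes>\<^sub>M borel)"
      by (simp add: borel_prod)
    have mh: "(\<lambda>(x, z). ?h x z) \<in> borel_measurable (borel \<Otimes>\<^sub>M borel)"
      unfolding case_prod_beta by measurable
    have bh: "\<bar>?h x z\<bar> \<le> S * L * indicator E x * indicator (cball 0 1) z" for x z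
    proof (cases "norm z \<le> 1")
      case True
      have "\<bar>z \<bullet> fderiv Z x z\<bar> \<le> norm z * (L * norm z)"
        using Cauchy_Schwarz_ineq2[of z "fderiv Z x z"] mult_left_mono[OF L(3)[of x z], of "norm z"] by simp
      also have "\<dots> \<le> 1 * (L * 1)" using True L by (intro mult_mono) auto
      finally have "\<bar>mollifier_slope z\<bar> * \<bar>z \<bullet> fderiv Z x z\<bar> \<le> S * L" using S L by (intro mult_mono) auto
      then show ?thesis using True S(1) L(1) by (auto simp: indicator_def abs_mult)
    qed (simp add: mollifier_slope_eq_0)
    have "(LBINT z. mollifier_slope z * ?J z) = (LBINT z. (LBINT x. ?h x z))" by simp
    also have "\<dots> = (LBINT x. (LBINT z. ?h x z))"
      using fubini_bounded(1)[OF mh bh E] emeasure_lborel_cball_finite[of "0::'a" 1] by simp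
    also have "\<dots> = (LBINT x. - (indicator (E \<inter> F) x * trace_div Z x))"
    proof (intro Bochner_Integration.integral_cong refl)
      fix x
      have "(LBINT z. ?h x z) = indicator E x * indicator F x * (LBINT z. mollifier_slope z *
          (z \<bullet> fderiv Z x z))"
        by (simp add: mult_ac flip: integral_mult_right_zero)
      then show "(LBINT z. ?h x z) = - (indicator (E \<inter> F) x * trace_div Z x)"
        by (simp add: integral_mollifier_slope_trace[OF linear_fderiv[OF Z(1)]] trace_div_def
            indicator_inter_arith)
    qed
    finally show ?thesis by simp
  qed
  ultimately show ?thesis
    unfolding commutator_identity[OF E F Z scale_seq_pos] q_def by simp
qed

section \<open>Submodularity of the variation\<close>

definition flux :: "'a::euclidean_space set \<Rightarrow> ('a \<Rightarrow> 'a) \<Rightarrow> real" where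
  "flux E U = (LBINT x. indicator E x * trace_div U x)"

definition fields_in :: "('a::euclidean_space \<Rightarrow> 'a set) \<Rightarrow> ('a \<Rightarrow> 'a) set" where
  "fields_in S = {U. C_k 1 U \<and> compactly_supported U \<and> (\<forall>p. U p \<in> S p)}"

text \<open>The perimeter of a sub-Finsler structure arises when \<open>S p\<close> is the unit ball of the asymmetric
  norm at \<open>p\<close>.\<close>

definition variation :: "('a::euclidean_space \<Rightarrow> 'a set) \<Rightarrow> 'a set \<Rightarrow> ereal" where
  "variation S E = (SUP U\<in>fields_in S. ereal (flux E U))"

lemma trace_div_bounded:
  assumes "C_k 1 U" "compactly_supported U"
  obtains C where "C \<ge> 0" "\<And>x. \<bar>trace_div U x\<bar> \<le> C"
proof -
  obtain R where R: "R > 0" "\<And>x. norm x \<ge> R \<Longrightarrow> U x = 0" using compactly_supported_ball[OF assms(2)] by metis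
  have zero: "norm x > R \<Longrightarrow> trace_div U x = 0" for x
    by (rule trace_div_zero_outside[OF R(2)])
  obtain C where "C \<ge> 0" "\<And>x. norm (trace_div U x) \<le> C"
    using continuous_bounded_support[OF continuous_trace_div[OF assms(1)] zero] by blast
  then show ?thesis using that by simp
qed

lemma borel_measurable_trace_div: "C_k 1 U \<Longrightarrow> trace_div U \<in> borel_measurable borel"
  by (rule borel_measurable_continuous_onI[OF continuous_trace_div])

lemma integrable_flux:
  assumes "C_k 1 U" "compactly_supported U" "E \<in> sets borel"
  shows "integrable lborel (\<lambda>x. indicator E x * trace_div U x)"
  using integrable_mult_indicator[of E lborel "trace_div U"] integrable_trace_div[OF assms(1,2)]
      assms(3) by simp

lemma compactly_supported_mix:
  fixes U W :: "'a::euclidean_space \<Rightarrow> 'b::real_vector"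
  assumes "compactly_supported U" "compactly_supported W"
  shows "compactly_supported (\<lambda>x. U x + f x *\<^sub>R (W x - U x))"
proof -
  obtain R where R: "\<And>x. norm x \<ge> R \<Longrightarrow> U x = 0" using compactly_supported_ball[OF assms(1)] by metis
  obtain R' where R': "\<And>x. norm x \<ge> R' \<Longrightarrow> W x = 0" using compactly_supported_ball[OF assms(2)] by metis
  show ?thesis
    by (rule compactly_supported_if_ball[of "max R R'"]) (simp add: R R')
qed

lemma compactly_supported_diff:
  fixes U W :: "'a::euclidean_space \<Rightarrow> 'b::real_vector"
  assumes "compactly_supported U" "compactly_supported W"
  shows "compactly_supported (\<lambda>x. U x - W x)"
proof -
  obtain R where R: "\<And>x. norm x \<ge> R \<Longrightarrow> U x = 0" using compactly_supported_ball[OF assms(1)] by metis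
  obtain R' where R': "\<And>x. norm x \<ge> R' \<Longrightarrow> W x = 0" using compactly_supported_ball[OF assms(2)] by metis
  show ?thesis
    by (rule compactly_supported_if_ball[of "max R R'"]) (simp add: R R')
qed

lemma fields_in_mix:
  assumes "U \<in> fields_in S" "W \<in> fields_in S" "C_k 1 f" "\<And>x. 0 \<le> f x" "\<And>x. f x \<le> 1" "\<And>p. convex (S p)"
  shows "(\<lambda>x. U x + f x *\<^sub>R (W x - U x)) \<in> fields_in S"
  unfolding fields_in_def
proof (intro CollectI conjI allI)
  show "C_k 1 (\<lambda>x. U x + f x *\<^sub>R (W x - U x))"
    using assms by (intro C_k_1_add C_k_1_scaleR C_k_1_diff) (auto simp: fields_in_def)
  show "compactly_supported (\<lambda>x. U x + f x *\<^sub>R (W x - U x))"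
    using assms by (intro compactly_supported_mix) (auto simp: fields_in_def)
  show "U p + f p *\<^sub>R (W p - U p) \<in> S p" for p
  proof -
    have "(1 - f p) *\<^sub>R U p + f p *\<^sub>R W p \<in> S p"
      using assms by (intro convexD_alt) (auto simp: fields_in_def)
    then show ?thesis by (simp add: algebra_simps)
  qed
qed

lemma flux_mix:
  assumes U: "C_k 1 U" "compactly_supported U" and W: "C_k 1 W" "compactly_supported W" and f: "C_k 1 f"
    and E [measurable]: "E \<in> sets borel"
  shows "flux E (\<lambda>x. U x + f x *\<^sub>R (W x - U x))
     = flux E U + (LBINT x. indicator E x * f x * trace_div (\<lambda>x. W x - U x) x)
       + (LBINT x. indicator E x * fderiv f x (W x - U x))"
proof -
  let ?Z = "\<lambda>x. W x - U x"
  have Z: "C_k 1 ?Z" by (intro C_k_1_diff U W)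
  have zero: "trace_div ?Z x = trace_div W x - trace_div U x" for x
    by (rule trace_div_diff[OF W(1) U(1)])
  obtain R where R: "\<And>x. norm x \<ge> R \<Longrightarrow> U x = 0" using compactly_supported_ball[OF U(2)] by metis
  obtain R' where R': "\<And>x. norm x \<ge> R' \<Longrightarrow> W x = 0" using compactly_supported_ball[OF W(2)] by metis
  have "integrable lborel (\<lambda>x. f x * trace_div ?Z x)"
  proof (rule integrable_continuous_support[of _ "max R R'"])
    show "continuous_on UNIV (\<lambda>x. f x * trace_div ?Z x)"
      by (rule continuous_on_mult[OF C_k_1_continuous[OF f] continuous_trace_div[OF Z]])
  qed (use trace_div_zero_outside[of R U, OF R] trace_div_zero_outside[of R' W, OF R'] in \<open>simp add: zero\<close>)
  from integrable_mult_indicator[OF _ this, of E]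
  have i1: "integrable lborel (\<lambda>x. indicator E x * f x * trace_div ?Z x)" by (simp add: mult_ac)
  have "integrable lborel (\<lambda>x. fderiv f x (?Z x))"
    by (rule integrable_continuous_support[of _ "max R R'",
          OF C_k_1_continuous_fderiv_comp[OF f continuous_on_id C_k_1_continuous[OF Z]]])
       (simp add: R R' linear_0[OF linear_fderiv[OF f]])
  from integrable_mult_indicator[OF _ this, of E]
  have i2: "integrable lborel (\<lambda>x. indicator E x * fderiv f x (?Z x))" by simp
  have td: "trace_div (\<lambda>x. U x + f x *\<^sub>R ?Z x) x = trace_div U x + (f x * trace_div ?Z x
      + fderiv f x (?Z x))" for x
    by (simp only: trace_div_add[OF U(1) C_k_1_scaleR[OF f Z]] trace_div_scaleR[OF f Z])
  have "flux E (\<lambda>x. U x + f x *\<^sub>R ?Z x)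
     = (LBINT x. indicator E x * trace_div U x + indicator E x * f x * trace_div ?Z x
         + indicator E x * fderiv f x (?Z x))"
    unfolding flux_def td
    by (intro Bochner_Integration.integral_cong refl) (simp add: algebra_simps)
  then show ?thesis
    using i1 i2 integrable_flux[OF U E] by (simp add: flux_def)
qed

text \<open>Let \<open>U\<close> and \<open>W\<close> be test fields for \<open>E \<inter> F\<close> and \<open>E \<union> F\<close>. Test \<open>E\<close> with \<open>W + f *\<^sub>R (U - W)\<close>, where
  \<open>f\<close> mollifies the indicator of \<open>F\<close>, and \<open>F\<close> with the same expression with \<open>f\<close> mollifying the
  indicator of \<open>E\<close>; both fields are admissible because the constraint is convex. In the sum of the
  fluxes the terms without derivatives of \<open>f\<close> count the divergence of \<open>U - W\<close> twice on \<open>E \<inter> F\<close>,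
  and the commutator takes one of them away in the limit.\<close>

lemma variation_submodular:
  fixes E F :: "'a::euclidean_space set"
  assumes E [measurable]: "E \<in> sets borel" "emeasure lborel E < \<infinity>"
    and F [measurable]: "F \<in> sets borel" "emeasure lborel F < \<infinity>"
    and conv: "\<And>p. convex (S p)"
  shows "variation S (E \<inter> F) + variation S (E \<union> F) \<le> variation S E + variation S F"
proof -
  have key: "ereal (flux (E \<inter> F) U) + ereal (flux (E \<union> F) W) \<le> variation S E + variation S F"
    if U: "U \<in> fields_in S" and W: "W \<in> fields_in S" for U W
  proof -
    have U': "C_k 1 U" "compactly_supported U" and W': "C_k 1 W" "compactly_supported W"
      using U W by (auto simp: fields_in_def)
    let ?Z = "\<lambda>x. U x - W x"
    have Z: "C_k 1 ?Z" "compactly_supported ?Z"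
      by (intro C_k_1_diff compactly_supported_diff U' W')+
    obtain C where C: "\<And>x. \<bar>trace_div ?Z x\<bar> \<le> C" using trace_div_bounded[OF Z] by metis
    let ?fE = "\<lambda>n. smooth_indicator (scale_seq n) E" and ?fF = "\<lambda>n. smooth_indicator (scale_seq n) F"
    let ?IE = "\<lambda>n. LBINT x. indicator E x * ?fF n x * trace_div ?Z x"
    let ?IF = "\<lambda>n. LBINT x. indicator F x * ?fE n x * trace_div ?Z x"
    let ?D = "\<lambda>n. (LBINT x. indicator E x * fderiv (?fF n) x (?Z x))
        + (LBINT x. indicator F x * fderiv (?fE n) x (?Z x))"
    let ?lim = "flux E W + flux F W
       + (LBINT x. indicator E x * indicator F x * trace_div ?Z x)
       + (LBINT x. indicator F x * indicator E x * trace_div ?Z x)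
       + - (LBINT x. indicator (E \<inter> F) x * trace_div ?Z x)"
    have C1: "C_k 1 (?fE n)" "C_k 1 (?fF n)" for n
      by (rule smooth_indicator_has_derivative(2)[OF scale_seq_pos]; fact)+
    let ?WE = "\<lambda>n x. W x + ?fF n x *\<^sub>R ?Z x" and ?WF = "\<lambda>n x. W x + ?fE n x *\<^sub>R ?Z x"
    have in1: "?WE n \<in> fields_in S" for n
      by (rule fields_in_mix[OF W U C1(2) _ _ conv]) (use smooth_indicator_bounds[OF F(1)] in auto)
    have in2: "?WF n \<in> fields_in S" for n
      by (rule fields_in_mix[OF W U C1(1) _ _ conv]) (use smooth_indicator_bounds[OF E(1)] in auto)
    have "(\<lambda>n. flux E W + flux F W + ?IE n + ?IF n + ?D n)
      \<longlonglongrightarrow> ?lim"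
      by (intro tendsto_add tendsto_const commutator_tendsto[OF E F Z]
          smooth_indicator_tendsto[OF E F borel_measurable_trace_div[OF Z(1)] C]
          smooth_indicator_tendsto[OF F E borel_measurable_trace_div[OF Z(1)] C])
    moreover have "?lim
       = flux (E \<inter> F) U + flux (E \<union> F) W"
    proof -
      have a: "(LBINT x. indicator F x * indicator E x * trace_div ?Z x)
          = (LBINT x. indicator (E \<inter> F) x * trace_div ?Z x)"
        by (intro Bochner_Integration.integral_cong refl) (auto simp: indicator_def)
      have b: "(LBINT x. indicator E x * indicator F x * trace_div ?Z x) = flux (E \<inter> F) U - flux (E \<inter> F) W"
      proof -
        have "flux (E \<inter> F) U - flux (E \<inter> F) W
            = (LBINT x. indicator (E \<inter> F) x * trace_div U x - indicator (E \<inter> F) x * trace_div W x)"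
          unfolding flux_def
          by (intro Bochner_Integration.integral_diff[symmetric] integrable_flux U' W') auto
        also have "\<dots> = (LBINT x. indicator E x * indicator F x * trace_div ?Z x)"
          by (intro Bochner_Integration.integral_cong refl)
             (auto simp: trace_div_diff[OF U'(1) W'(1)] indicator_def)
        finally show ?thesis by simp
      qed
      have c: "flux E W + flux F W = flux (E \<inter> F) W + flux (E \<union> F) W"
      proof -
        have "flux E W + flux F W = (LBINT x. indicator E x * trace_div W x
            + indicator F x * trace_div W x)"
          unfolding flux_def by (intro Bochner_Integration.integral_add[symmetric] integrable_flux W' E F)
        also have "\<dots> = (LBINT x. indicator (E \<inter> F) x * trace_div W x + indicator (E \<union> F) x * trace_div W x)"
          by (intro Bochner_Integration.integral_cong refl) (auto simp: indicator_def)
        also have "\<dots> = flux (E \<inter> F) W + flux (E \<union> F) W"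
          unfolding flux_def by (intro Bochner_Integration.integral_add integrable_flux W') auto
        finally show ?thesis .
      qed
      show ?thesis unfolding a b c by simp
    qed
    moreover have "flux E (?WE n) + flux F (?WF n) = flux E W + flux F W + ?IE n + ?IF n + ?D n" for n
      unfolding flux_mix[OF W' U' C1(2) E(1)] flux_mix[OF W' U' C1(1) F(1)] by simp
    ultimately have "(\<lambda>n. flux E (?WE n) + flux F (?WF n)) \<longlonglongrightarrow> flux (E \<inter> F) U + flux (E \<union> F) W"
      by simp
    then have lim: "(\<lambda>n. ereal (flux E (?WE n) + flux F (?WF n))) \<longlonglongrightarrow> ereal (flux (E \<inter> F) U + flux (E \<union> F) W)"
      by simp
    have le: "ereal (flux E (?WE n) + flux F (?WF n)) \<le> variation S E + variation S F" for n
      unfolding variation_def plus_ereal.simps(1)[symmetric]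
      by (intro add_mono SUP_upper in1 in2)
    have "ereal (flux (E \<inter> F) U + flux (E \<union> F) W) \<le> variation S E + variation S F"
      by (rule LIMSEQ_le_const2[OF lim]) (use le in blast)
    then show ?thesis by simp
  qed
  show ?thesis
  proof (cases "fields_in S = {}")
    case True
    then show ?thesis by (simp add: variation_def)
  next
    case False
    then obtain W where W: "W \<in> fields_in S" by blast
    show ?thesis
    proof (cases "variation S E + variation S F")
      case (real c)
      have *: "variation S (E \<inter> F) \<le> ereal (c - flux (E \<union> F) W)" if "W \<in> fields_in S" for W
        unfolding variation_def
        by (intro SUP_least) (use key[OF _ that] real in \<open>auto simp: le_diff_eq\<close>)
      have inf: "ereal (flux (E \<inter> F) W) \<le> variation S (E \<inter> F)"
        unfolding variation_def by (rule SUP_upper[OF W])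
      obtain d where d: "variation S (E \<inter> F) = ereal d"
        using *[OF W] inf by (cases "variation S (E \<inter> F)") auto
      have "variation S (E \<union> F) \<le> ereal (c - d)"
        unfolding variation_def[of S "E \<union> F"]
        by (intro SUP_least) (use * d in \<open>fastforce simp: le_diff_eq\<close>)
      then show ?thesis unfolding d real by (cases "variation S (E \<union> F)") auto
    next
      case MInf
      then have False using key[OF W W] unfolding MInf by simp
      then show ?thesis ..
    next
      case PInf
      show ?thesis unfolding PInf by simp
    qed
  qed
qed

lemma measure_cbox_cube_side:
  fixes b :: "'a::euclidean_space"
  assumes b: "b \<in> Basis" and t: "0 \<le> t" "t \<le> c"
  shows "measure lborel (cbox (t *\<^sub>R b) (c *\<^sub>R One)) = c ^ (DIM('a) - 1) * (c - t)"
proof -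
  have le: "(t *\<^sub>R b) \<bullet> b' \<le> (c *\<^sub>R One) \<bullet> b'" if "b' \<in> Basis" for b'
    using that t b by (auto simp: inner_Basis)
  have "measure lborel (cbox (t *\<^sub>R b) (c *\<^sub>R One)) = (\<Prod>b'\<in>Basis. (c *\<^sub>R One - t *\<^sub>R b) \<bullet> b')"
    using le by (simp add: measure_lborel_cbox_eq)
  also have "\<dots> = (c *\<^sub>R One - t *\<^sub>R b) \<bullet> b * (\<Prod>b'\<in>Basis - {b}. (c *\<^sub>R One - t *\<^sub>R b) \<bullet> b')"
    using b by (simp add: prod.remove)
  also have "(\<Prod>b'\<in>Basis - {b}. (c *\<^sub>R One - t *\<^sub>R b) \<bullet> b') = (\<Prod>b'\<in>Basis - {b}. c)"
    by (rule prod.cong) (use b in \<open>auto simp: inner_diff_left inner_Basis\<close>)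
  also have "\<dots> = c ^ (DIM('a) - 1)"
    using b by (simp add: card_Diff_singleton)
  finally show ?thesis using b by (simp add: inner_diff_left mult.commute)
qed

text \<open>Translating the cube by \<open>1 / n\<close> along an edge alters it on two slabs of total measure
  \<open>2 * c ^ (d - 1) / n\<close>, so the difference quotients of its indicator are bounded in \<open>L\<^sup>1\<close>. The
  bound depends on \<open>U\<close> only through its maximum near the cube.\<close>

lemma flux_cube_bound:
  fixes U :: "'a::euclidean_space \<Rightarrow> 'a"
  assumes c: "c > 0" and U: "C_k 1 U" "compactly_supported U"
    and R: "\<And>x::'a. x \<in> cbox 0 (c *\<^sub>R One) \<Longrightarrow> norm x \<le> R"
    and M: "\<And>x. norm x \<le> R + 1 \<Longrightarrow> norm (U x) \<le> M"
  shows "flux (cbox 0 (c *\<^sub>R One)) U \<le> real DIM('a) * (2 * M * c ^ (DIM('a) - 1))"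
proof -
  let ?Q = "cbox 0 (c *\<^sub>R One) :: 'a set"
  have "0 \<in> ?Q" using c by (simp add: mem_box)
  then have "R \<ge> 0" using R[of 0] by simp
  then have "norm (U 0) \<le> M" by (intro M) simp
  then have M0: "M \<ge> 0" using norm_ge_zero order_trans by blast
  have Q: "?Q \<in> sets borel" "emeasure lborel ?Q < \<infinity>"
    using emeasure_lborel_cbox_finite by auto
  have side: "\<bar>LBINT x. indicator ?Q x * fderiv (\<lambda>x. U x \<bullet> b) x b\<bar> \<le> 2 * M * c ^ (DIM('a) - 1)"
    if b: "b \<in> Basis" for b
  proof -
    let ?f = "\<lambda>x. U x \<bullet> b"
    have f: "C_k 1 ?f" "compactly_supported ?f"
      by (rule C_k_1_inner_left[OF U(1)], rule compactly_supported_inner[OF U(2)])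
    have [measurable]: "?f \<in> borel_measurable borel"
      by (rule borel_measurable_continuous_onI[OF C_k_1_continuous[OF f(1)]])
    let ?t = "\<lambda>n. inverse (real (Suc n))"
    let ?D = "\<lambda>n x. indicat_real ?Q (x - b /\<^sub>R real (Suc n)) - indicat_real ?Q x"
    have "\<forall>\<^sub>F n in sequentially. ?t n < c"
      using order_tendstoD(2)[OF LIMSEQ_inverse_real_of_nat c] .
    then have "\<forall>\<^sub>F n in sequentially. \<bar>real (Suc n) * (LBINT x. ?D n x * ?f x)\<bar> \<le> 2 * M * c ^ (DIM('a) - 1)"
    proof eventually_elim
      case (elim n)
      let ?T = "\<lambda>x::'a. x - b /\<^sub>R real (Suc n)"
      note T = distr_lborel_shift[of "b /\<^sub>R real (Suc n)"]
      have Tm [measurable]: "?T \<in> borel_measurable borel" by measurable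
      have intQ: "integrable lborel (indicat_real ?Q)"
        using Q by (simp add: integrable_indicator_iff)
      have intD: "integrable lborel (?D n)"
        by (intro Bochner_Integration.integrable_diff intQ integrable_measure_preserving[OF T Tm])
      have bound: "norm (?D n x * ?f x) \<le> M * \<bar>?D n x\<bar>" for x
      proof (cases "?D n x = 0")
        case False
        then have "x \<in> ?Q \<or> ?T x \<in> ?Q" by (auto simp: indicator_def split: if_splits)
        then have "norm x \<le> R + 1"
        proof
          assume "?T x \<in> ?Q"
          then have "norm (?T x) \<le> R" by (rule R)
          moreover have "norm (b /\<^sub>R real (Suc n)) \<le> 1" using b by (simp add: field_simps)
          ultimately show ?thesis using norm_triangle_ineq[of "?T x" "b /\<^sub>R real (Suc n)"] by simp
        qed (use R in fastforce)
        then have "\<bar>?f x\<bar> \<le> M"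
          using M[of x] Basis_le_norm[OF b, of "U x"] by linarith
        then show ?thesis by (simp add: abs_mult mult.commute mult_right_mono)
      qed simp
      have "norm (LBINT x. ?D n x * ?f x) \<le> (LBINT x. M * \<bar>?D n x\<bar>)"
      proof (rule Bochner_Integration.integral_norm_bound_integral)
        show i: "integrable lborel (\<lambda>x. M * \<bar>?D n x\<bar>)"
          by (intro integrable_mult_right integrable_abs intD)
        show "integrable lborel (\<lambda>x. ?D n x * ?f x)"
          by (rule Bochner_Integration.integrable_bound[OF i])
             (use bound M0 in \<open>auto simp: abs_mult\<close>)
      qed (rule bound)
      also have "\<dots> = M * (2 * measure lborel ?Q - 2 * measure lborel (?Q \<inter> ?T -` ?Q))"
        using integral_abs_indicator_preimage_diff[OF T Tm Q] by simp
      also have "\<dots> \<le> M * (2 * c ^ (DIM('a) - 1) * ?t n)"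
      proof (rule mult_left_mono[OF _ M0])
        have "cbox (?t n *\<^sub>R b) (c *\<^sub>R One) \<subseteq> ?Q \<inter> ?T -` ?Q"
        proof
          fix x assume x: "x \<in> cbox (?t n *\<^sub>R b) (c *\<^sub>R One)"
          have tb: "0 \<le> (?t n *\<^sub>R b) \<bullet> b'" if "b' \<in> Basis" for b'
            using that b by (simp add: inner_Basis)
          show "x \<in> ?Q \<inter> ?T -` ?Q"
            using x tb by (force simp: mem_box inner_diff_left divide_inverse)
        qed
        then have "measure lborel (cbox (?t n *\<^sub>R b) (c *\<^sub>R One)) \<le> measure lborel (?Q \<inter> ?T -` ?Q)"
          using Q by (intro measure_mono_fmeasurable)
            (auto simp: fmeasurable_def intro: le_less_trans[OF emeasure_mono, of _ ?Q]
                measurable_sets_borel[OF Tm])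
        moreover have "measure lborel (cbox (?t n *\<^sub>R b) (c *\<^sub>R One)) = c ^ (DIM('a) - 1) * (c - ?t n)"
          using elim by (intro measure_cbox_cube_side b) auto
        moreover have "measure lborel ?Q = c ^ (DIM('a) - 1) * c"
          using measure_cbox_cube_side[OF b, of 0 c] c by simp
        ultimately show "2 * measure lborel ?Q - 2 * measure lborel (?Q \<inter> ?T -` ?Q)
            \<le> 2 * c ^ (DIM('a) - 1) * ?t n"
          by (simp add: algebra_simps)
      qed
      finally have "\<bar>LBINT x. ?D n x * ?f x\<bar> \<le> 2 * M * c ^ (DIM('a) - 1) * ?t n" by (simp add: mult_ac)
      then have "real (Suc n) * \<bar>LBINT x. ?D n x * ?f x\<bar>
          \<le> real (Suc n) * (2 * M * c ^ (DIM('a) - 1) * ?t n)"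
        by (rule mult_left_mono) simp
      also have "\<dots> = 2 * M * c ^ (DIM('a) - 1)"
        by (simp del: of_nat_Suc)
      finally show ?case by (simp only: abs_mult abs_of_nat)
    qed
    moreover have "(\<lambda>n. \<bar>real (Suc n) * (LBINT x. ?D n x * ?f x)\<bar>)
      \<longlonglongrightarrow> \<bar>LBINT x. indicator ?Q x * fderiv ?f x b\<bar>"
      by (intro tendsto_rabs integral_fderiv_indicator_tendsto f Q)
    ultimately show ?thesis by (intro tendsto_upperbound) auto
  qed
  have int: "integrable lborel (\<lambda>x. indicator ?Q x * fderiv (\<lambda>x. U x \<bullet> b) x b)" for b
  proof -
    obtain R where R: "\<And>x. norm x \<ge> R \<Longrightarrow> U x \<bullet> b = 0"
      using compactly_supported_ball[OF compactly_supported_inner[OF U(2)]] by metis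
    have "integrable lborel (\<lambda>x. fderiv (\<lambda>x. U x \<bullet> b) x b)"
      by (rule integrable_continuous_support[OF C_k_1_continuous_fderiv[OF C_k_1_inner_left[OF U(1)]]])
         (rule fderiv_zero_outside[OF R])
    from integrable_mult_indicator[OF _ this, of ?Q] show ?thesis by simp
  qed
  have "flux ?Q U = (LBINT x. (\<Sum>b\<in>Basis. indicator ?Q x * fderiv (\<lambda>x. U x \<bullet> b) x b))"
    unfolding flux_def trace_div_def by (simp add: fderiv_inner[OF U(1)] sum_distrib_left)
  also have "\<dots> = (\<Sum>b\<in>Basis. LBINT x. indicator ?Q x * fderiv (\<lambda>x. U x \<bullet> b) x b)"
    by (rule Bochner_Integration.integral_sum[OF int])
  also have "\<dots> \<le> (\<Sum>b\<in>(Basis :: 'a set). 2 * M * c ^ (DIM('a) - 1))"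
    by (intro sum_mono) (use side in fastforce)
  finally show ?thesis by simp
qed

section \<open>Differentials of left translations are unipotent\<close>

lemma index_less_induct [case_names less]:
  fixes i :: "'n::{finite,linorder}"
  assumes "\<And>i. (\<And>k. k < i \<Longrightarrow> P k) \<Longrightarrow> P i"
  shows "P i"
proof (induction "card {..<i}" arbitrary: i rule: less_induct)
  case less
  show ?case
  proof (rule assms)
    fix k assume "k < i"
    then have "{..<k} \<subset> {..<i}" by auto
    then show "P k" by (intro less) (auto intro: psubset_card_mono)
  qed
qed

text \<open>For linear \<open>f\<close> this says that the matrix of \<open>f\<close> is lower triangular with ones on the diagonal.
  Phrased through vanishing coordinates, the property passes to compositions and inverses without
  matrix computations.\<close>

definition lower_unipotent :: "(real^'n::{finite,linorder} \<Rightarrow> real^'n::{finite,linorder}) \<Rightarrow> bool" where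
  "lower_unipotent f \<longleftrightarrow> (\<forall>v i. (\<forall>k<i. v $ k = 0) \<longrightarrow> f v $ i = v $ i)"

lemma lower_unipotent_compose:
  assumes "lower_unipotent f" "lower_unipotent h"
  shows "lower_unipotent (\<lambda>v. f (h v))"
  using assms unfolding lower_unipotent_def by (metis order.strict_trans)

lemma lower_unipotent_right_inverse:
  fixes f h :: "real^'n::{finite,linorder} \<Rightarrow> real^'n::{finite,linorder}"
  assumes f: "lower_unipotent f" and fh: "\<And>v. f (h v) = v"
  shows "lower_unipotent h"
  unfolding lower_unipotent_def
proof (intro allI impI)
  fix v :: "(real,'n) vec" and i assume v: "\<forall>k<i. v $ k = 0"
  have "\<forall>k<i. h v $ k = 0"
  proof (intro allI impI)
    fix k assume "k < i"
    then show "h v $ k = 0"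
    proof (induction k rule: index_less_induct)
      case (less k)
      then have "\<forall>l<k. h v $ l = 0" by (meson order.strict_trans)
      then have "f (h v) $ k = h v $ k" using f by (simp add: lower_unipotent_def)
      then show ?case using fh v less by simp
    qed
  qed
  then have "f (h v) $ i = h v $ i" using f by (simp add: lower_unipotent_def)
  then show "h v $ i = v $ i" using fh by simp
qed

context nilpotent_group
begin

lemma mul_assoc: "mul (mul a b) c = mul a (mul b c)"
  and mul_0_left [simp]: "mul 0 a = a"
  and mul_0_right [simp]: "mul a 0 = a"
  and mul_inverse_left [simp]: "mul (- a) a = 0"
  and mul_inverse_right [simp]: "mul a (- a) = 0"
proof -
  interpret G: Groups.group mul 0 uminus by (rule group_law)
  show "mul (mul a b) c = mul a (mul b c)" by (rule G.assoc)
  show "mul 0 a = a" "mul a 0 = a" "mul (- a) a = 0" "mul a (- a) = 0"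
    by (simp_all)
qed

lemma mul_cancel_left [simp]: "mul (- a) (mul a b) = b" "mul a (mul (- a) b) = b"
  by (simp_all flip: mul_assoc)

lemma minus_mul: "- mul a b = mul (- b) (- a)"
proof -
  interpret G: Groups.group mul 0 uminus by (rule group_law)
  show ?thesis by (rule G.inverse_distrib_swap)
qed

definition dmul :: "((real,'n) vec) \<times> ((real,'n) vec) \<Rightarrow> ((real,'n) vec) \<times> ((real,'n) vec) \<Rightarrow>
    (real,'n) vec" where
  "dmul z = fderiv (\<lambda>(x, y). mul x y) z"

lemma C_k_mul: "C_k (Suc (Suc 0)) (\<lambda>(x, y). mul x y)"
  using smooth_law unfolding smooth_def by blast

lemma has_derivative_mul_pair:
  "((\<lambda>(x, y). mul x y) has_derivative dmul z) (at z)"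
  using C_k_mul unfolding dmul_def C_k_Suc_iff frechet_derivative_works by blast

lemma dmul_C1: "C_k 1 (\<lambda>z. dmul z v)"
  using C_k_mul unfolding dmul_def C_k_Suc_iff[of "Suc 0"] One_nat_def by blast

lemma linear_dmul: "linear (dmul z)"
  using has_derivative_mul_pair has_derivative_linear by blast

lemma has_derivative_mul:
  assumes "(f has_derivative f') (at x within S)" "(h has_derivative h') (at x within S)"
  shows "((\<lambda>x. mul (f x) (h x)) has_derivative (\<lambda>v. dmul (f x, h x) (f' v, h' v))) (at x within S)"
  using has_derivative_compose[OF has_derivative_Pair[OF assms] has_derivative_mul_pair] by simp

lemma has_derivative_left_mul: "(mul a has_derivative (\<lambda>v. dmul (a, p) (0, v))) (at p)"
  using has_derivative_mul[OF has_derivative_const has_derivative_ident, of a p] by simp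

lemma dL_eq: "dL mul a p v = dmul (a, p) (0, v)"
  unfolding dL_def using frechet_derivative_at[OF has_derivative_left_mul] by metis

lemma has_derivative_dL: "(mul a has_derivative dL mul a p) (at p)"
  using has_derivative_left_mul unfolding dL_eq[abs_def] .

lemma linear_dL: "linear (dL mul a p)"
  using has_derivative_dL has_derivative_linear by blast

lemma dL_chain: "dL mul a (mul b p) (dL mul b p v) = dL mul (mul a b) p v"
proof -
  have "((\<lambda>q. mul a (mul b q)) has_derivative (\<lambda>v. dL mul a (mul b p) (dL mul b p v))) (at p)"
    by (rule has_derivative_compose[OF has_derivative_dL has_derivative_dL])
  moreover have "(\<lambda>q. mul a (mul b q)) = mul (mul a b)"
    by (simp add: fun_eq_iff mul_assoc)
  ultimately have "(mul (mul a b) has_derivative (\<lambda>v. dL mul a (mul b p) (dL mul b p v))) (at p)"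
    by simp
  then show ?thesis
    using has_derivative_unique[OF _ has_derivative_dL] by metis
qed

lemma dL_0 [simp]: "dL mul 0 p v = v"
proof -
  have "mul 0 = (\<lambda>q. q)" by (simp add: fun_eq_iff)
  then have "((\<lambda>q. q) has_derivative dL mul 0 p) (at p)"
    using has_derivative_dL[of 0 p] by simp
  then show ?thesis using has_derivative_unique[OF _ has_derivative_ident] by metis
qed

lemma dL_inverse: "dL mul a p (dL mul (- a) (mul a p) v) = v"
  "dL mul (- a) (mul a p) (dL mul a p v) = v"
  using dL_chain[of a "- a" "mul a p" v] dL_chain[of "- a" a p v] by simp_all

text \<open>The line through \<open>x\<close> is a one-parameter subgroup, so left translation by one of its points
  carries its velocity at \<open>0\<close> to its velocity at that point.\<close>

lemma dL_radial: "dL mul (t *\<^sub>R x) 0 x = x"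
proof -
  have "((\<lambda>s. mul (t *\<^sub>R x) (s *\<^sub>R x)) has_derivative (\<lambda>s. dL mul (t *\<^sub>R x) 0 (s *\<^sub>R x))) (at 0)"
    by (rule has_derivative_compose_at[OF _ has_derivative_dL]) (auto intro!: derivative_eq_intros)
  moreover have "((\<lambda>s. (t + s) *\<^sub>R x) has_derivative (\<lambda>s. s *\<^sub>R x)) (at 0)"
    by (auto intro!: derivative_eq_intros)
  ultimately have "(\<lambda>s. dL mul (t *\<^sub>R x) 0 (s *\<^sub>R x)) = (\<lambda>s. s *\<^sub>R x)"
    unfolding exp_coord by (rule has_derivative_unique)
  from fun_cong[OF this, of 1] show ?thesis by simp
qed

text \<open>The mixed second derivative of the group law at the identity, in direction \<open>u\<close> for the first and
  \<open>w\<close> for the second factor.\<close>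

definition mixed_deriv :: "(real,'n) vec \<Rightarrow> (real,'n) vec \<Rightarrow> (real,'n) vec" where
  "mixed_deriv u w = fderiv (left_ext mul w) 0 u"

lemma has_derivative_dmul: "((\<lambda>z. dmul z v) has_derivative fderiv (\<lambda>z. dmul z v) z) (at z)"
  using dmul_C1 unfolding C_k_1_iff frechet_derivative_works by blast

lemma left_ext_eq: "left_ext mul w p = dmul (p, 0) (0, w)"
  by (simp add: left_ext_def dL_eq)

lemma has_derivative_left_ext:
  "(left_ext mul w has_derivative (\<lambda>u. fderiv (\<lambda>z. dmul z (0, w)) (p, 0) (u, 0))) (at p)"
  unfolding left_ext_eq[abs_def]
  by (rule has_derivative_compose[OF has_derivative_Pair[OF has_derivative_ident has_derivative_const]
      has_derivative_dmul])

lemma mixed_deriv_eq: "mixed_deriv u w = fderiv (\<lambda>z. dmul z (0, w)) (0, 0) (u, 0)"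
  unfolding mixed_deriv_def using frechet_derivative_at[OF has_derivative_left_ext] by metis

lemma has_derivative_left_ext_0: "(left_ext mul w has_derivative (\<lambda>u. mixed_deriv u w)) (at 0)"
  unfolding mixed_deriv_eq by (rule has_derivative_left_ext)

lemma linear_mixed_deriv_left: "linear (\<lambda>u. mixed_deriv u w)"
  using has_derivative_left_ext_0 has_derivative_linear by blast

lemma linear_mixed_deriv_right: "linear (mixed_deriv u)"
proof (rule linearI)
  fix v w :: "(real,'n) vec" and c :: real
  have "left_ext mul (v + w) = (\<lambda>p. left_ext mul v p + left_ext mul w p)"
    by (auto simp: left_ext_def linear_add[OF linear_dL])
  then have "(left_ext mul (v + w) has_derivative (\<lambda>u. mixed_deriv u v + mixed_deriv u w)) (at 0)"
    by (auto intro!: has_derivative_add has_derivative_left_ext_0)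
  then show "mixed_deriv u (v + w) = mixed_deriv u v + mixed_deriv u w"
    using has_derivative_unique[OF _ has_derivative_left_ext_0] by metis
  have "left_ext mul (c *\<^sub>R v) = (\<lambda>p. c *\<^sub>R left_ext mul v p)"
    by (auto simp: left_ext_def linear_cmul[OF linear_dL])
  then have "(left_ext mul (c *\<^sub>R v) has_derivative (\<lambda>u. c *\<^sub>R mixed_deriv u v)) (at 0)"
    by (auto intro!: has_derivative_scaleR_right has_derivative_left_ext_0)
  then show "mixed_deriv u (c *\<^sub>R v) = c *\<^sub>R mixed_deriv u v"
    using has_derivative_unique[OF _ has_derivative_left_ext_0] by metis
qed

text \<open>By \<open>dL_radial\<close> the field \<open>left_ext mul x\<close> is constant along the line through \<open>x\<close>.\<close>

lemma mixed_deriv_diag: "mixed_deriv x x = 0"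
proof -
  have "((\<lambda>t. left_ext mul x (t *\<^sub>R x)) has_derivative (\<lambda>t. mixed_deriv (t *\<^sub>R x) x)) (at 0)"
    by (rule has_derivative_compose_at[OF _ has_derivative_left_ext_0])
       (auto intro!: derivative_eq_intros)
  then have "((\<lambda>t::real. x) has_derivative (\<lambda>t. mixed_deriv (t *\<^sub>R x) x)) (at 0)"
    by (simp add: left_ext_def dL_radial)
  then have "(\<lambda>t. mixed_deriv (t *\<^sub>R x) x) = (\<lambda>t. 0)"
    using has_derivative_unique[OF _ has_derivative_const] by blast
  from fun_cong[OF this, of 1] show ?thesis by simp
qed

lemma mixed_deriv_antisym: "mixed_deriv w u = - mixed_deriv u w"
  using mixed_deriv_diag[of "u + w"] mixed_deriv_diag[of u] mixed_deriv_diag[of w]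
    linear_add[OF linear_mixed_deriv_left] linear_add[OF linear_mixed_deriv_right]
  by (simp add: eq_neg_iff_add_eq_0 add.commute)

lemma bracket_eq: "bracket mul u w = 2 *\<^sub>R mixed_deriv u w"
proof -
  have "bracket mul u w = mixed_deriv u w - mixed_deriv w u"
    unfolding bracket_def lie_bracket_def by (simp add: mixed_deriv_def left_ext_def)
  then show ?thesis using mixed_deriv_antisym[of w u] by (simp add: scaleR_2)
qed

lemma linear_bracket: "linear (bracket mul u)"
  unfolding bracket_eq[abs_def]
  by (rule linear_compose_scale_right[OF linear_mixed_deriv_right])

text \<open>Inversion is \<open>x \<mapsto> - x\<close> and reverses products, so right translations are expressed through left
  ones. Derivatives in the first factor thereby reduce to \<open>mixed_deriv\<close> without an exchange of
  second derivatives.\<close>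

lemma dmul_right: "dmul (0, q) (u, 0) = dL mul (- q) 0 u"
proof -
  have "((\<lambda>p. mul p q) has_derivative (\<lambda>u. dmul (0, q) (u, 0))) (at 0)"
    using has_derivative_mul[OF has_derivative_ident has_derivative_const[of q], of 0 UNIV] by simp
  moreover have "((\<lambda>p. - mul (- q) (- p)) has_derivative (\<lambda>u. - dL mul (- q) 0 (- u))) (at 0)"
    by (intro has_derivative_minus has_derivative_compose_at[OF _ has_derivative_dL])
       (auto intro!: derivative_eq_intros)
  moreover have "(\<lambda>p. - mul (- q) (- p)) = (\<lambda>p. mul p q)"
    by (simp add: minus_mul)
  ultimately have "(\<lambda>u. dmul (0, q) (u, 0)) = (\<lambda>u. - dL mul (- q) 0 (- u))"
    by (metis has_derivative_unique)
  from fun_cong[OF this, of u] show ?thesis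
    by (simp add: linear_neg[OF linear_dL])
qed

text \<open>The derivative of \<open>s \<mapsto> exp (t *\<^sub>R (x + s *\<^sub>R w))\<close> at \<open>s = 0\<close>, carried to the tangent space at
  the identity by left translation; the exponential map is the identity in these coordinates.\<close>

definition exp_jacobi :: "(real,'n) vec \<Rightarrow> real \<Rightarrow> (real,'n) vec \<Rightarrow> (real,'n) vec" where
  "exp_jacobi x t w = dL mul (- (t *\<^sub>R x)) (t *\<^sub>R x) (t *\<^sub>R w)"

lemma exp_jacobi_has_derivative:
  "((\<lambda>s. mul (- (t *\<^sub>R x)) (t *\<^sub>R (x + s *\<^sub>R w))) has_derivative (\<lambda>s. s *\<^sub>R exp_jacobi x t w)) (at 0)"
proof -
  have "((\<lambda>s. mul (- (t *\<^sub>R x)) (t *\<^sub>R (x + s *\<^sub>R w))) has_derivative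
      (\<lambda>s. dL mul (- (t *\<^sub>R x)) (t *\<^sub>R x) (t *\<^sub>R (s *\<^sub>R w)))) (at 0)"
    by (rule has_derivative_compose_at[OF _ has_derivative_dL]) (auto intro!: derivative_eq_intros)
  then show ?thesis
    by (simp add: exp_jacobi_def linear_cmul[OF linear_dL] mult.commute)
qed

text \<open>All rays are one-parameter subgroups, so \<open>exp (- (t + h) x) exp ((t + h) (x + s w))\<close> is
  \<open>exp (- h x)\<close> times the same expression for \<open>t\<close> times \<open>exp (h (x + s w))\<close>. Differentiate at
  \<open>s = 0\<close>.\<close>

lemma exp_jacobi_add:
  "exp_jacobi x (t + h) w = dL mul (- (h *\<^sub>R x)) (h *\<^sub>R x) (dL mul (- (h *\<^sub>R x)) 0
      (exp_jacobi x t w) + h *\<^sub>R w)"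
proof -
  let ?e = "\<lambda>s. mul (- (t *\<^sub>R x)) (t *\<^sub>R (x + s *\<^sub>R w))"
  have e0: "?e 0 = 0" by simp
  have "((\<lambda>s. mul (?e s) (h *\<^sub>R (x + s *\<^sub>R w))) has_derivative
     (\<lambda>s. dmul (?e 0, h *\<^sub>R (x + 0 *\<^sub>R w)) (s *\<^sub>R exp_jacobi x t w, h *\<^sub>R (s *\<^sub>R w)))) (at 0)"
    by (rule has_derivative_mul[OF exp_jacobi_has_derivative]) (auto intro!: derivative_eq_intros)
  then have inner: "((\<lambda>s. mul (?e s) (h *\<^sub>R (x + s *\<^sub>R w))) has_derivative
     (\<lambda>s. dmul (0, h *\<^sub>R x) (s *\<^sub>R exp_jacobi x t w, h *\<^sub>R (s *\<^sub>R w)))) (at 0)"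
    by simp
  have "((\<lambda>s. mul (- (h *\<^sub>R x)) (mul (?e s) (h *\<^sub>R (x + s *\<^sub>R w)))) has_derivative
     (\<lambda>s. dL mul (- (h *\<^sub>R x)) (h *\<^sub>R x) (dmul (0, h *\<^sub>R x) (s *\<^sub>R exp_jacobi x t w, h *\<^sub>R
         (s *\<^sub>R w))))) (at 0)"
    by (rule has_derivative_compose_at[OF inner has_derivative_dL]) simp
  moreover have "mul (- (h *\<^sub>R x)) (mul (?e s) (h *\<^sub>R (x + s *\<^sub>R w)))
      = mul (- ((t + h) *\<^sub>R x)) ((t + h) *\<^sub>R (x + s *\<^sub>R w))" for s
  proof -
    have a: "- ((t + h) *\<^sub>R x) = mul (- (h *\<^sub>R x)) (- (t *\<^sub>R x))"
      using exp_coord[of t x h] minus_mul[of "t *\<^sub>R x" "h *\<^sub>R x"] by simp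
    show ?thesis
      by (subst a, subst exp_coord[of t _ h, symmetric]) (simp add: mul_assoc del: scaleR_left.add)
  qed
  ultimately have "((\<lambda>s. mul (- ((t + h) *\<^sub>R x)) ((t + h) *\<^sub>R (x + s *\<^sub>R w))) has_derivative
     (\<lambda>s. dL mul (- (h *\<^sub>R x)) (h *\<^sub>R x) (dmul (0, h *\<^sub>R x) (s *\<^sub>R exp_jacobi x t w, h *\<^sub>R
         (s *\<^sub>R w))))) (at 0)"
    by simp
  then have "(\<lambda>s. s *\<^sub>R exp_jacobi x (t + h) w) =
     (\<lambda>s. dL mul (- (h *\<^sub>R x)) (h *\<^sub>R x) (dmul (0, h *\<^sub>R x) (s *\<^sub>R exp_jacobi x t w, h *\<^sub>R (s *\<^sub>R w))))"
    using has_derivative_unique[OF exp_jacobi_has_derivative] by blast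
  from fun_cong[OF this, of 1]
  have "exp_jacobi x (t + h) w = dL mul (- (h *\<^sub>R x)) (h *\<^sub>R x) (dmul (0, h *\<^sub>R x)
      (exp_jacobi x t w, h *\<^sub>R w))"
    by simp
  also have "dmul (0, h *\<^sub>R x) (exp_jacobi x t w, h *\<^sub>R w)
      = dmul (0, h *\<^sub>R x) (exp_jacobi x t w, 0) + dmul (0, h *\<^sub>R x) (0, h *\<^sub>R w)"
    using linear_add[OF linear_dmul, of "(0, h *\<^sub>R x)" "(exp_jacobi x t w, 0)" "(0, h *\<^sub>R w)"] by simp
  also have "\<dots> = dL mul (- (h *\<^sub>R x)) 0 (exp_jacobi x t w) + h *\<^sub>R w"
    using dL_0[of "h *\<^sub>R x" "h *\<^sub>R w"] by (simp only: dmul_right dL_eq)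
  finally show ?thesis .
qed

lemma linear_dL_expand: "dL mul a p v = (\<Sum>i\<in>UNIV. v $ i *\<^sub>R dL mul a p (axis i 1))"
proof -
  have "dL mul a p v = dL mul a p (\<Sum>i\<in>UNIV. v $ i *\<^sub>R axis i 1)"
    using basis_expansion[of v] by (simp add: scalar_mult_eq_scaleR)
  then show ?thesis
    by (simp add: linear_sum[OF linear_dL] linear_cmul[OF linear_dL])
qed

text \<open>Along \<open>h \<mapsto> (- h x, h x)\<close> only the first slot of \<open>dmul\<close> contributes, because
  \<open>dmul (0, q) (0, z) = z\<close> for all \<open>q\<close>.\<close>

lemma has_derivative_dL_inverse_radial:
  "((\<lambda>h. dL mul (- (h *\<^sub>R x)) (h *\<^sub>R x) z) has_derivative (\<lambda>h. h *\<^sub>R (- mixed_deriv x z))) (at 0)"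
proof -
  let ?f = "\<lambda>z'. dmul z' (0, z)"
  have lin: "linear (fderiv ?f (0, 0))"
    using has_derivative_dmul has_derivative_linear by blast
  have 1: "((\<lambda>h. (- (h *\<^sub>R x), h *\<^sub>R x)) has_derivative (\<lambda>h. (- (h *\<^sub>R x), h *\<^sub>R x))) (at 0)"
    by (auto intro!: derivative_eq_intros)
  have D: "((\<lambda>h. ?f (- (h *\<^sub>R x), h *\<^sub>R x)) has_derivative
     (\<lambda>h. fderiv ?f (0, 0) (- (h *\<^sub>R x), h *\<^sub>R x))) (at 0)"
    by (rule has_derivative_compose_at[OF 1 has_derivative_dmul]) simp
  have 2: "((\<lambda>q. (0::(real,'n) vec, q)) has_derivative (\<lambda>h. (0, h))) (at 0)"
    by (auto intro!: derivative_eq_intros)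
  have "((\<lambda>q. ?f (0, q)) has_derivative (\<lambda>h. fderiv ?f (0, 0) (0, h))) (at 0)"
    by (rule has_derivative_compose_at[OF 2 has_derivative_dmul]) simp
  moreover have "(\<lambda>q. ?f (0, q)) = (\<lambda>q. z)"
    using dL_0 unfolding dL_eq by blast
  ultimately have "((\<lambda>q::(real,'n) vec. z) has_derivative (\<lambda>h. fderiv ?f (0, 0) (0, h))) (at 0)"
    by simp
  then have "(\<lambda>h. fderiv ?f (0, 0) (0, h)) = (\<lambda>h. 0)"
    by (rule has_derivative_unique[OF _ has_derivative_const])
  then have zero: "fderiv ?f (0, 0) (0, h) = 0" for h by (rule fun_cong)
  have "fderiv ?f (0, 0) (- (h *\<^sub>R x), h *\<^sub>R x) = h *\<^sub>R (- mixed_deriv x z)" for h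
    using linear_diff[OF lin, of "(0, h *\<^sub>R x)" "(h *\<^sub>R x, 0)"] zero
      linear_cmul[OF linear_mixed_deriv_left, of h x z]
    by (simp add: mixed_deriv_eq)
  with D show ?thesis by (simp add: dL_eq)
qed

text \<open>The derivative of \<open>exp_jacobi_add\<close> at \<open>h = 0\<close>: each of the two differentials on its right-hand
  side contributes \<open>- mixed_deriv x\<close>, and together they give minus the bracket.\<close>

lemma has_vector_derivative_exp_jacobi:
  "((\<lambda>t. exp_jacobi x t w) has_vector_derivative w - bracket mul x (exp_jacobi x t w)) (at t)"
proof -
  let ?u = "exp_jacobi x t w"
  let ?G = "\<lambda>h. dL mul (- (h *\<^sub>R x)) 0 ?u + h *\<^sub>R w"
  have 1: "((\<lambda>h. - (h *\<^sub>R x)) has_derivative (\<lambda>h. - (h *\<^sub>R x))) (at 0)"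
    by (auto intro!: derivative_eq_intros)
  have "((\<lambda>h. left_ext mul ?u (- (h *\<^sub>R x))) has_derivative (\<lambda>h. mixed_deriv (- (h *\<^sub>R x)) ?u)) (at 0)"
    by (rule has_derivative_compose_at[OF 1 has_derivative_left_ext_0]) simp
  then have G': "(?G has_derivative (\<lambda>h. mixed_deriv (- (h *\<^sub>R x)) ?u + h *\<^sub>R w)) (at 0)"
    unfolding left_ext_def by (intro has_derivative_add) (auto intro!: derivative_eq_intros)
  have G0: "?G 0 = ?u" by simp
  let ?B = "\<lambda>h z. dL mul (- (h *\<^sub>R x)) (h *\<^sub>R x) z"
  have B0: "?B 0 z = z" for z by simp
  have comp: "((\<lambda>h. ?G h $ i) has_derivative (\<lambda>h. (mixed_deriv (- (h *\<^sub>R x)) ?u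
      + h *\<^sub>R w) $ i)) (at 0)" for i
    by (rule bounded_linear.has_derivative[OF bounded_linear_vec_nth G'])
  have D: "((\<lambda>h. \<Sum>i\<in>UNIV. ?G h $ i *\<^sub>R ?B h (axis i 1)) has_derivative
     (\<lambda>h. \<Sum>i\<in>UNIV. ?G 0 $ i *\<^sub>R (h *\<^sub>R (- mixed_deriv x (axis i 1)))
         + (mixed_deriv (- (h *\<^sub>R x)) ?u + h *\<^sub>R w) $ i *\<^sub>R ?B 0 (axis i 1))) (at 0)"
    by (intro has_derivative_sum has_derivative_scaleR comp has_derivative_dL_inverse_radial)
  have s1: "(\<Sum>i\<in>UNIV. ?G h $ i *\<^sub>R ?B h (axis i 1)) = exp_jacobi x (t + h) w" for h
    unfolding exp_jacobi_add by (rule linear_dL_expand[symmetric])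
  have s2: "(\<Sum>i\<in>UNIV. ?G 0 $ i *\<^sub>R (h *\<^sub>R (- mixed_deriv x (axis i 1)))
         + (mixed_deriv (- (h *\<^sub>R x)) ?u + h *\<^sub>R w) $ i *\<^sub>R ?B 0 (axis i 1))
       = h *\<^sub>R (w - bracket mul x ?u)" for h
  proof -
    have "(\<Sum>i\<in>UNIV. ?u $ i *\<^sub>R (h *\<^sub>R (- mixed_deriv x (axis i 1))))
        = - (h *\<^sub>R mixed_deriv x (\<Sum>i\<in>UNIV. ?u $ i *\<^sub>R axis i 1))"
      by (simp add: linear_sum[OF linear_mixed_deriv_right] linear_cmul[OF linear_mixed_deriv_right]
          scaleR_sum_right sum_negf mult.commute)
    also have "(\<Sum>i\<in>UNIV. ?u $ i *\<^sub>R axis i 1) = ?u"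
      using basis_expansion[of ?u] by (simp add: scalar_mult_eq_scaleR)
    finally have a: "(\<Sum>i\<in>UNIV. ?u $ i *\<^sub>R (h *\<^sub>R (- mixed_deriv x (axis i 1))))
        = - (h *\<^sub>R mixed_deriv x ?u)" .
    have b: "(\<Sum>i\<in>UNIV. v $ i *\<^sub>R axis i 1) = v" for v :: "(real,'n) vec"
      using basis_expansion[of v] by (simp add: scalar_mult_eq_scaleR)
    have c: "mixed_deriv (- (h *\<^sub>R x)) ?u = - (h *\<^sub>R mixed_deriv x ?u)"
      using linear_cmul[OF linear_mixed_deriv_left, of "- h" x ?u] by simp
    show ?thesis
      unfolding sum.distrib G0 a B0 b c bracket_eq
      by (simp add: algebra_simps scaleR_2)
  qed
  from D have "((\<lambda>h. exp_jacobi x (t + h) w) has_derivative (\<lambda>h. h *\<^sub>R (w - bracket mul x ?u))) (at 0)"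
    unfolding s1 s2 .
  then have "((\<lambda>h. exp_jacobi x (t + h) w) has_vector_derivative (w - bracket mul x ?u)) (at 0)"
    by (simp add: has_vector_derivative_def)
  then have "((\<lambda>h. exp_jacobi x (t + h) w) has_vector_derivative (w - bracket mul x ?u)) (at (t - t))"
    by simp
  then have "((\<lambda>h. exp_jacobi x (t + h) w) \<circ> (\<lambda>s. s - t) has_vector_derivative 1 *\<^sub>R (w
      - bracket mul x ?u)) (at t)"
    by (intro vector_diff_chain_at) (auto intro!: derivative_eq_intros simp: has_vector_derivative_def)
  then show ?thesis by (simp add: o_def)
qed

lemma malcev_ideal_component:
  fixes v :: "(real,'n) vec"
  assumes "v \<in> malcev_ideal j" "i < j"
  shows "v $ i = 0"
proof -
  have "subspace {v :: (real,'n) vec. v $ i = 0}" by (auto simp: subspace_def)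
  moreover have "{axis k 1 |k. j \<le> k} \<subseteq> {v :: (real,'n) vec. v $ i = 0}"
    using \<open>i < j\<close> by (auto simp: axis_def)
  ultimately have "malcev_ideal j \<subseteq> {v :: (real,'n) vec. v $ i = 0}"
    unfolding malcev_ideal_def by (rule span_minimal[rotated])
  then show ?thesis using \<open>v \<in> malcev_ideal j\<close> by auto
qed

lemma bracket_component:
  "bracket mul x v $ i = (\<Sum>k\<in>UNIV. v $ k * bracket mul x (axis k 1) $ i)"
proof -
  have "bracket mul x v = bracket mul x (\<Sum>i\<in>UNIV. v $ i *\<^sub>R axis i 1)"
    using basis_expansion[of v] by (simp add: scalar_mult_eq_scaleR)
  then show ?thesis
    by (simp add: linear_sum[OF linear_bracket] linear_cmul[OF linear_bracket])
qed

text \<open>The Malcev ideals make \<open>ad x\<close> lower triangular. A diagonal entry \<open>a\<close> of it satisfies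
  \<open>a ^ r = 0\<close>, since \<open>r\<close>-fold brackets vanish.\<close>

lemma bracket_strictly_lower:
  assumes "i \<le> j"
  shows "bracket mul x (axis j 1) $ i = 0"
proof -
  have ideal: "bracket mul x v \<in> malcev_ideal j" if "v \<in> malcev_ideal j" for v j
    using malcev_is_ideal that unfolding lie_ideal_def by blast
  have axis_in: "axis j 1 \<in> malcev_ideal j" for j :: 'n
    unfolding malcev_ideal_def by (rule span_base) auto
  show ?thesis
  proof (cases "i = j")
    case False
    then show ?thesis using assms malcev_ideal_component[OF ideal[OF axis_in]] by simp
  next
    case True
    let ?a = "bracket mul x (axis j 1) $ j"
    have comp: "bracket mul x v $ j = ?a * v $ j" if "v \<in> malcev_ideal j" for v
    proof -
      have "v $ k * bracket mul x (axis k 1) $ j = (if k = j then ?a * v $ j else 0)" for k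
        using malcev_ideal_component[OF that, of k] malcev_ideal_component[OF ideal[OF axis_in[of k]], of j]
        by (cases k j rule: linorder_cases) auto
      then show ?thesis unfolding bracket_component[of x v] by simp
    qed
    have pow: "(bracket mul x ^^ n) (axis j 1) \<in> malcev_ideal j
        \<and> (bracket mul x ^^ n) (axis j 1) $ j = ?a ^ n
        \<and> (bracket mul x ^^ n) (axis j 1) \<in> lower_central mul n" for n
    proof (induction n)
      case 0
      then show ?case using axis_in by (simp add: axis_def)
    next
      case (Suc n)
      then show ?case
        using comp ideal by (auto simp: bracket_span_def intro!: span_base)
    qed
    have "(bracket mul x ^^ r) (axis j 1) = 0"
      using pow[of r] unfolding step(1) by blast
    moreover have "(bracket mul x ^^ r) (axis j 1) $ j = ?a ^ r"
      using pow[of r] by blast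
    ultimately have "?a ^ r = 0" by simp
    then show ?thesis using True by simp
  qed
qed

text \<open>Induction on \<open>i\<close>: the component \<open>i\<close> of the bracket involves only components below \<open>i\<close>, which
  vanish, so the differential equation says that this component grows with constant speed \<open>v $ i\<close>.\<close>

lemma exp_jacobi_lower:
  assumes "\<forall>k<i. v $ k = 0"
  shows "exp_jacobi x t v $ i = t * v $ i"
  using assms
proof (induction i arbitrary: t rule: index_less_induct)
  case (less i)
  have lower: "exp_jacobi x t v $ k = 0" if "k < i" for k t
  proof -
    have "\<forall>l<k. v $ l = 0" using less.prems that by (meson order.strict_trans)
    then show ?thesis using less.IH[OF that, of t] less.prems that by simp
  qed
  have "bracket mul x (exp_jacobi x t v) $ i = 0" for t
    unfolding bracket_component[of x "exp_jacobi x t v"]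
  proof (rule sum.neutral, intro ballI)
    fix k show "exp_jacobi x t v $ k * bracket mul x (axis k 1) $ i = 0"
      using lower[of k] bracket_strictly_lower[of i k x] by (cases "k < i") auto
  qed
  then have D: "((\<lambda>t. exp_jacobi x t v $ i) has_real_derivative v $ i) (at t)" for t
    using bounded_linear.has_vector_derivative[OF bounded_linear_vec_nth[of i]
        has_vector_derivative_exp_jacobi[of x v t]]
    by (simp add: has_real_derivative_iff_has_vector_derivative)
  have "((\<lambda>t. exp_jacobi x t v $ i - t * v $ i) has_real_derivative 0) (at t)" for t
    using D by (auto intro!: derivative_eq_intros)
  then have "exp_jacobi x t v $ i - t * v $ i = exp_jacobi x 0 v $ i - 0 * v $ i"
    using DERIV_isconst_all[of "\<lambda>t. exp_jacobi x t v $ i - t * v $ i" t 0] by blast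
  then show ?case by (simp add: exp_jacobi_def linear_0[OF linear_dL])
qed

text \<open>The case \<open>t = 1\<close> of \<open>exp_jacobi_lower\<close> is the claim for \<open>dL mul (- x) x\<close>. Its inverse is
  \<open>dL mul x 0\<close>, and by the chain rule every differential of a left translation is a product of two
  such maps.\<close>

lemma lower_unipotent_dL: "lower_unipotent (dL mul a p)"
proof -
  have B: "lower_unipotent (dL mul (- x) x)" for x
    unfolding lower_unipotent_def
  proof (intro allI impI)
    fix v :: "(real,'n) vec" and i assume "\<forall>k<i. v $ k = 0"
    from exp_jacobi_lower[OF this, of x 1] show "dL mul (- x) x v $ i = v $ i"
      by (simp add: exp_jacobi_def)
  qed
  have A: "lower_unipotent (dL mul x 0)" for x
    by (rule lower_unipotent_right_inverse[OF B[of x]]) (use dL_inverse(2)[of x 0] in simp)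
  have "dL mul a p v = dL mul (mul a p) 0 (dL mul (- p) p v)" for v
    using dL_chain[of "mul a p" "- p" p v] by (simp add: mul_assoc)
  then show ?thesis
    using lower_unipotent_compose[OF A B] by presburger
qed

end

section \<open>Left translations preserve Lebesgue measure\<close>

text \<open>A permutation with \<open>p i \<le> i\<close> for all \<open>i\<close> is the identity, so only the diagonal contributes to
  the determinant.\<close>

lemma det_lower_unitriangular:
  fixes M :: "real^'n::{finite,linorder}^'n::{finite,linorder}"
  assumes "\<And>i j. i < j \<Longrightarrow> M $ i $ j = 0" "\<And>i. M $ i $ i = 1"
  shows "det M = 1"
proof -
  have "(\<Prod>i\<in>UNIV. M $ i $ p i) = 0" if p: "p permutes (UNIV :: 'n set)" and "p \<noteq> id" for p
  proof (rule ccontr)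
    assume nz: "(\<Prod>i\<in>UNIV. M $ i $ p i) \<noteq> 0"
    have le: "p i \<le> i" for i
      using nz assms(1)[of i "p i"] by (metis UNIV_I finite leI prod_zero)
    have "p i = i" for i
    proof (induction i rule: index_less_induct)
      case (less i)
      show ?case
      proof (rule ccontr)
        assume "p i \<noteq> i"
        with le[of i] have "p i < i" by simp
        then have "p (p i) = p i" by (rule less)
        then show False using permutes_inj[OF p] \<open>p i \<noteq> i\<close> by (simp add: inj_eq)
      qed
    qed
    with \<open>p \<noteq> id\<close> show False by auto
  qed
  then have "det M = (\<Sum>p\<in>{p. p permutes (UNIV :: 'n set)}. if p = id then 1 else 0)"
    unfolding det_def by (intro sum.cong) (auto simp: assms(2) sign_id)
  then show ?thesis
    by (simp add: permutes_id)
qed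

lemma det_matrix_lower_unipotent:
  assumes "lower_unipotent f"
  shows "det (matrix f) = 1"
  using assms unfolding lower_unipotent_def
  by (intro det_lower_unitriangular) (auto simp: matrix_def axis_def)

text \<open>The change of variables formula is stated for well-ordered index types. A finite linear order is
  a well-order; this copy of the index type carries the corresponding class instance, and
  Euclidean space is transported along the obvious isometry.\<close>

typedef 'n ordered_index = "UNIV :: 'n set" by simp

instance ordered_index :: (finite) finite
proof
  have "(UNIV :: 'a ordered_index set) = range Abs_ordered_index"
    by (metis (no_types) Rep_ordered_index_inverse surjI)
  then show "finite (UNIV :: 'a ordered_index set)"
    by (metis finite finite_imageI)
qed

instantiation ordered_index :: ("{finite,linorder}") wellorder
begin

definition "i \<le> j \<longleftrightarrow> Rep_ordered_index i \<le> Rep_ordered_index j"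
definition "i < j \<longleftrightarrow> Rep_ordered_index i < Rep_ordered_index j"

instance
proof
  fix P :: "'a ordered_index \<Rightarrow> bool" and a :: "'a ordered_index"
  assume ih: "\<And>x. (\<And>y. y < x \<Longrightarrow> P y) \<Longrightarrow> P x"
  have "P (Abs_ordered_index i)" for i
  proof (induction i rule: index_less_induct)
    case (less i)
    show ?case
    proof (rule ih)
      fix y assume "y < Abs_ordered_index i"
      then have "Rep_ordered_index y < i"
        by (simp add: less_ordered_index_def Abs_ordered_index_inverse)
      from less[OF this] show "P y" by (simp add: Rep_ordered_index_inverse)
    qed
  qed
  from this[of "Rep_ordered_index a"] show "P a" by (simp add: Rep_ordered_index_inverse)
qed (auto simp: less_eq_ordered_index_def less_ordered_index_def Rep_ordered_index_inject
    antisym less_le_not_le)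

end

definition to_ordered :: "real^'n::finite \<Rightarrow> real^'n::finite ordered_index" where
  "to_ordered x = (\<chi> i. x $ Rep_ordered_index i)"

definition from_ordered :: "real^'n::finite ordered_index \<Rightarrow> real^'n::finite" where
  "from_ordered x = (\<chi> i. x $ Abs_ordered_index i)"

lemma to_from_ordered [simp]: "to_ordered (from_ordered x) = x" "from_ordered (to_ordered y) = y"
  by (simp_all add: to_ordered_def from_ordered_def vec_eq_iff Rep_ordered_index_inverse
      Abs_ordered_index_inverse)

lemma bounded_linear_to_ordered: "bounded_linear to_ordered"
  and bounded_linear_from_ordered: "bounded_linear from_ordered"
  unfolding linear_conv_bounded_linear[symmetric]
  by (auto intro!: linearI simp: to_ordered_def from_ordered_def vec_eq_iff)

lemma prod_Basis_cart:
  fixes v :: "real^'n"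
  shows "(\<Prod>b\<in>Basis. v \<bullet> b) = (\<Prod>i\<in>UNIV. v $ i)"
proof -
  have B: "(Basis :: (real^'n) set) = range (\<lambda>i. axis i 1)"
    by (auto simp: Basis_vec_def)
  have inj: "inj (\<lambda>i. axis i 1 :: real^'n)"
    by (auto simp: inj_def axis_eq_axis)
  show ?thesis
    unfolding B prod.reindex[OF inj] by (simp add: inner_axis)
qed

lemma distr_to_ordered:
  "distr lborel borel (to_ordered :: real^'n::finite \<Rightarrow> _) = lborel"
proof (rule sym, rule lborel_eqI)
  fix l u :: "real^'n ordered_index"
  assume le: "\<And>b. b \<in> Basis \<Longrightarrow> l \<bullet> b \<le> u \<bullet> b"
  have meas: "(to_ordered :: real^'n \<Rightarrow> _) \<in> borel_measurable borel"
    by (intro borel_measurable_continuous_onI linear_continuous_on bounded_linear_to_ordered)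
  have "(to_ordered :: real^'n \<Rightarrow> _) -` box l u = box (from_ordered l) (from_ordered u)"
    by (auto simp: mem_box_cart to_ordered_def from_ordered_def Rep_ordered_index_inverse)
       (metis Abs_ordered_index_inverse UNIV_I Rep_ordered_index_inverse)+
  then have *: "emeasure (distr lborel borel to_ordered) (box l u)
      = emeasure lborel (box (from_ordered l) (from_ordered u))"
    using meas by (simp add: emeasure_distr)
  have le': "l $ i \<le> u $ i" for i
    using le[of "axis i 1"] by (simp add: inner_axis axis_in_Basis_iff)
  have "emeasure lborel (box (from_ordered l) (from_ordered u))
      = ennreal (\<Prod>b\<in>Basis. (from_ordered u - from_ordered l) \<bullet> b)"
    using le' by (subst emeasure_lborel_box) (auto simp: Basis_vec_def inner_axis from_ordered_def)
  also have "(\<Prod>b\<in>Basis. (from_ordered u - from_ordered l) \<bullet> b) = (\<Prod>i\<in>UNIV. (u - l) $ Abs_ordered_index i)"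
    unfolding prod_Basis_cart by (simp add: from_ordered_def)
  also have "\<dots> = (\<Prod>i\<in>UNIV. (u - l) $ i)"
    by (rule prod.reindex_bij_witness[of _ Rep_ordered_index Abs_ordered_index])
       (simp_all add: Abs_ordered_index_inverse Rep_ordered_index_inverse)
  finally show "emeasure (distr lborel borel to_ordered) (box l u) = ennreal (\<Prod>b\<in>Basis. (u - l) \<bullet> b)"
    using * by (simp add: prod_Basis_cart)
qed simp

text \<open>The change of variables formula on boxes, with Jacobian determinant \<open>1\<close>. Boxes determine
  Lebesgue measure.\<close>

lemma measure_preserving_unipotent_wellorder:
  fixes f h :: "real^'n::{finite,wellorder} \<Rightarrow> real^'n::_"
  assumes der: "\<And>x. (h has_derivative h' x) (at x)" and unip: "\<And>x. lower_unipotent (h' x)"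
    and f: "f \<in> borel_measurable borel" and inv: "\<And>x. f (h x) = x" "\<And>x. h (f x) = x"
  shows "distr lborel borel f = lborel"
proof (rule sym, rule lborel_eqI)
  fix l u :: "(real,'n) vec"
  assume le: "\<And>b. b \<in> Basis \<Longrightarrow> l \<bullet> b \<le> u \<bullet> b"
  have vim: "f -` box l u = h ` box l u"
    using inv by (auto simp: image_iff) metis
  have inj: "inj_on h (box l u)"
    by (metis inj_onI inv(1))
  have det: "\<bar>det (matrix (h' x))\<bar> = 1" for x
    using det_matrix_lower_unipotent[OF unip] by simp
  have int: "(\<lambda>x. \<bar>det (matrix (h' x))\<bar>) integrable_on box l u"
    unfolding det by (rule integrable_on_const) simp
  have der': "(h has_derivative h' x) (at x within box l u)" for x
    using der has_derivative_at_withinI by blast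
  have "h ` box l u \<in> lmeasurable"
    using measurable_differentiable_image_eq[OF _ der' inj] int by auto
  then have "emeasure lebesgue (h ` box l u) = ennreal (measure lebesgue (h ` box l u))"
    by (rule emeasure_eq_measure2)
  moreover have "measure lebesgue (h ` box l u) = measure lebesgue (box l u)"
    using measure_differentiable_image_eq[OF _ der' inj int] lmeasure_integral[of "box l u"]
    unfolding det by simp
  moreover have "h ` box l u \<in> sets borel"
    unfolding vim[symmetric] using f by (simp add: measurable_sets_borel)
  ultimately have "emeasure lborel (h ` box l u) = ennreal (measure lborel (box l u))"
    by simp
  then show "emeasure (distr lborel borel f) (box l u) = ennreal (\<Prod>b\<in>Basis. (u - l) \<bullet> b)"
    using f le by (simp add: emeasure_distr vim measure_lborel_box_eq)
qed simp

lemma measure_preserving_unipotent: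
  fixes f h :: "real^'n::{finite,linorder} \<Rightarrow> real^'n::{finite,linorder}"
  assumes der: "\<And>x. (h has_derivative h' x) (at x)" and unip: "\<And>x. lower_unipotent (h' x)"
    and f: "f \<in> borel_measurable borel" and inv: "\<And>x. f (h x) = x" "\<And>x. h (f x) = x"
  shows "distr lborel borel f = lborel"
proof -
  have cont: "continuous_on UNIV (to_ordered :: (real,'n) vec \<Rightarrow> _)"
      "continuous_on UNIV (from_ordered :: _ \<Rightarrow> (real,'n) vec)"
    by (intro linear_continuous_on bounded_linear_to_ordered bounded_linear_from_ordered)+
  note meas [measurable] = f borel_measurable_continuous_onI[OF cont(1)]
      borel_measurable_continuous_onI[OF cont(2)]
  have *: "distr lborel borel (\<lambda>x. to_ordered (f (from_ordered x))) = lborel"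
  proof (rule measure_preserving_unipotent_wellorder)
    show "((\<lambda>x. to_ordered (h (from_ordered x))) has_derivative
       (\<lambda>v. to_ordered (h' (from_ordered x) (from_ordered v)))) (at x)" for x
      by (intro bounded_linear.has_derivative[OF bounded_linear_to_ordered]
          has_derivative_compose[OF bounded_linear.has_derivative[OF bounded_linear_from_ordered] der])
         (rule has_derivative_ident)
    show "lower_unipotent (\<lambda>v. to_ordered (h' (from_ordered x) (from_ordered v)))" for x
      unfolding lower_unipotent_def
    proof (intro allI impI)
      fix v :: "(real,'n ordered_index) vec"  and i assume "\<forall>k<i. v $ k = 0"
      then have "\<forall>k<Rep_ordered_index i. from_ordered v $ k = 0"
        by (simp add: from_ordered_def less_ordered_index_def Abs_ordered_index_inverse)
      then have "h' (from_ordered x) (from_ordered v) $ Rep_ordered_index i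
          = from_ordered v $ Rep_ordered_index i"
        using unip unfolding lower_unipotent_def by blast
      then show "to_ordered (h' (from_ordered x) (from_ordered v)) $ i = v $ i"
        by (simp add: to_ordered_def from_ordered_def Rep_ordered_index_inverse)
    qed
  qed (use inv in auto)
  have "distr lborel borel f = distr (distr lborel borel (\<lambda>x. to_ordered (f x))) borel from_ordered"
    by (simp add: distr_distr o_def)
  also have "distr lborel borel (\<lambda>x. to_ordered (f x)) = distr (distr lborel borel to_ordered) borel
      (\<lambda>x. to_ordered (f (from_ordered x)))"
    by (subst distr_distr) (simp_all add: o_def)
  also have "\<dots> = lborel"
    unfolding distr_to_ordered * ..
  also have "distr lborel borel from_ordered = (lborel :: ((real,'n) vec) measure)"
    by (subst distr_to_ordered[symmetric], subst distr_distr) (simp_all add: o_def distr_id2)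
  finally show ?thesis .
qed

lemma (in nilpotent_group) distr_left_mul: "distr lborel borel (mul a) = lborel"
proof (rule measure_preserving_unipotent)
  show "(mul (- a) has_derivative dL mul (- a) x) (at x)" for x
    by (rule has_derivative_dL)
  have "continuous_on UNIV (mul a)"
    by (meson continuous_at_imp_continuous_on has_derivative_continuous has_derivative_dL)
  then show "mul a \<in> borel_measurable borel" by (rule borel_measurable_continuous_onI)
qed (simp_all add: lower_unipotent_dL)

section \<open>Admissible fields and perimeter\<close>

context nilpotent_group begin

lemma continuous_mul:
  assumes "continuous_on S p" "continuous_on S q"
  shows "continuous_on S (\<lambda>x. mul (p x) (q x))"
proof -
  have "continuous_on UNIV (\<lambda>(x, y). mul x y)"
    by (meson continuous_at_imp_continuous_on has_derivative_continuous has_derivative_mul_pair)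
  from continuous_on_compose2[OF this continuous_on_Pair[OF assms]] show ?thesis by simp
qed

lemma borel_measurable_mul [measurable]: "mul a \<in> borel_measurable borel"
  by (intro borel_measurable_continuous_onI continuous_mul continuous_intros)

lemma continuous_dL_0:
  assumes "continuous_on S p" "continuous_on S v"
  shows "continuous_on S (\<lambda>x. dL mul (p x) 0 (v x))"
proof -
  have "continuous_on S (\<lambda>x. dmul (p x, 0) (0, b))" for b
    using continuous_on_compose2[OF C_k_1_continuous[OF dmul_C1] continuous_on_Pair[OF assms(1)
        continuous_on_const]]
    by simp
  then have "continuous_on S (\<lambda>x. \<Sum>b\<in>Basis. (v x \<bullet> b) *\<^sub>R dL mul (p x) 0 b)"
    unfolding dL_eq by (intro continuous_intros assms(2))
  then show ?thesis
    by (subst linear_Basis_expand[OF linear_dL])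
qed

end

context sub_finsler_nilpotent_group begin

lemma X_eq: "X i p = dL mul p 0 (X i 0)"
  using X_left_invariant[of i] unfolding left_invariant_def by (metis mul_0_right)

lemma hor_eq: "hor X p = dL mul p 0 ` hor X 0"
proof -
  have "range (\<lambda>i. X i p) = dL mul p 0 ` range (\<lambda>i. X i 0)"
    unfolding image_image by (rule image_cong[OF refl X_eq])
  then show ?thesis unfolding hor_def by (simp add: linear_span_image[OF linear_dL])
qed

lemma hor_0_representation:
  assumes "w \<in> hor X 0"
  obtains a where "w = (\<Sum>i\<in>UNIV. a i *\<^sub>R X i 0)"
proof -
  let ?T = "range (\<lambda>a. \<Sum>i\<in>UNIV. a i *\<^sub>R X i 0)"
  have "subspace ?T"
    unfolding subspace_def
  proof (intro conjI ballI allI)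
    show "0 \<in> ?T" by (rule image_eqI[of _ _ "\<lambda>_. 0"]) simp_all
    fix x assume "x \<in> ?T"
    then obtain a where x: "x = (\<Sum>i\<in>UNIV. a i *\<^sub>R X i 0)" by blast
    show "c *\<^sub>R x \<in> ?T" for c
      unfolding x by (rule image_eqI[of _ _ "\<lambda>i. c * a i"]) (simp_all add: scaleR_sum_right)
    fix y assume "y \<in> ?T"
    then obtain b where y: "y = (\<Sum>i\<in>UNIV. b i *\<^sub>R X i 0)" by blast
    show "x + y \<in> ?T"
      unfolding x y by (rule image_eqI[of _ _ "\<lambda>i. a i + b i"]) (simp_all add: scaleR_add_left sum.distrib)
  qed
  moreover have "range (\<lambda>i. X i 0) \<subseteq> ?T"
  proof (intro image_subsetI)
    fix j
    have "(\<Sum>i\<in>UNIV. (if i = j then 1 else 0) *\<^sub>R X i 0) = (\<Sum>i\<in>UNIV. if i = j then X i 0 else 0)"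
      by (intro sum.cong) auto
    then show "X j 0 \<in> ?T"
      by (intro image_eqI[of _ _ "\<lambda>i. if i = j then 1 else 0"]) simp_all
  qed
  ultimately have "hor X 0 \<subseteq> ?T" unfolding hor_def by (rule span_minimal[rotated])
  then show thesis using assms that by blast
qed

lemma dL_0_inj: "dL mul p 0 v = dL mul p 0 w \<Longrightarrow> v = w"
  using dL_inverse(2)[of p 0] by metis

lemma hor_coeff_eq: "hor_coeff X p (dL mul p 0 (\<Sum>i\<in>UNIV. a i *\<^sub>R X i 0)) = a"
  unfolding hor_coeff_def
proof (rule the_equality)
  have eq: "(\<Sum>i\<in>UNIV. c i *\<^sub>R X i p) = dL mul p 0 (\<Sum>i\<in>UNIV. c i *\<^sub>R X i 0)" for c p
    using X_eq[of _ p] by (simp add: linear_sum[OF linear_dL] linear_cmul[OF linear_dL])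
  show "dL mul p 0 (\<Sum>i\<in>UNIV. a i *\<^sub>R X i 0) = (\<Sum>i\<in>UNIV. a i *\<^sub>R X i p)"
    by (rule eq[symmetric])
  fix c assume "dL mul p 0 (\<Sum>i\<in>UNIV. a i *\<^sub>R X i 0) = (\<Sum>i\<in>UNIV. c i *\<^sub>R X i p)"
  then have "(\<Sum>i\<in>UNIV. a i *\<^sub>R X i 0) = (\<Sum>i\<in>UNIV. c i *\<^sub>R X i 0)"
    unfolding eq[of c p] by (rule dL_0_inj)
  then have z: "(\<Sum>i\<in>UNIV. (c i - a i) *\<^sub>R X i 0) = 0"
    by (simp add: scaleR_left_diff_distrib sum_subtractf)
  have "(\<Sum>i\<in>UNIV. (c i - a i) *\<^sub>R X i q) = 0" for q
    unfolding eq[of "\<lambda>i. c i - a i" q] z by (rule linear_0[OF linear_dL])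
  from X_independent[OF this] have "c i - a i = 0" for i .
  then show "c = a" by (simp add: fun_eq_iff)
qed

lemma norm_K_eq:
  assumes "w \<in> hor X 0"
  shows "norm_K X K p (dL mul p 0 w) = gauge K w"
proof -
  obtain a where "w = (\<Sum>i\<in>UNIV. a i *\<^sub>R X i 0)" using hor_0_representation[OF assms] .
  then show ?thesis unfolding norm_K_def using hor_coeff_eq by simp
qed

lemma zero_in_K: "0 \<in> K"
  by (rule subsetD[OF interior_of_subset K_zero_interior])

lemma scale_in_K: "k \<in> K \<Longrightarrow> 0 \<le> t \<Longrightarrow> t \<le> 1 \<Longrightarrow> t *\<^sub>R k \<in> K"
  using convexD_alt[OF K_convex zero_in_K, of k t] by simp

text \<open>Since \<open>0\<close> is interior to \<open>K\<close> within \<open>hor X 0\<close>, some multiple of \<open>K\<close> contains \<open>w\<close> and the gauge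
  is an infimum over a nonempty set. If it is at most \<open>1\<close>, slightly shrunk copies of \<open>w\<close> lie in
  \<open>K\<close>, which is closed.\<close>

lemma gauge_le_1_iff:
  assumes w: "w \<in> hor X 0"
  shows "gauge K w \<le> 1 \<longleftrightarrow> w \<in> K"
proof
  let ?S = "{l. l \<ge> 0 \<and> w \<in> (\<lambda>x. l *\<^sub>R x) ` K}"
  have bdd: "bdd_below ?S" by (intro bdd_belowI[of _ 0]) auto
  show "gauge K w \<le> 1" if "w \<in> K"
    unfolding gauge_def by (rule cInf_lower[OF _ bdd]) (use that in auto)
  assume le: "gauge K w \<le> 1"
  obtain T where T: "open T" "0 \<in> T" "T \<inter> hor X 0 \<subseteq> K"
    using K_zero_interior unfolding interior_of_def openin_open by blast
  have "?S \<noteq> {}"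
  proof -
    have "((\<lambda>t. t *\<^sub>R w) \<longlongrightarrow> 0 *\<^sub>R w) (at_right 0)" by (intro tendsto_intros)
    then have "\<forall>\<^sub>F t in at_right 0. t *\<^sub>R w \<in> T" using T topological_tendstoD by fastforce
    moreover have "\<forall>\<^sub>F t in at_right (0::real). 0 < t" by (simp add: eventually_at_right_less)
    ultimately have "\<forall>\<^sub>F t in at_right (0::real). 0 < t \<and> t *\<^sub>R w \<in> T" by eventually_elim auto
    then obtain t :: real where t: "t > 0" "t *\<^sub>R w \<in> T"
      using eventually_happens trivial_limit_at_right_real by blast
    have "t *\<^sub>R w \<in> K" using T(3) t w by (auto simp: hor_def span_scale)
    then have "w \<in> (\<lambda>x. (1/t) *\<^sub>R x) ` K" using t by (intro image_eqI[of _ _ "t *\<^sub>R w"]) auto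
    then have "1 / t \<in> ?S" using t by simp
    then show ?thesis by blast
  qed
  \<comment> \<open>The infimum lies below \<open>1 + scale_seq n\<close>, so some admissible scaling factor does too.\<close>
  have near: "(1 / (1 + scale_seq n)) *\<^sub>R w \<in> K" for n
  proof -
    have "Inf ?S < 1 + scale_seq n" using le scale_seq_pos[of n] unfolding gauge_def by simp
    then obtain l where "l \<in> ?S" "l < 1 + scale_seq n"
      using cInf_lessD[OF \<open>?S \<noteq> {}\<close>] by blast
    then obtain k where k: "k \<in> K" "w = l *\<^sub>R k" "0 \<le> l" "l < 1 + scale_seq n" by auto
    have "(1 / (1 + scale_seq n)) *\<^sub>R w = (l / (1 + scale_seq n)) *\<^sub>R k" using k by simp
    also have "\<dots> \<in> K" using k scale_seq_pos[of n] by (intro scale_in_K) auto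
    finally show ?thesis .
  qed
  have "(\<lambda>n. (1 / (1 + scale_seq n)) *\<^sub>R w) \<longlonglongrightarrow> (1 / (1 + 0)) *\<^sub>R w"
    by (intro tendsto_intros scale_seq_tendsto) auto
  then show "w \<in> K"
    using closed_sequentially[OF compact_imp_closed[OF K_compact], of "\<lambda>n. (1 / (1
        + scale_seq n)) *\<^sub>R w"] near
    by simp
qed

text \<open>The unit ball of the asymmetric norm at \<open>p\<close>.\<close>

definition K_at :: "(real,'n) vec \<Rightarrow> (real,'n) vec set" where
  "K_at p = dL mul p 0 ` K"

lemma admissible_fields_eq: "admissible_fields X K = fields_in K_at"
proof -
  have "(u \<in> hor X p \<and> norm_K X K p u \<le> 1) \<longleftrightarrow> u \<in> K_at p" for u p
    unfolding K_at_def hor_eq[of p] using norm_K_eq gauge_le_1_iff K_horizontal by auto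
  then show ?thesis unfolding admissible_fields_def fields_in_def by blast
qed

lemma convex_K_at: "convex (K_at p)"
  unfolding K_at_def by (rule convex_linear_image[OF linear_dL K_convex])

lemma zero_field_in: "(\<lambda>_. 0) \<in> fields_in K_at"
proof -
  have "0 \<in> K_at p" for p
    unfolding K_at_def using zero_in_K linear_0[OF linear_dL] by (metis image_eqI)
  moreover have "compactly_supported (\<lambda>_::(real,'n) vec. 0 :: (real,'n) vec)"
    by (simp add: compactly_supported_def)
  ultimately show ?thesis unfolding fields_in_def using C_k_1_const by blast
qed

lemma gram_expand: "g p u w = (\<Sum>k\<in>UNIV. \<Sum>l\<in>UNIV. u $ k * gram g p $ k $ l * w $ l)"
proof -
  have b: "v = (\<Sum>k\<in>UNIV. v $ k *\<^sub>R axis k 1)" for v :: "(real,'n) vec"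
    using basis_expansion[of v] by (simp add: scalar_mult_eq_scaleR)
  have "g p u w = g p (\<Sum>k\<in>UNIV. u $ k *\<^sub>R axis k 1) (\<Sum>l\<in>UNIV. w $ l *\<^sub>R axis l 1)"
    using b by metis
  also have "\<dots> = (\<Sum>k\<in>UNIV. \<Sum>l\<in>UNIV. g p (u $ k *\<^sub>R axis k 1) (w $ l *\<^sub>R axis l 1))"
    by (simp only: bilinear_sum[OF g_bilinear] sum.cartesian_product)
  also have "\<dots> = (\<Sum>k\<in>UNIV. \<Sum>l\<in>UNIV. u $ k * gram g p $ k $ l * w $ l)"
    using bilinear_lmul[OF g_bilinear] bilinear_rmul[OF g_bilinear] by (simp add: gram_def mult_ac)
  finally show ?thesis .
qed

text \<open>By left invariance the Gram matrices at \<open>0\<close> and at \<open>p\<close> are congruent through the unipotent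
  differential of the translation by \<open>p\<close>.\<close>

lemma det_gram_constant: "det (gram g p) = det (gram g 0)"
proof -
  let ?M = "matrix (dL mul p 0)"
  have M: "dL mul p 0 (axis i 1) $ k = ?M $ k $ i" for i k by (simp add: matrix_def)
  have "gram g 0 $ i $ j = (transpose ?M ** gram g p ** ?M) $ i $ j" for i j
  proof -
    have "gram g 0 $ i $ j = g p (dL mul p 0 (axis i 1)) (dL mul p 0 (axis j 1))"
      using g_left_invariant[of p 0] by (simp add: gram_def)
    also have "\<dots> = (\<Sum>k\<in>UNIV. \<Sum>l\<in>UNIV. ?M $ k $ i * gram g p $ k $ l * ?M $ l $ j)"
      unfolding gram_expand[of p "dL mul p 0 (axis i 1)"] M ..
    also have "\<dots> = (\<Sum>l\<in>UNIV. (\<Sum>k\<in>UNIV. ?M $ k $ i * gram g p $ k $ l) * ?M $ l $ j)"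
      by (subst sum.swap) (simp add: sum_distrib_right)
    also have "\<dots> = (transpose ?M ** gram g p ** ?M) $ i $ j"
      by (simp add: matrix_matrix_mult_def transpose_def)
    finally show ?thesis .
  qed
  then have "gram g 0 = transpose ?M ** gram g p ** ?M" by (simp add: vec_eq_iff)
  then show ?thesis
    by (simp add: det_mul det_matrix_lower_unipotent[OF lower_unipotent_dL])
qed

lemma det_gram_nonzero: "det (gram g 0) \<noteq> 0"
proof -
  have "z = 0" if "gram g 0 *v z = 0" for z
  proof (rule ccontr)
    assume "z \<noteq> 0"
    have "g 0 z z = (\<Sum>k\<in>UNIV. z $ k * (gram g 0 *v z) $ k)"
      unfolding gram_expand[of 0 z z] by (simp add: matrix_vector_mult_def sum_distrib_left mult_ac)
    then show False using g_pos[OF \<open>z \<noteq> 0\<close>, of 0] that by simp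
  qed
  then have "\<exists>B. B ** gram g 0 = mat 1"
    using matrix_left_invertible_ker by blast
  then show ?thesis
    using invertible_det_nz invertible_left_inverse by blast
qed

lemma divergence_eq: "C_k 1 U \<Longrightarrow> divergence g U = trace_div U"
proof
  fix p assume U: "C_k 1 U"
  define c where "c = sqrt (det (gram g 0))"
  have c: "c \<noteq> 0" using det_gram_nonzero by (simp add: c_def)
  have const: "sqrt (det (gram g q)) = c" for q
    unfolding c_def by (subst det_gram_constant) (rule refl)
  have Bas: "(\<Sum>b\<in>Basis. h b) = (\<Sum>i\<in>UNIV. h (axis i 1))" for h :: "(real,'n) vec \<Rightarrow> real"
  proof -
    have B: "(Basis :: (real,'n) vec set) = range (\<lambda>i. axis i 1)" by (auto simp: Basis_vec_def)
    have inj: "inj (\<lambda>i. axis i 1 :: (real,'n) vec)" by (auto simp: inj_def axis_eq_axis)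
    show ?thesis unfolding B sum.reindex[OF inj] by simp
  qed
  have "fderiv (\<lambda>q. c * U q $ i) p v = c * fderiv U p v $ i" for i v
    by (rule fderiv_eqI)
       (intro has_derivative_mult_right bounded_linear.has_derivative[OF bounded_linear_vec_nth]
           C_k_1_has_derivative U)
  then have "divergence g U p = (\<Sum>i\<in>UNIV. c * fderiv U p (axis i 1) $ i) / c"
    unfolding divergence_def const by simp
  also have "\<dots> = (\<Sum>i\<in>UNIV. fderiv U p (axis i 1) $ i)"
    using c by (simp flip: sum_distrib_left)
  finally show "divergence g U p = trace_div U p"
    by (simp add: trace_div_def Bas inner_axis)
qed

lemma perimeter_borel:
  assumes E [measurable]: "E \<in> sets borel"
  shows "perimeter X g K E = variation K_at E"
  unfolding perimeter_def variation_def admissible_fields_eq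
proof (rule SUP_cong[OF refl])
  fix U assume "U \<in> fields_in K_at"
  then have U: "C_k 1 U" by (simp add: fields_in_def)
  note [measurable] = borel_measurable_trace_div[OF U]
  have "set_lebesgue_integral lebesgue E (divergence g U) = (\<integral>x. indicator E x * trace_div U x \<partial>lebesgue)"
    unfolding set_lebesgue_integral_def divergence_eq[OF U] by simp
  also have "\<dots> = flux E U"
    unfolding flux_def by (rule integral_completion) measurable
  finally show "ereal (set_lebesgue_integral lebesgue E (divergence g U)) = ereal (flux E U)" by simp
qed

text \<open>Passing to a Borel set that differs by a null set makes the measure-theoretic lemmas on \<open>lborel\<close>
  applicable.\<close>

lemma borel_representative:
  assumes E: "E \<in> sets lebesgue"
  obtains E' where "E' \<in> sets borel" "emeasure lborel E' = emeasure lebesgue E"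
    "perimeter X g K E = perimeter X g K E'"
proof -
  obtain S N N' where S: "E = S \<union> N" "N \<subseteq> N'" "N' \<in> null_sets lborel" "S \<in> sets lborel"
    using E by (rule sets_completionE)
  have ae: "AE x in lebesgue. x \<in> E \<longleftrightarrow> x \<in> S"
    by (rule AE_I'[of N']) (use S in \<open>auto intro: null_sets_completionI\<close>)
  have S': "S \<in> sets lebesgue" using S(4) by auto
  have "emeasure lebesgue E = emeasure lebesgue S"
    by (rule emeasure_eq_AE[OF ae E S'])
  moreover have "perimeter X g K E = perimeter X g K S"
    unfolding perimeter_def admissible_fields_eq
  proof (rule SUP_cong[OF refl])
    fix U assume "U \<in> fields_in K_at"
    then have U: "C_k 1 U" by (simp add: fields_in_def)
    have m: "trace_div U \<in> borel_measurable lebesgue"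
      using borel_measurable_trace_div[OF U] by (simp add: measurable_completion)
    have "set_lebesgue_integral lebesgue E (divergence g U)
        = set_lebesgue_integral lebesgue S (divergence g U)"
      unfolding set_lebesgue_integral_def divergence_eq[OF U]
      by (rule integral_cong_AE) (use m E S' ae in \<open>auto elim!: eventually_mono simp: indicator_def\<close>)
    then show "ereal (set_lebesgue_integral lebesgue E (divergence g U))
        = ereal (set_lebesgue_integral lebesgue S (divergence g U))"
      by simp
  qed
  ultimately show thesis using that[of S] S(4) by simp
qed

end

section \<open>Left invariance of the variation\<close>

context nilpotent_group begin

lemma C_k_1_mul: "C_k 1 (mul a)"
proof (rule C_k_1I[OF has_derivative_dL])
  show "continuous_on UNIV (\<lambda>p. dL mul a p v)" for v
    unfolding dL_eq
    by (intro continuous_on_compose2[OF C_k_1_continuous[OF dmul_C1]] continuous_intros) auto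
qed

lemma C_k_1_dL_comp:
  assumes p: "C_k 1 p" and v: "C_k 1 v"
  shows "C_k 1 (\<lambda>x. dL mul a (p x) (v x))"
proof -
  have bl: "bounded_linear (\<lambda>y. (0, y) :: (real,'n) vec \<times> (real,'n) vec)"
    by (intro bounded_linear_Pair bounded_linear_zero bounded_linear_ident)
  have "C_k 1 (\<lambda>x. (a, 0) + (0, p x))"
    by (intro C_k_1_add C_k_1_const C_k_1_compose[OF p C_k_1_bounded_linear[OF bl]])
  then have pair: "C_k 1 (\<lambda>x. (a, p x))" by simp
  have "C_k 1 (\<lambda>x. dL mul a (p x) b)" for b
    unfolding dL_eq by (rule C_k_1_compose[OF pair dmul_C1])
  then have "C_k 1 (\<lambda>x. \<Sum>b\<in>Basis. (v x \<bullet> b) *\<^sub>R dL mul a (p x) b)"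
    by (intro C_k_1_sum C_k_1_scaleR C_k_1_inner_left v)
  then show ?thesis
    by (subst linear_Basis_expand[OF linear_dL])
qed

lemma bounded_preimage_mul:
  obtains R' where "\<And>p. norm (mul a p) \<le> R \<Longrightarrow> norm p \<le> R'"
proof -
  have "compact (mul (- a) ` cball 0 R)"
    by (intro compact_continuous_image continuous_mul continuous_intros compact_cball)
  then have "bounded (mul (- a) ` cball 0 R)" by (rule compact_imp_bounded)
  then obtain R' where R': "\<And>q. q \<in> mul (- a) ` cball 0 R \<Longrightarrow> norm q \<le> R'"
    unfolding bounded_iff by blast
  have "norm p \<le> R'" if "norm (mul a p) \<le> R" for p
    by (rule R', rule image_eqI[of _ _ "mul a p"]) (use that in auto)
  then show thesis using that by blast
qed

definition pullback_field :: "(real,'n) vec \<Rightarrow> ((real,'n) vec \<Rightarrow> (real,'n) vec) \<Rightarrow> (real,'n) vec \<Rightarrow>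
    (real,'n) vec" where
  "pullback_field a U p = dL mul (- a) (mul a p) (U (mul a p))"

lemma C_k_1_pullback: "C_k 1 U \<Longrightarrow> C_k 1 (pullback_field a U)"
  unfolding pullback_field_def[abs_def]
  by (intro C_k_1_dL_comp C_k_1_mul C_k_1_compose[OF C_k_1_mul])

lemma compactly_supported_pullback:
  assumes "compactly_supported U"
  shows "compactly_supported (pullback_field a U)"
proof -
  obtain R where R: "\<And>x. norm x \<ge> R \<Longrightarrow> U x = 0" using compactly_supported_ball[OF assms] by metis
  obtain R' where R': "\<And>p. norm (mul a p) \<le> R \<Longrightarrow> norm p \<le> R'" using bounded_preimage_mul by blast
  show ?thesis
  proof (rule compactly_supported_if_ball[of "R' + 1"])
    fix p :: "(real,'n) vec" assume "norm p \<ge> R' + 1"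
    then have "\<not> norm (mul a p) \<le> R" using R'[of p] by linarith
    then have "U (mul a p) = 0" by (intro R) simp
    then show "pullback_field a U p = 0" by (simp add: pullback_field_def linear_0[OF linear_dL])
  qed
qed

text \<open>The divergence is tested against the mollified indicators \<open>f\<close> of \<open>E\<close>. Integrating by parts
  twice, \<open>\<integral> f div U\<close> equals \<open>\<integral> (f \<circ> mul a) div V\<close> for the pulled back field \<open>V\<close>: the first-order
  terms agree pointwise by the chain rule, and \<open>mul a\<close> preserves measure. In the limit \<open>f\<close> becomes
  the indicator of \<open>E\<close>. The argument involves only first derivatives of \<open>mul a\<close>, although the
  divergence of \<open>V\<close> contains second ones.\<close>

lemma flux_pullback:
  assumes U: "C_k 1 U" "compactly_supported U"
    and E [measurable]: "E \<in> sets borel" and fin: "emeasure lborel E < \<infinity>"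
  shows "flux (mul a -` E) (pullback_field a U) = flux E U"
proof -
  let ?V = "pullback_field a U"
  have V: "C_k 1 ?V" "compactly_supported ?V"
    by (rule C_k_1_pullback[OF U(1)], rule compactly_supported_pullback[OF U(2)])
  note [measurable] = borel_measurable_trace_div[OF U(1)] borel_measurable_trace_div[OF V(1)]
  note pres = integral_measure_preserving[OF distr_left_mul borel_measurable_mul]
  let ?\<phi> = "\<lambda>n. smooth_indicator (scale_seq n) E"
  have \<phi>: "C_k 1 (?\<phi> n)" for n by (rule smooth_indicator_has_derivative(2)[OF scale_seq_pos E fin])
  let ?W = "\<lambda>q. trace_div ?V (mul (- a) q)"
  have swap: "(LBINT q. ?\<phi> n q * trace_div U q) = (LBINT q. ?\<phi> n q * ?W q)" for n
  proof -
    have comp: "C_k 1 (\<lambda>p. ?\<phi> n (mul a p))" by (rule C_k_1_compose[OF C_k_1_mul \<phi>])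
    have d: "fderiv (\<lambda>p. ?\<phi> n (mul a p)) p (?V p) = fderiv (?\<phi> n) (mul a p) (U (mul a p))" for p
    proof -
      have "((\<lambda>p. ?\<phi> n (mul a p)) has_derivative (\<lambda>v. fderiv (?\<phi> n) (mul a p) (dL mul a p v))) (at p)"
        by (rule has_derivative_compose[OF has_derivative_dL C_k_1_has_derivative[OF \<phi>]])
      from fderiv_eqI[OF this] show ?thesis
        by (simp add: pullback_field_def dL_inverse)
    qed
    have [measurable]: "(\<lambda>q. fderiv (?\<phi> n) q (U q)) \<in> borel_measurable borel"
      by (intro borel_measurable_continuous_onI C_k_1_continuous_fderiv_comp \<phi> continuous_on_id
          C_k_1_continuous[OF U(1)])
    have [measurable]: "?\<phi> n \<in> borel_measurable borel"
      by (intro borel_measurable_continuous_onI C_k_1_continuous \<phi>)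
    have "(LBINT q. ?\<phi> n q * trace_div U q) = - (LBINT q. fderiv (?\<phi> n) q (U q))"
      by (rule integral_scaleR_trace_div[OF \<phi> U])
    also have "(LBINT q. fderiv (?\<phi> n) q (U q)) = (LBINT p. fderiv (?\<phi> n) (mul a p) (U (mul a p)))"
      by (rule pres[symmetric]) measurable
    also have "- \<dots> = (LBINT p. ?\<phi> n (mul a p) * trace_div ?V p)"
      using integral_scaleR_trace_div[OF comp V] by (simp add: d)
    also have "\<dots> = (LBINT p. ?\<phi> n (mul a p) * ?W (mul a p))" by simp
    also have "\<dots> = (LBINT q. ?\<phi> n q * ?W q)"
      by (rule pres) measurable
    finally show ?thesis .
  qed
  obtain R where R: "\<And>x. norm x \<ge> R \<Longrightarrow> U x = 0" using compactly_supported_ball[OF U(2)] by metis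
  obtain R1 where R1: "\<And>x. norm x \<ge> R1 \<Longrightarrow> ?V x = 0" using compactly_supported_ball[OF V(2)] by metis
  obtain R2 where R2: "\<And>q. norm (mul (- a) q) \<le> R1 \<Longrightarrow> norm q \<le> R2" using bounded_preimage_mul by blast
  \<comment> \<open>A ball containing the supports of both divergences, so that \<open>smooth_indicator_tendsto\<close> applies.\<close>
  define B where "B = cball (0::(real,'n) vec) (max R R2)"
  have B [measurable]: "B \<in> sets borel" "emeasure lborel B < \<infinity>"
    unfolding B_def using emeasure_lborel_cball_finite[of "0::(real,'n) vec" "max R R2"] by simp_all
  have zU: "trace_div U q = 0" if "q \<notin> B" for q
    using trace_div_zero_outside[of R U q, OF R] that by (simp add: B_def)
  have zW: "?W q = 0" if "q \<notin> B" for q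
  proof -
    have "\<not> norm (mul (- a) q) \<le> R1" using R2[of q] that by (auto simp: B_def)
    then show ?thesis using trace_div_zero_outside[of R1 ?V "mul (- a) q", OF R1] by simp
  qed
  obtain C where C: "\<And>x. \<bar>trace_div U x\<bar> \<le> C" using trace_div_bounded[OF U] by metis
  obtain C' where C': "\<And>x. \<bar>trace_div ?V x\<bar> \<le> C'" using trace_div_bounded[OF V] by metis
  have limit: "(\<lambda>n. LBINT q. ?\<phi> n q * w q) \<longlonglongrightarrow> (LBINT q. indicator E q * w q)"
    if "w \<in> borel_measurable borel" "\<And>x. \<bar>w x\<bar> \<le> c" "\<And>q. q \<notin> B \<Longrightarrow> w q = 0" for w c
  proof -
    have eq: "indicator B q * h * w q = h * w q" for q h
      using that(3)[of q] by (cases "q \<in> B") auto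
    show ?thesis
      using smooth_indicator_tendsto[OF B E fin that(1,2)] unfolding eq .
  qed
  have "(\<lambda>n. LBINT q. ?\<phi> n q * trace_div U q) \<longlonglongrightarrow> (LBINT q. indicator E q * trace_div U q)"
    by (rule limit[OF _ C zU]) simp
  moreover have "(\<lambda>n. LBINT q. ?\<phi> n q * trace_div U q) \<longlonglongrightarrow> (LBINT q. indicator E q * ?W q)"
    unfolding swap by (rule limit[OF _ C' zW]) simp
  ultimately have "flux E U = (LBINT q. indicator E q * ?W q)"
    unfolding flux_def by (rule LIMSEQ_unique)
  also have "\<dots> = (LBINT p. indicator E (mul a p) * ?W (mul a p))"
    by (rule pres[symmetric]) measurable
  also have "\<dots> = flux (mul a -` E) ?V"
    unfolding flux_def by (intro Bochner_Integration.integral_cong refl) (simp add: indicator_def)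
  finally show ?thesis by simp
qed

end

context sub_finsler_nilpotent_group begin

text \<open>The sets \<open>K_at p\<close> are translates of one another, by the chain rule \<open>dL_chain\<close>.\<close>

lemma pullback_field_in:
  assumes "U \<in> fields_in K_at"
  shows "pullback_field a U \<in> fields_in K_at"
proof -
  have "pullback_field a U p \<in> K_at p" for p
  proof -
    have "U (mul a p) \<in> K_at (mul a p)" using assms by (simp add: fields_in_def)
    then obtain k where k: "k \<in> K" "U (mul a p) = dL mul (mul a p) 0 k" unfolding K_at_def by blast
    have "pullback_field a U p = dL mul p 0 k"
      using dL_chain[of "- a" "mul a p" 0 k] by (simp add: pullback_field_def k(2))
    then show ?thesis unfolding K_at_def using k(1) by blast
  qed
  then show ?thesis
    using assms unfolding fields_in_def by (auto intro: C_k_1_pullback compactly_supported_pullback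
        simp del: One_nat_def)
qed

lemma variation_left_invariant:
  assumes E [measurable]: "E \<in> sets borel" and fin: "emeasure lborel E < \<infinity>"
  shows "variation K_at (mul a -` E) = variation K_at E"
proof -
  have le: "variation K_at E \<le> variation K_at (mul a -` E)"
    if E: "E \<in> sets borel" "emeasure lborel E < \<infinity>" for a E
    unfolding variation_def[of K_at E]
  proof (rule SUP_least)
    fix U assume U: "U \<in> fields_in K_at"
    then have "flux E U = flux (mul a -` E) (pullback_field a U)"
      using flux_pullback[OF _ _ E] by (simp add: fields_in_def)
    then show "ereal (flux E U) \<le> variation K_at (mul a -` E)"
      unfolding variation_def using SUP_upper[OF pullback_field_in[OF U, of a], of
          "\<lambda>U. ereal (flux (mul a -` E) U)"]
      by simp
  qed
  have "mul a -` E \<in> sets borel" by (rule measurable_sets_borel[OF borel_measurable_mul E])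
  moreover have "emeasure lborel (mul a -` E) < \<infinity>"
    using emeasure_measure_preserving[OF distr_left_mul borel_measurable_mul E] fin by simp
  ultimately have "variation K_at (mul a -` E) \<le> variation K_at (mul (- a) -` mul a -` E)"
    by (rule le)
  also have "mul (- a) -` mul a -` E = E" by (auto simp: vimage_def)
  finally show ?thesis using le[OF E fin, of a] by simp
qed

end

section \<open>Competitors of prescribed volume\<close>

text \<open>Translate along a one-parameter subgroup. The overlap depends continuously on the parameter by
  \<open>L\<^sup>1\<close>-continuity of translations. Up to a small part \<open>E\<close> lies in a ball, and a ball is disjoint
  from its translates by far elements, since the products \<open>mul q (- p)\<close> of its points form a
  bounded set. The intermediate value theorem concludes.\<close>

lemma (in nilpotent_group) exists_translate_overlap:
  assumes E [measurable]: "E \<in> sets borel" and fin: "emeasure lborel E < \<infinity>"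
    and t: "0 < t" "t < measure lborel E"
  shows "\<exists>a. measure lborel (E \<inter> mul a -` E) = t"
proof -
  define x :: "(real,'n) vec" where "x = axis undefined 1"
  have nx: "norm x = 1" by (simp add: x_def norm_axis_1)
  define h where "h s = measure lborel (E \<inter> mul (s *\<^sub>R x) -` E)" for s
  have pre: "mul a -` A \<in> sets borel" if "A \<in> sets borel" for a A
    by (rule measurable_sets_borel[OF borel_measurable_mul that])
  have h_int: "h s = (LBINT p. indicator E p * indicator E (mul (s *\<^sub>R x) p))" for s
  proof -
    have "(\<lambda>p. indicat_real E p * indicator E (mul (s *\<^sub>R x) p)) = indicator (E \<inter> mul (s *\<^sub>R x) -` E)"
      by (auto simp: indicator_def)
    then show ?thesis by (simp add: h_def)
  qed
  have cont: "continuous_on UNIV h"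
  proof (rule continuous_on_sequentiallyI)
    fix u :: "nat \<Rightarrow> real" and s assume u: "u \<longlonglongrightarrow> s"
    let ?b = "- (s *\<^sub>R x)"
    have shift: "h w = (LBINT q. indicator (mul ?b -` E) q * indicator E (mul ((w - s) *\<^sub>R x) q) * 1)" for w
    proof -
      have "mul (w *\<^sub>R x) (mul ?b q) = mul ((w - s) *\<^sub>R x) q" for q
        using exp_coord[of w x "- s"] by (simp flip: mul_assoc)
      then have "(LBINT q. indicator E (mul ?b q) * indicat_real E (mul ((w - s) *\<^sub>R x) q)) = h w"
        unfolding h_int
        using integral_measure_preserving[OF distr_left_mul[of ?b] borel_measurable_mul, of
            "\<lambda>p. indicat_real E p * indicator E (mul (w *\<^sub>R x) p)"]
        by simp
      then show ?thesis by (simp add: indicator_def vimage_def)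
    qed
    have "(\<lambda>n. mul ((u n - s) *\<^sub>R x) q) \<longlonglongrightarrow> q" for q
    proof -
      have "continuous_on UNIV (\<lambda>w. mul ((w - s) *\<^sub>R x) q)"
        by (intro continuous_mul continuous_intros)
      from continuous_on_tendsto_compose[OF this u] show ?thesis by simp
    qed
    from integral_shifted_indicator_tendsto[OF distr_left_mul borel_measurable_mul this E fin pre[OF
        E], of "\<lambda>_ _. 1" 1 "\<lambda>_. 1" ?b]
    show "(\<lambda>n. h (u n)) \<longlonglongrightarrow> h s"
      unfolding shift by simp
  qed
  have "(\<lambda>n. LBINT p. indicat_real (E - cball 0 (real n)) p) \<longlonglongrightarrow> (\<integral>p. 0 \<partial>(lborel :: (real,'n) vec measure))"
  proof (rule integral_dominated_convergence[where w="indicator E"])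
    show "integrable lborel (indicat_real E)" using fin by (simp add: integrable_indicator_iff)
    show "AE p in lborel. (\<lambda>n. indicat_real (E - cball 0 (real n)) p) \<longlonglongrightarrow> 0"
    proof (intro always_eventually allI)
      fix p :: "(real,'n) vec"
      obtain N :: nat where "norm p \<le> real N" using real_arch_simple by blast
      then have "\<forall>\<^sub>F n in sequentially. indicat_real (E - cball 0 (real n)) p = 0"
        by (intro eventually_sequentiallyI[of N]) auto
      then show "(\<lambda>n. indicat_real (E - cball 0 (real n)) p) \<longlonglongrightarrow> 0"
        by (rule tendsto_eventually)
    qed
  qed (auto simp: indicator_def)
  then have "(\<lambda>n. measure lborel (E - cball 0 (real n))) \<longlonglongrightarrow> 0" by simp
  then have "\<forall>\<^sub>F n in sequentially. measure lborel (E - cball 0 (real n)) < t / 2"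
    using t by (intro order_tendstoD) auto
  then obtain N where N: "measure lborel (E - cball 0 (real N)) < t / 2"
    using eventually_happens'[OF sequentially_bot] by blast
  let ?B = "cball (0::(real,'n) vec) (real N)"
  have "compact ((\<lambda>(q, p). mul q (- p)) ` (?B \<times> ?B))"
    unfolding case_prod_beta by (intro compact_continuous_image continuous_mul continuous_intros
        compact_Times compact_cball)
  then have "bounded ((\<lambda>(q, p). mul q (- p)) ` (?B \<times> ?B))" by (rule compact_imp_bounded)
  then obtain L where L: "\<And>y. y \<in> (\<lambda>(q, p). mul q (- p)) ` (?B \<times> ?B) \<Longrightarrow> norm y \<le> L"
    unfolding bounded_iff by blast
  \<comment> \<open>Beyond this parameter the ball and its translate are disjoint.\<close>
  define s where "s = max L 0 + 1"
  let ?T = "mul (s *\<^sub>R x)"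
  have far: "?T p \<notin> ?B" if "p \<in> ?B" for p
  proof
    assume "?T p \<in> ?B"
    with that have "norm (mul (?T p) (- p)) \<le> L" by (intro L) force
    moreover have "mul (?T p) (- p) = s *\<^sub>R x" by (simp add: mul_assoc)
    ultimately show False using nx by (simp add: s_def)
  qed
  have fE: "A \<in> fmeasurable lborel" if "A \<in> sets borel" "A \<subseteq> E" for A
    using that fin by (auto simp: fmeasurable_def intro: le_less_trans[OF emeasure_mono, of _ E])
  have preE: "?T -` A \<in> fmeasurable lborel" "measure lborel (?T -` A) = measure lborel A"
    if "A \<in> sets borel" "A \<subseteq> E" for A
    using fE[OF that] emeasure_measure_preserving[OF distr_left_mul borel_measurable_mul that(1)]
        pre[OF that(1)]
    by (auto simp: fmeasurable_def measure_def)
  have "h s \<le> measure lborel ((E - ?B) \<union> ?T -` (E - ?B))"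
    unfolding h_def
  proof (rule measure_mono_fmeasurable)
    show "E \<inter> ?T -` E \<subseteq> (E - ?B) \<union> ?T -` (E - ?B)" using far by blast
    show "(E - ?B) \<union> ?T -` (E - ?B) \<in> fmeasurable lborel"
      by (rule fmeasurable.Un[OF fE preE(1)]) auto
  qed (use pre[OF E] in auto)
  also have "\<dots> \<le> measure lborel (E - ?B) + measure lborel (?T -` (E - ?B))"
    by (rule measure_Un_le) (auto intro: pre)
  also have "\<dots> < t" using N preE(2)[of "E - ?B"] by simp
  finally have "h s \<le> t" by simp
  moreover have "t \<le> h 0" using t by (simp add: h_def vimage_def)
  ultimately obtain w where "h w = t"
    using IVT2'[of h s t 0] continuous_on_subset[OF cont subset_UNIV] by (auto simp: s_def)
  then show ?thesis unfolding h_def by blast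
qed

context sub_finsler_nilpotent_group begin

text \<open>The map \<open>(x, k) \<mapsto> dL mul x 0 k\<close> is continuous and \<open>K\<close> is compact, so all admissible fields
  satisfy a common bound near the cube.\<close>

lemma exists_finite_perimeter_cube:
  assumes v: "v > 0"
  obtains Q where "Q \<in> sets borel" "emeasure lborel Q = ennreal v" "variation K_at Q < \<infinity>"
proof -
  let ?d = "DIM((real,'n) vec)"
  define c where "c = root ?d v"
  have c: "c > 0" "c ^ ?d = v" using v by (auto simp: c_def real_root_pow_pos2)
  let ?Q = "cbox 0 (c *\<^sub>R One) :: (real,'n) vec set"
  obtain b :: "(real,'n) vec" where b: "b \<in> Basis" using nonempty_Basis by blast
  have "measure lborel ?Q = c ^ (?d - 1) * c"
    using measure_cbox_cube_side[OF b, of 0 c] c by simp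
  also have "\<dots> = v" using c(2) DIM_positive by (metis power_minus_mult)
  finally have vol: "emeasure lborel ?Q = ennreal v"
    by (metis emeasure_eq_ennreal_measure emeasure_lborel_cbox_finite less_irrefl infinity_ennreal_def)
  obtain R where R: "\<And>x. x \<in> ?Q \<Longrightarrow> norm x \<le> R"
    using bounded_cbox[of 0 "c *\<^sub>R One :: (real,'n) vec"] unfolding bounded_iff by blast
  have "compact ((\<lambda>(x, k). dL mul x 0 k) ` (cball 0 (R + 1) \<times> K))"
    unfolding case_prod_beta
    by (intro compact_continuous_image continuous_dL_0 continuous_intros compact_Times compact_cball
        K_compact)
  then have "bounded ((\<lambda>(x, k). dL mul x 0 k) ` (cball 0 (R + 1) \<times> K))" by (rule compact_imp_bounded)
  then obtain M where M: "\<And>y. y \<in> (\<lambda>(x, k). dL mul x 0 k) ` (cball 0 (R + 1) \<times> K) \<Longrightarrow> norm y \<le> M"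
    unfolding bounded_iff by blast
  have "flux ?Q U \<le> real ?d * (2 * M * c ^ (?d - 1))" if U: "U \<in> fields_in K_at" for U
  proof (rule flux_cube_bound[OF c(1) _ _ R])
    show "C_k 1 U" "compactly_supported U" using U by (auto simp: fields_in_def)
    fix x :: "(real,'n) vec" assume x: "norm x \<le> R + 1"
    obtain k where "k \<in> K" "U x = dL mul x 0 k" using U unfolding fields_in_def K_at_def by blast
    then show "norm (U x) \<le> M" using x by (intro M) force
  qed
  then have "variation K_at ?Q \<le> ereal (real ?d * (2 * M * c ^ (?d - 1)))"
    unfolding variation_def by (intro SUP_least) simp
  then have "variation K_at ?Q < \<infinity>" by (rule le_less_trans) simp
  then show thesis using that[of ?Q] vol by simp
qed

lemma variation_nonneg: "0 \<le> variation K_at E"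
proof -
  have "flux E (\<lambda>_. 0) = 0"
    using fderiv_eqI[OF has_derivative_const[of "0 :: (real,'n) vec"]] by (simp add: flux_def trace_div_def)
  then show ?thesis
    unfolding variation_def using SUP_upper[OF zero_field_in, of "\<lambda>U. ereal (flux E U)"]
    by (simp add: zero_ereal_def[symmetric])
qed

section \<open>The isoperimetric profile\<close>

abbreviation profile :: "real \<Rightarrow> ereal" where
  "profile \<equiv> isoperimetric_profile X g K"

lemma profile_le:
  assumes "E \<in> sets borel" "emeasure lborel E = ennreal v" "variation K_at E < \<infinity>"
  shows "profile v \<le> variation K_at E"
  unfolding isoperimetric_profile_def perimeter_borel[OF assms(1), symmetric]
  by (rule INF_lower) (use assms perimeter_borel[OF assms(1)] in \<open>auto simp: finite_perimeter_set_def\<close>)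

lemma profile_greatest:
  assumes "\<And>E. E \<in> sets borel \<Longrightarrow> emeasure lborel E = ennreal v \<Longrightarrow> variation K_at E < \<infinity> \<Longrightarrow> c \<le> variation K_at E"
  shows "c \<le> profile v"
  unfolding isoperimetric_profile_def
proof (rule INF_greatest)
  fix E assume "E \<in> {E. finite_perimeter_set X g K E \<and> emeasure lebesgue E = ennreal v}"
  then have E: "E \<in> sets lebesgue" "perimeter X g K E < \<infinity>" "emeasure lebesgue E = ennreal v"
    by (auto simp: finite_perimeter_set_def)
  obtain E' where E': "E' \<in> sets borel" "emeasure lborel E' = emeasure lebesgue E"
    "perimeter X g K E = perimeter X g K E'" using borel_representative[OF E(1)] .
  show "c \<le> perimeter X g K E"
    using assms[OF E'(1)] E E' perimeter_borel[OF E'(1)] by simp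
qed

lemma profile_nonneg: "0 \<le> profile v"
  by (rule profile_greatest) (rule variation_nonneg)

lemma profile_finite: "v > 0 \<Longrightarrow> profile v < \<infinity>"
  using exists_finite_perimeter_cube[of v] profile_le le_less_trans by metis

text \<open>For a competitor \<open>E\<close> of volume \<open>v\<close> choose a left translate whose overlap with \<open>E\<close> has volume
  \<open>v - w\<close>. The overlap and the union compete for \<open>v - w\<close> and \<open>v + w\<close>, and by submodularity and
  left invariance their perimeters add up to at most twice that of \<open>E\<close>.\<close>

lemma profile_midpoint:
  assumes w: "0 < w" "w < v"
  shows "real_of_ereal (profile (v - w)) + real_of_ereal (profile (v + w)) \<le> 2 * real_of_ereal (profile v)"
proof -
  have real: "profile u = ereal (real_of_ereal (profile u))" if "u > 0" for u
    using profile_nonneg[of u] profile_finite[OF that] by (cases "profile u") auto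
  let ?S = "real_of_ereal (profile (v - w)) + real_of_ereal (profile (v + w))"
  have "ereal (?S / 2) \<le> profile v"
  proof (rule profile_greatest)
    fix E assume E [measurable]: "E \<in> sets borel" and vol: "emeasure lborel E = ennreal v"
      and P: "variation K_at E < \<infinity>"
    have fin: "emeasure lborel E < \<infinity>" using vol by simp
    have mE: "measure lborel E = v" using vol w by (simp add: measure_def)
    obtain a where a: "measure lborel (E \<inter> mul a -` E) = v - w"
      using exists_translate_overlap[OF E fin, of "v - w"] w mE by auto
    let ?F = "mul a -` E"
    have F [measurable]: "?F \<in> sets borel" by (rule measurable_sets_borel[OF borel_measurable_mul E])
    have volF: "emeasure lborel ?F = ennreal v"
      using emeasure_measure_preserving[OF distr_left_mul borel_measurable_mul E] vol by simp
    have finF: "emeasure lborel ?F < \<infinity>" using volF by simp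
    have mF: "measure lborel ?F = v" using volF w by (simp add: measure_def)
    have fm: "E \<in> fmeasurable lborel" "?F \<in> fmeasurable lborel"
      using fin finF by (auto simp: fmeasurable_def)
    have mU: "measure lborel (E \<union> ?F) = v + w"
      using measure_Un3[OF fm] a mE mF by simp
    have volI: "emeasure lborel (E \<inter> ?F) = ennreal (v - w)"
      using emeasure_eq_measure2[OF fmeasurable.Int[OF fm]] a by simp
    have volU: "emeasure lborel (E \<union> ?F) = ennreal (v + w)"
      using emeasure_eq_measure2[OF fmeasurable.Un[OF fm]] mU by simp
    have "variation K_at (E \<inter> ?F) + variation K_at (E \<union> ?F) \<le> variation K_at E + variation K_at ?F"
      by (rule variation_submodular[OF E fin F finF convex_K_at])
    then have sub: "variation K_at (E \<inter> ?F) + variation K_at (E \<union> ?F) \<le> variation K_at E + variation K_at E"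
      by (simp add: variation_left_invariant[OF E fin])
    obtain p where p: "variation K_at E = ereal p"
      using P variation_nonneg[of E] by (cases "variation K_at E") auto
    obtain p1 where p1: "variation K_at (E \<inter> ?F) = ereal p1"
      using sub p variation_nonneg[of "E \<inter> ?F"] variation_nonneg[of "E \<union> ?F"]
      by (cases "variation K_at (E \<inter> ?F)"; cases "variation K_at (E \<union> ?F)") auto
    obtain p2 where p2: "variation K_at (E \<union> ?F) = ereal p2"
      using sub p p1 variation_nonneg[of "E \<union> ?F"] by (cases "variation K_at (E \<union> ?F)") auto
    have "profile (v - w) \<le> ereal p1"
      using profile_le[OF _ volI] p1 by simp
    moreover have "profile (v + w) \<le> ereal p2"
      using profile_le[OF _ volU] p2 by simp
    ultimately have "?S \<le> p1 + p2"
      using real[of "v - w"] real[of "v + w"] w by (metis add_mono add_pos_pos diff_gt_0_iff_gt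
          ereal_less_eq(3) order.strict_trans)
    also have "\<dots> \<le> 2 * p" using sub p p1 p2 by simp
    finally show "ereal (?S / 2) \<le> variation K_at E" using p by simp
  qed
  then have "ereal (?S / 2) \<le> ereal (real_of_ereal (profile v))" using real[of v] w by simp
  then show ?thesis by simp
qed

end

theorem corollary4p6:
  fixes mul :: "real^'n::{finite,linorder} \<Rightarrow> real^'n::{finite,linorder} \<Rightarrow> real^'n::{finite,linorder}"
    and r :: nat
    and X :: "'k::finite \<Rightarrow> (real^'n::{finite,linorder}) vector_field"
    and V :: "real^'n::{finite,linorder} \<Rightarrow> (real^'n::{finite,linorder}) set"
    and g :: "real^'n::{finite,linorder} \<Rightarrow> real^'n::{finite,linorder} \<Rightarrow> real^'n::{finite,linorder} \<Rightarrow> real"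
    and K :: "(real^'n::{finite,linorder}) set"
  assumes "sub_finsler_nilpotent_group mul r X V g K"
  shows "(\<forall>v>0. 0 \<le> isoperimetric_profile X g K v \<and> isoperimetric_profile X g K v < \<infinity>)
    \<and> locally_lipschitz_on {0<..} (\<lambda>v. real_of_ereal (isoperimetric_profile X g K v))"
proof -
  interpret sub_finsler_nilpotent_group mul r X V g K by (rule assms)
  show ?thesis
    using profile_nonneg profile_finite profile_midpoint
    by (intro conjI allI impI locally_lipschitz_if_midpoint_concave) (auto simp: real_of_ereal_pos)
qed

end
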